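(* Assume Conditions C and D. Then for every $\mu\in\mathcal M_d$ the following limits exist $\mathbb P^\mu$-a.s. and the equalities hold: $$v_P:=\lim_{n\to\infty}\frac{\xi_n}{n}=\lim_{n\to\infty}\frac{n}{T_n}=\frac{1}{E_P\big(\pi_\omega\cdot(b_0+a_0b_{-1}+a_0a_{-1}b_{-2}+\cdots)\big)},$$ where $b_n:=\gamma_n\mathbf 1$ (and $1/\infty:=0$).
   Context: Setting. Fix $d\ge 1$, $\mathcal D=\{1,\dots,d\}$. Let $(\mathcal S,\mathcal B)$ be a measurable space, $\Omega=\mathcal S^{\mathbb Z}$ with product $\sigma$-algebra $\mathcal F$, and $P$ a probability measure on $(\Omega,\mathcal F)$ (law of the environment $\omega=(\omega_n)_{n\in\mathbb Z}$) with expectation $E_P$. $\theta:\Omega\to\Omega$ is the shift $(\theta\omega)_n=\omega_{n+1}$. Let $p,q,r$ be measurable functions from $\mathcal S$ to the nonnegative $d\times d$ matrices with $p+q+r$ stochastic; $p_n=p(\omega_n)$, $q_n=q(\omega_n)$, $r_n=r(\omega_n)$. Given $\omega$, the walk $X_t=(\xi_t,Y_t)$, $t\ge0$, is the Markov chain on $\mathbb Z\times\mathcal D$ which from $(n,i)$ jumps to $(n+1,j)$, $(n,j)$, $(n-1,j)$ with probability $p_n(i,j)$, $r_n(i,j)$, $q_n(i,j)$ respectively. $P^i_\omega$ is its law started at $(0,i)$. $\mathcal M_d$ is the set of collections $\mu=(\mu_\omega)_{\omega\in\Omega}$ of probability measures on $\mathcal D$ depending measurably on $\omega$ and only through $(\omega_n)_{n\le0}$.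 $P^\mu_\omega$ is the law of the walk with $\xi_0=0$, $Y_0\sim\mu_\omega$; the annealed law is $\mathbb P^\mu(F\times G)=\int_F P_\omega^\mu(G)\,P(d\omega)$. $T_n=\inf\{t\ge0:\xi_t=n\}$ ($\inf\emptyset=\infty$). For vectors $\|x\|=\max_i|x^i|$, for matrices $\|\cdot\|$ is the induced operator norm; $\mathbf 1=(1,\dots,1)$; $I$ is the identity matrix. $\eta_n(i,j)=P^i_{\theta^n\omega}(T_1<\infty,\ Y_{T_1}=j)$. Condition C: (C1) $(\omega_n)$ is stationary and ergodic under $P$; (C2) $E_P\big(\log\frac1{1-\|r_0+p_0\|}\big)<\infty$ and $E_P\big(\log\frac1{1-\|r_0+q_0\|}\big)<\infty$; (C3) for all $j\in\mathcal D$, $\sum_i q_0(i,j)>0$ and $\sum_i p_0(i,j)>0$, $P$-a.s.; (C4) $P(\eta_0(i,j)>0)=1$ for all $i,j\in\mathcal D$. Under Condition C there is a unique stationary sequence $(\zeta_n)_{n\in\mathbb Z}$ of stochastic matrices (functions of $\omega$) with $\zeta_n=(I-q_n\zeta_{n-1}-r_n)^{-1}p_n$ $P$-a.s. Put $\gamma_n=(I-q_n\zeta_{n-1}-r_n)^{-1}$, $a_n=\gamma_nq_n$, and $\lambda=\lim_n\frac1n E_P(\log\|a_n\cdots a_1\|)$. Condition D: $\lambda<0$. (Under C, D is equivalent to $\xi_n\to+\infty$ a.s. for every starting height, and then $\zeta_n=\eta_n$ $P$-a.s.) $\pi_\omega:=\lim_{n\to\infty}e_i\,\eta_{-n}(\omega)\cdots\eta_{-1}(\omega)$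 (row vector; $e_i$ is the $i$-th standard basis vector); under C and D the limit exists $P$-a.s., does not depend on $i$, and is a strictly positive probability vector on $\mathcal D$; $\pi=(\pi_\omega)\in\mathcal M_d$. *)

theory Defs
  imports "HOL-Probability.Probability"
begin

abbreviation path_space :: "(nat \<Rightarrow> 'a) measure" where
  "path_space \<equiv> PiM UNIV (\<lambda>_. count_space UNIV)"

primrec follow :: "'a \<Rightarrow> (nat \<times> 'a \<Rightarrow> 'a) \<Rightarrow> nat \<Rightarrow> 'a" where
  "follow x Z 0 = x"
| "follow x Z (Suc t) = Z (t, follow x Z t)"

text \<open>The law of the Markov chain with initial distribution \<open>\<nu>\<close> and transition kernel \<open>K\<close>,
  built from independent variables \<open>Z (t, x)\<close> with law \<open>K x\<close>: the chain jumps at time \<open>t\<close> from \<open>x\<close>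
  to \<open>Z (t, x)\<close>. The lemma \<open>emeasure_markov_law_cylinder\<close> below gives its finite-dimensional
  distributions, which determine it.\<close>

definition markov_law :: "'a pmf \<Rightarrow> ('a \<Rightarrow> 'a pmf) \<Rightarrow> (nat \<Rightarrow> 'a) measure" where
  "markov_law \<nu> K =
     distr (measure_pmf \<nu> \<Otimes>\<^sub>M PiM UNIV (\<lambda>(t::nat, x). measure_pmf (K x))) path_space
       (\<lambda>(x, Z). follow x Z)"

definition cylinder :: "nat \<Rightarrow> (nat \<Rightarrow> 'a) \<Rightarrow> (nat \<Rightarrow> 'a) set" where
  "cylinder n x = {X. \<forall>t\<le>n. X t = x t}"

lemma space_path_space [simp]: "space (path_space :: (nat \<Rightarrow> 'a) measure) = UNIV"
  by (simp add: space_PiM)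

lemma sets_markov_law [simp]: "sets (markov_law \<nu> K) = sets path_space"
  by (simp add: markov_law_def)

lemma space_markov_law [simp]: "space (markov_law \<nu> K) = UNIV"
  by (simp add: markov_law_def)

lemma cylinder_sets [measurable]: "cylinder n x \<in> sets (path_space :: (nat \<Rightarrow> 'a::countable) measure)"
proof -
  have "cylinder n x = (\<Inter>t\<in>{..n}. (\<lambda>X. X t) -` {x t} \<inter> space path_space)"
    by (auto simp: cylinder_def)
  also have "\<dots> \<in> sets path_space"
    by (intro sets.finite_INT measurable_sets[OF measurable_component_singleton]) auto
  finally show ?thesis .
qed

lemma follow_measurable:
  fixes \<nu> :: "'a::countable pmf"
  shows "(\<lambda>(x, Z). follow x Z)
    \<in> measurable (measure_pmf \<nu> \<Otimes>\<^sub>M PiM UNIV (\<lambda>(t::nat, x). measure_pmf (K x))) path_space"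
proof -
  let ?M = "measure_pmf \<nu> \<Otimes>\<^sub>M PiM UNIV (\<lambda>(t::nat, x). measure_pmf (K x))"
  have "(\<lambda>w. follow (fst w) (snd w) t) \<in> measurable ?M (count_space UNIV)" for t
  proof (induction t)
    case 0
    have "fst \<in> measurable ?M (measure_pmf \<nu>)" by (rule measurable_fst)
    then show ?case by (simp add: measurable_cong_sets[OF refl sets_measure_pmf_count_space])
  next
    case (Suc t)
    have comp: "(\<lambda>w. snd w (t, y)) \<in> measurable ?M (count_space UNIV)" for y
    proof -
      have "(\<lambda>Z. Z (t, y)) \<in> measurable (PiM UNIV (\<lambda>(t::nat, x). measure_pmf (K x))) (measure_pmf (K y))"
        using measurable_component_singleton[of "(t, y)" UNIV "\<lambda>(t::nat, x). measure_pmf (K x)"] by simp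
      from measurable_compose[OF measurable_snd this]
      show ?thesis by (simp add: measurable_cong_sets[OF refl sets_measure_pmf_count_space])
    qed
    show ?case
      unfolding follow.simps
      by (rule measurable_compose_countable[OF comp Suc])
  qed
  then show ?thesis
    by (intro measurable_PiM_single') (auto simp: split_beta')
qed

lemma prob_space_stack: "prob_space (PiM UNIV (\<lambda>(t::nat, x). measure_pmf (K x)))"
  by (rule prob_space_PiM) (auto split: prod.split intro: prob_space_measure_pmf)

lemma prob_space_markov_law:
  fixes \<nu> :: "'a::countable pmf"
  shows "prob_space (markov_law \<nu> K)"
proof -
  interpret Z: prob_space "PiM UNIV (\<lambda>(t::nat, x). measure_pmf (K x))"
    by (rule prob_space_stack)
  interpret pair_prob_space "measure_pmf \<nu>" "PiM UNIV (\<lambda>(t::nat, x). measure_pmf (K x))" ..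
  show ?thesis
    unfolding markov_law_def by (rule prob_space_distr[OF follow_measurable])
qed

lemma follow_eq_iff:
  "(\<forall>t\<le>n. follow y Z t = x t) \<longleftrightarrow> y = x 0 \<and> (\<forall>t<n. Z (t, x t) = x (Suc t))"
proof (induction n)
  case 0 then show ?case by simp
next
  case (Suc n)
  have "(\<forall>t\<le>Suc n. follow y Z t = x t) \<longleftrightarrow> (\<forall>t\<le>n. follow y Z t = x t) \<and> follow y Z (Suc n) = x (Suc n)"
    by (auto simp del: follow.simps simp: le_Suc_eq)
  also have "\<dots> \<longleftrightarrow> (\<forall>t\<le>n. follow y Z t = x t) \<and> Z (n, x n) = x (Suc n)"
    by auto
  finally show ?case unfolding Suc.IH by (auto simp: less_Suc_eq)
qed

lemma emeasure_markov_law_cylinder: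
  fixes \<nu> :: "'a::countable pmf"
  shows "emeasure (markov_law \<nu> K) (cylinder n x) =
    ennreal (pmf \<nu> (x 0) * (\<Prod>t<n. pmf (K (x t)) (x (Suc t))))"
proof -
  let ?N = "\<lambda>(t::nat, x). measure_pmf (K x)"
  interpret PZ: product_prob_space ?N UNIV
    by (rule product_prob_spaceI) (auto split: prod.split intro: prob_space_measure_pmf)
  interpret Z: prob_space "PiM UNIV ?N"
    by (rule prob_space_stack)
  interpret pair_prob_space "measure_pmf \<nu>" "PiM UNIV ?N" ..
  let ?J = "(\<lambda>t. (t, x t)) ` {..<n}"
  let ?A = "\<lambda>(t, y). {x (Suc t)}"
  let ?E = "prod_emb UNIV ?N ?J (PiE ?J ?A)"
  have E: "?E = {Z. \<forall>t<n. Z (t, x t) = x (Suc t)}"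
    by (auto simp: prod_emb_def space_PiM PiE_iff split: prod.split)
  have Es: "?E \<in> sets (PiM UNIV ?N)"
    by (intro sets_PiM_I) (auto split: prod.split)
  have "emeasure (PiM UNIV ?N) ?E = (\<Prod>j\<in>?J. emeasure (?N j) (?A j))"
    by (intro PZ.emeasure_PiM_emb) (auto split: prod.split)
  also have "\<dots> = (\<Prod>t<n. ennreal (pmf (K (x t)) (x (Suc t))))"
    by (subst prod.reindex) (auto simp: inj_on_def emeasure_pmf_single)
  also have "\<dots> = ennreal (\<Prod>t<n. pmf (K (x t)) (x (Suc t)))"
    by (simp add: prod_ennreal)
  finally have mE: "emeasure (PiM UNIV ?N) ?E = ennreal (\<Prod>t<n. pmf (K (x t)) (x (Suc t)))" .
  have sp: "space (PiM UNIV ?N) = UNIV"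
    by (auto simp: space_PiM PiE_iff split: prod.split)
  have vim: "(\<lambda>(x, Z). follow x Z) -` cylinder n x \<inter> space (measure_pmf \<nu> \<Otimes>\<^sub>M PiM UNIV ?N)
      = {x 0} \<times> ?E"
    unfolding E
    by (rule set_eqI) (simp add: cylinder_def follow_eq_iff space_pair_measure sp[unfolded split_beta'] split_beta' mem_Times_iff)
  have "emeasure (markov_law \<nu> K) (cylinder n x) =
      emeasure (measure_pmf \<nu> \<Otimes>\<^sub>M PiM UNIV ?N) ({x 0} \<times> ?E)"
    unfolding markov_law_def
    by (subst emeasure_distr[OF follow_measurable cylinder_sets]) (simp only: vim)
  also have "\<dots> = emeasure (measure_pmf \<nu>) {x 0} * emeasure (PiM UNIV ?N) ?E"
    by (intro sigma_finite_measure.emeasure_pair_measure_Times[OF prob_space_imp_sigma_finite[OF prob_space_stack]] Es) auto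
  also have "\<dots> = ennreal (pmf \<nu> (x 0) * (\<Prod>t<n. pmf (K (x t)) (x (Suc t))))"
    unfolding mE by (simp add: emeasure_pmf_single ennreal_mult prod_nonneg)
  finally show ?thesis .
qed

lemma cylinder_Int:
  "cylinder n x \<inter> cylinder m y = {} \<or>
   cylinder n x \<inter> cylinder m y = cylinder (max n m) (if n \<le> m then y else x)"
proof (cases "\<forall>t\<le>min n m. x t = y t")
  case True
  then show ?thesis
    by (auto simp: cylinder_def max_def min_def split: if_splits)
next
  case False
  then obtain t where "t \<le> n" "t \<le> m" "x t \<noteq> y t" by auto
  then have "cylinder n x \<inter> cylinder m y = {}"
    by (auto simp: cylinder_def)
  then show ?thesis ..
qed

lemma sets_path_space_cylinder:
  "sets (path_space :: (nat \<Rightarrow> 'a::countable) measure) =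
     sigma_sets UNIV (insert {} (range (\<lambda>(n, x). cylinder n x)))" (is "_ = sigma_sets UNIV ?G")
proof
  have *: "{X. X i \<in> A} \<in> sigma_sets UNIV ?G" for i :: nat and A :: "'a set"
  proof -
    let ?L = "{l :: 'a list. l ! i \<in> A}"
    have "{X. X i \<in> A} = (\<Union>l\<in>?L. cylinder i (\<lambda>t. l ! t))"
    proof (intro equalityI subsetI)
      fix X assume "X \<in> {X. X i \<in> A}"
      then show "X \<in> (\<Union>l\<in>?L. cylinder i (\<lambda>t. l ! t))"
        by (intro UN_I[of "map X [0..<Suc i]"]) (auto simp: cylinder_def simp del: upt_Suc)
    qed (auto simp: cylinder_def)
    moreover have "\<dots> \<in> sigma_sets UNIV ?G"
    proof -
      interpret sigma_algebra UNIV "sigma_sets UNIV ?G"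
        by (rule sigma_algebra_sigma_sets) auto
      show ?thesis
        by (rule countable_UN') (auto intro!: sigma_sets.Basic)
    qed
    ultimately show ?thesis by simp
  qed
  show "sets path_space \<subseteq> sigma_sets UNIV ?G"
    unfolding sets_PiM_single by (simp add: PiE_UNIV_domain) (rule sigma_sets_mono, use * in auto)
  show "sigma_sets UNIV ?G \<subseteq> sets path_space"
    using sets.sigma_sets_subset[of ?G "path_space :: (nat \<Rightarrow> 'a) measure"]
    by (simp add: image_subset_iff split_beta')
qed

lemma markov_law_measurable:
  fixes \<nu> :: "'b \<Rightarrow> 'a::countable pmf"
  assumes [measurable]: "\<And>x. (\<lambda>\<omega>. pmf (\<nu> \<omega>) x) \<in> borel_measurable N"
    and [measurable]: "\<And>x y. (\<lambda>\<omega>. pmf (K \<omega> x) y) \<in> borel_measurable N"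
  shows "(\<lambda>\<omega>. markov_law (\<nu> \<omega>) (K \<omega>)) \<in> measurable N (prob_algebra path_space)"
proof (rule measurable_prob_algebra_generated[where \<Omega> = UNIV
      and G = "insert {} (range (\<lambda>(n, x). cylinder n x))"])
  show "sets path_space = sigma_sets UNIV (insert {} (range (\<lambda>(n, x). cylinder n (x :: nat \<Rightarrow> 'a))))"
    by (rule sets_path_space_cylinder)
  show "Int_stable (insert {} (range (\<lambda>(n, x). cylinder n (x :: nat \<Rightarrow> 'a))))"
  proof (rule Int_stableI)
    fix a b assume "a \<in> insert {} (range (\<lambda>(n, x). cylinder n (x :: nat \<Rightarrow> 'a)))"
      "b \<in> insert {} (range (\<lambda>(n, x). cylinder n (x :: nat \<Rightarrow> 'a)))"
    then consider "a \<inter> b = {}"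
      | n x m y where "a = cylinder n x" "b = cylinder m y"
      by fastforce
    then show "a \<inter> b \<in> insert {} (range (\<lambda>(n, x). cylinder n (x :: nat \<Rightarrow> 'a)))"
    proof cases
      case 2
      then show ?thesis using cylinder_Int[of n x m y]
        by (metis (mono_tags, lifting) case_prod_conv insertCI rangeI)
    qed simp
  qed
  show "prob_space (markov_law (\<nu> \<omega>) (K \<omega>))" for \<omega>
    by (rule prob_space_markov_law)
  fix A assume "A \<in> insert {} (range (\<lambda>(n, x). cylinder n (x :: nat \<Rightarrow> 'a)))"
  then consider "A = {}" | n x where "A = cylinder n x" by auto
  then show "(\<lambda>\<omega>. emeasure (markov_law (\<nu> \<omega>) (K \<omega>)) A) \<in> borel_measurable N"
    by cases (simp_all add: emeasure_markov_law_cylinder)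
qed auto

type_synonym 'd matr = "real ^ 'd ^ 'd"
type_synonym 's env = "int \<Rightarrow> 's"

abbreviation env_space :: "'s measure \<Rightarrow> 's env measure" where
  "env_space S \<equiv> PiM UNIV (\<lambda>_. S)"

definition env_shift :: "int \<Rightarrow> 's env \<Rightarrow> 's env" where
  "env_shift n \<omega> = (\<lambda>m. \<omega> (m + n))"

definition stochastic :: "'d::finite matr \<Rightarrow> bool" where
  "stochastic A \<longleftrightarrow> (\<forall>i j. 0 \<le> A $ i $ j) \<and> (\<forall>i. (\<Sum>j\<in>UNIV. A $ i $ j) = 1)"

definition transition_matrices ::
    "'s measure \<Rightarrow> ('s \<Rightarrow> 'd::finite matr) \<Rightarrow> ('s \<Rightarrow> 'd matr) \<Rightarrow> ('s \<Rightarrow> 'd matr) \<Rightarrow> bool" where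
  "transition_matrices S p q r \<longleftrightarrow>
     p \<in> borel_measurable S \<and> q \<in> borel_measurable S \<and> r \<in> borel_measurable S \<and>
     (\<forall>s\<in>space S. (\<forall>i j. 0 \<le> p s $ i $ j \<and> 0 \<le> q s $ i $ j \<and> 0 \<le> r s $ i $ j) \<and>
        stochastic (p s + q s + r s))"

fun jump_prob ::
    "('s \<Rightarrow> 'd::finite matr) \<Rightarrow> ('s \<Rightarrow> 'd matr) \<Rightarrow> ('s \<Rightarrow> 'd matr) \<Rightarrow> 's env \<Rightarrow>
     int \<times> 'd \<Rightarrow> int \<times> 'd \<Rightarrow> real" where
  "jump_prob p q r \<omega> (n, i) (m, j) =
     (if m = n + 1 then p (\<omega> n) $ i $ j
      else if m = n then r (\<omega> n) $ i $ j
      else if m = n - 1 then q (\<omega> n) $ i $ j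
      else 0)"

definition jump ::
    "('s \<Rightarrow> 'd::finite matr) \<Rightarrow> ('s \<Rightarrow> 'd matr) \<Rightarrow> ('s \<Rightarrow> 'd matr) \<Rightarrow> 's env \<Rightarrow>
     int \<times> 'd \<Rightarrow> (int \<times> 'd) pmf" where
  "jump p q r \<omega> x = embed_pmf (jump_prob p q r \<omega> x)"

definition quenched ::
    "('s \<Rightarrow> 'd::finite matr) \<Rightarrow> ('s \<Rightarrow> 'd matr) \<Rightarrow> ('s \<Rightarrow> 'd matr) \<Rightarrow> 's env \<Rightarrow>
     'd pmf \<Rightarrow> (nat \<Rightarrow> int \<times> 'd) measure" where
  "quenched p q r \<omega> \<nu> = markov_law (map_pmf (\<lambda>i. (0, i)) \<nu>) (jump p q r \<omega>)"

definition initial_laws :: "'s measure \<Rightarrow> ('s env \<Rightarrow> 'd::finite pmf) set" where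
  "initial_laws S =
     {\<mu>. (\<forall>i. (\<lambda>\<omega>. pmf (\<mu> \<omega>) i) \<in> borel_measurable (env_space S)) \<and>
         (\<forall>\<omega>\<in>space (env_space S). \<forall>\<omega>'\<in>space (env_space S).
            (\<forall>n\<le>0. \<omega> n = \<omega>' n) \<longrightarrow> \<mu> \<omega> = \<mu> \<omega>')}"

text \<open>The product rule that characterizes the annealed law is the lemma
  \<open>emeasure_annealed_Times\<close> below.\<close>

definition annealed ::
    "'s env measure \<Rightarrow> ('s \<Rightarrow> 'd::finite matr) \<Rightarrow> ('s \<Rightarrow> 'd matr) \<Rightarrow> ('s \<Rightarrow> 'd matr) \<Rightarrow>
     ('s env \<Rightarrow> 'd pmf) \<Rightarrow> ('s env \<times> (nat \<Rightarrow> int \<times> 'd)) measure" where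
  "annealed P p q r \<mu> =
     P \<bind> (\<lambda>\<omega>. distr (quenched p q r \<omega> (\<mu> \<omega>)) (P \<Otimes>\<^sub>M path_space) (Pair \<omega>))"

lemma pmf_jump:
  fixes p q r :: "'s \<Rightarrow> 'd::finite matr"
  assumes "transition_matrices S p q r" "\<omega> \<in> space (env_space S)"
  shows "pmf (jump p q r \<omega> x) y = jump_prob p q r \<omega> x y"
proof -
  obtain n i where x: "x = (n, i)" by (cases x)
  have \<omega>: "\<omega> n \<in> space S" for n
    using assms(2) by (auto simp: space_PiM)
  have nn: "0 \<le> jump_prob p q r \<omega> x y" for y
    using assms(1) \<omega> by (cases y) (auto simp: x transition_matrices_def)
  let ?F = "{n - 1, n, n + 1} \<times> (UNIV :: 'd set)"
  have supp: "y \<in> ?F" if "jump_prob p q r \<omega> x y \<noteq> 0" for y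
    using that by (cases y) (auto simp: x split: if_splits)
  have "(\<integral>\<^sup>+y. ennreal (jump_prob p q r \<omega> x y) \<partial>count_space UNIV)
      = (\<Sum>y\<in>?F. ennreal (jump_prob p q r \<omega> x y))"
  proof (rule nn_integral_count_space')
    fix y assume "y \<notin> ?F"
    then show "ennreal (jump_prob p q r \<omega> x y) = 0" using supp[of y] by fastforce
  qed auto
  also have "\<dots> = ennreal (\<Sum>y\<in>?F. jump_prob p q r \<omega> x y)"
    by (rule sum_ennreal) (rule nn)
  also have "(\<Sum>y\<in>?F. jump_prob p q r \<omega> x y)
      = (\<Sum>m\<in>{n - 1, n, n + 1}. \<Sum>j\<in>UNIV. jump_prob p q r \<omega> x (m, j))"
    by (simp add: sum.cartesian_product)
  also have "\<dots> = (\<Sum>j\<in>UNIV. (p (\<omega> n) + q (\<omega> n) + r (\<omega> n)) $ i $ j)"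
    by (simp add: x sum.distrib)
  also have "\<dots> = 1"
    using assms(1) \<omega>[of n] by (auto simp: transition_matrices_def stochastic_def)
  finally show ?thesis
    unfolding jump_def by (intro pmf_embed_pmf nn) simp
qed

lemma quenched_measurable:
  fixes p q r :: "'s \<Rightarrow> 'd::finite matr"
  assumes tm: "transition_matrices S p q r"
    and \<mu>[measurable]: "\<And>i. (\<lambda>\<omega>. pmf (\<mu> \<omega>) i) \<in> borel_measurable (env_space S)"
  shows "(\<lambda>\<omega>. quenched p q r \<omega> (\<mu> \<omega>)) \<in> measurable (env_space S) (prob_algebra path_space)"
  unfolding quenched_def
proof (rule markov_law_measurable)
  fix x :: "int \<times> 'd"
  obtain n i where x: "x = (n, i)" by (cases x)
  show "(\<lambda>\<omega>. pmf (map_pmf (\<lambda>i. (0, i)) (\<mu> \<omega>)) x) \<in> borel_measurable (env_space S)"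
  proof (cases "n = 0")
    case True
    have "pmf (map_pmf (\<lambda>i. (0, i)) (\<mu> \<omega>)) x = pmf (\<mu> \<omega>) i" for \<omega>
      unfolding x True by (rule pmf_map_inj') (auto simp: inj_def)
    then show ?thesis by simp
  next
    case False
    then have "pmf (map_pmf (\<lambda>i. (0, i)) (\<mu> \<omega>)) x = 0" for \<omega>
      unfolding x by (auto simp: pmf_eq_0_set_pmf)
    then show ?thesis by simp
  qed
  fix y :: "int \<times> 'd"
  obtain m j where y: "y = (m, j)" by (cases y)
  have *: "(\<lambda>\<omega>. f (\<omega> n) $ i $ j) \<in> borel_measurable (env_space S)"
    if "f \<in> borel_measurable S" for f :: "'s \<Rightarrow> 'd matr"
  proof -
    have "(\<lambda>A :: 'd matr. A $ i $ j) \<in> borel_measurable borel"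
      by (intro borel_measurable_continuous_onI continuous_intros)
    with that show ?thesis by measurable
  qed
  have "(\<lambda>\<omega>. jump_prob p q r \<omega> x y) \<in> borel_measurable (env_space S)"
    using tm * by (auto simp: x y transition_matrices_def)
  then show "(\<lambda>\<omega>. pmf (jump p q r \<omega> x) y) \<in> borel_measurable (env_space S)"
    by (subst measurable_cong[OF pmf_jump[OF tm]]) auto
qed

lemma emeasure_annealed:
  assumes P: "prob_space P" "sets P = sets (env_space S)"
    and tm: "transition_matrices S p q r"
    and \<mu>: "\<mu> \<in> initial_laws S"
    and A [measurable]: "A \<in> sets (P \<Otimes>\<^sub>M path_space)"
  shows "emeasure (annealed P p q r \<mu>) A =
    (\<integral>\<^sup>+\<omega>. emeasure (quenched p q r \<omega> (\<mu> \<omega>)) (Pair \<omega> -` A) \<partial>P)"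
proof -
  interpret prob_space P by fact
  have Q: "(\<lambda>\<omega>. quenched p q r \<omega> (\<mu> \<omega>)) \<in> measurable P (subprob_algebra path_space)"
    using quenched_measurable[OF tm, of \<mu>] \<mu>
    by (auto simp: initial_laws_def measurable_cong_sets[OF P(2) refl] intro: measurable_prob_algebraD)
  have "(\<lambda>\<omega>. distr (quenched p q r \<omega> (\<mu> \<omega>)) (P \<Otimes>\<^sub>M path_space) (Pair \<omega>))
      \<in> measurable P (subprob_algebra (P \<Otimes>\<^sub>M path_space))"
    by (rule measurable_distr2[OF _ Q]) simp
  from emeasure_bind[OF not_empty this A]
  have "emeasure (annealed P p q r \<mu>) A =
     (\<integral>\<^sup>+\<omega>. emeasure (distr (quenched p q r \<omega> (\<mu> \<omega>)) (P \<Otimes>\<^sub>M path_space) (Pair \<omega>)) A \<partial>P)"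
    by (simp add: annealed_def)
  also have "\<dots> = (\<integral>\<^sup>+\<omega>. emeasure (quenched p q r \<omega> (\<mu> \<omega>)) (Pair \<omega> -` A) \<partial>P)"
  proof (rule nn_integral_cong)
    fix \<omega> assume "\<omega> \<in> space P"
    then have "Pair \<omega> \<in> measurable (quenched p q r \<omega> (\<mu> \<omega>)) (P \<Otimes>\<^sub>M path_space)"
      by (simp add: quenched_def measurable_cong_sets[OF sets_markov_law refl])
    from emeasure_distr[OF this A]
    show "emeasure (distr (quenched p q r \<omega> (\<mu> \<omega>)) (P \<Otimes>\<^sub>M path_space) (Pair \<omega>)) A
      = emeasure (quenched p q r \<omega> (\<mu> \<omega>)) (Pair \<omega> -` A)"
      by (simp add: quenched_def)
  qed
  finally show ?thesis .
qed

lemma emeasure_annealed_Times: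
  assumes "prob_space P" "sets P = sets (env_space S)" "transition_matrices S p q r"
    and "\<mu> \<in> initial_laws S" and F: "F \<in> sets P" and G: "G \<in> sets path_space"
  shows "emeasure (annealed P p q r \<mu>) (F \<times> G) =
    (\<integral>\<^sup>+\<omega>\<in>F. emeasure (quenched p q r \<omega> (\<mu> \<omega>)) G \<partial>P)"
  by (subst emeasure_annealed[OF assms(1-4)])
     (use F G in \<open>auto intro!: nn_integral_cong split: split_indicator\<close>)

definition hitting_time :: "(nat \<Rightarrow> int \<times> 'd) \<Rightarrow> int \<Rightarrow> enat" where
  "hitting_time X n = Inf {enat t | t. fst (X t) = n}"

definition eta ::
    "('s \<Rightarrow> 'd::finite matr) \<Rightarrow> ('s \<Rightarrow> 'd matr) \<Rightarrow> ('s \<Rightarrow> 'd matr) \<Rightarrow> int \<Rightarrow> 's env \<Rightarrow> 'd matr" where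
  "eta p q r n \<omega> =
     (\<chi> i j. measure (quenched p q r (env_shift n \<omega>) (return_pmf i))
        {X. hitting_time X 1 < \<infinity> \<and> snd (X (the_enat (hitting_time X 1))) = j})"

text \<open>Matrix norm induced by the maximum norm \<open>infnorm\<close>, in the style of \<open>onorm\<close> (which is
  induced by the Euclidean norm).\<close>

definition max_onorm :: "'d::finite matr \<Rightarrow> real" where
  "max_onorm A = (SUP x. infnorm (A *v x) / infnorm x)"

definition stationary_ergodic :: "'s measure \<Rightarrow> 's env measure \<Rightarrow> bool" where
  "stationary_ergodic S P \<longleftrightarrow>
     distr P (env_space S) (env_shift 1) = P \<and>
     (\<forall>A\<in>sets P. env_shift 1 -` A \<inter> space P = A \<longrightarrow> measure P A = 0 \<or> measure P A = 1)"

text \<open>The function \<open>log (1 / (1 - x))\<close> for \<open>0 \<le> x \<le> 1\<close>, with value \<open>\<infinity>\<close> at 1.\<close>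

definition log_gap :: "real \<Rightarrow> ennreal" where
  "log_gap x = (if x < 1 then ennreal (ln (1 / (1 - x))) else \<infinity>)"

definition condition_C ::
    "'s measure \<Rightarrow> 's env measure \<Rightarrow> ('s \<Rightarrow> 'd::finite matr) \<Rightarrow> ('s \<Rightarrow> 'd matr) \<Rightarrow>
     ('s \<Rightarrow> 'd matr) \<Rightarrow> bool" where
  "condition_C S P p q r \<longleftrightarrow>
     stationary_ergodic S P \<and>
     (\<integral>\<^sup>+\<omega>. log_gap (max_onorm (r (\<omega> 0) + p (\<omega> 0))) \<partial>P) < \<infinity> \<and>
     (\<integral>\<^sup>+\<omega>. log_gap (max_onorm (r (\<omega> 0) + q (\<omega> 0))) \<partial>P) < \<infinity> \<and>
     (\<forall>j. AE \<omega> in P. (\<Sum>i\<in>UNIV. q (\<omega> 0) $ i $ j) > 0 \<and> (\<Sum>i\<in>UNIV. p (\<omega> 0) $ i $ j) > 0) \<and>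
     (\<forall>i j. AE \<omega> in P. eta p q r 0 \<omega> $ i $ j > 0)"

definition gamma ::
    "('s \<Rightarrow> 'd::finite matr) \<Rightarrow> ('s \<Rightarrow> 'd matr) \<Rightarrow> (int \<Rightarrow> 's env \<Rightarrow> 'd matr) \<Rightarrow>
     int \<Rightarrow> 's env \<Rightarrow> 'd matr" where
  "gamma q r \<zeta> n \<omega> = matrix_inv (mat 1 - q (\<omega> n) ** \<zeta> (n - 1) \<omega> - r (\<omega> n))"

text \<open>Stationarity of the sequence \<open>\<zeta>\<close> of functions of the environment means that it commutes
  with the shift, \<open>\<zeta> n (\<theta> \<omega>) = \<zeta> (n + 1) \<omega>\<close>.\<close>

definition stationary_solution ::
    "'s env measure \<Rightarrow> ('s \<Rightarrow> 'd::finite matr) \<Rightarrow> ('s \<Rightarrow> 'd matr) \<Rightarrow> ('s \<Rightarrow> 'd matr) \<Rightarrow>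
     (int \<Rightarrow> 's env \<Rightarrow> 'd matr) \<Rightarrow> bool" where
  "stationary_solution P p q r \<zeta> \<longleftrightarrow>
     (\<forall>n. \<zeta> n \<in> borel_measurable P) \<and>
     (\<forall>n. AE \<omega> in P. stochastic (\<zeta> n \<omega>)) \<and>
     (\<forall>n. AE \<omega> in P. \<zeta> n (env_shift 1 \<omega>) = \<zeta> (n + 1) \<omega>) \<and>
     (\<forall>n. AE \<omega> in P. \<zeta> n \<omega> = gamma q r \<zeta> n \<omega> ** p (\<omega> n))"

definition a_mat ::
    "('s \<Rightarrow> 'd::finite matr) \<Rightarrow> ('s \<Rightarrow> 'd matr) \<Rightarrow> (int \<Rightarrow> 's env \<Rightarrow> 'd matr) \<Rightarrow>
     int \<Rightarrow> 's env \<Rightarrow> 'd matr" where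
  "a_mat q r \<zeta> n \<omega> = gamma q r \<zeta> n \<omega> ** q (\<omega> n)"

definition b_vec ::
    "('s \<Rightarrow> 'd::finite matr) \<Rightarrow> ('s \<Rightarrow> 'd matr) \<Rightarrow> (int \<Rightarrow> 's env \<Rightarrow> 'd matr) \<Rightarrow>
     int \<Rightarrow> 's env \<Rightarrow> real ^ 'd" where
  "b_vec q r \<zeta> n \<omega> = gamma q r \<zeta> n \<omega> *v (\<chi> i. 1)"

text \<open>\<open>left_prod A n = A (n - 1) ** \<dots> ** A 0\<close> and \<open>right_prod A n = A 0 ** \<dots> ** A (n - 1)\<close>.\<close>

primrec left_prod :: "(nat \<Rightarrow> 'd::finite matr) \<Rightarrow> nat \<Rightarrow> 'd matr" where
  "left_prod A 0 = mat 1"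
| "left_prod A (Suc n) = A n ** left_prod A n"

primrec right_prod :: "(nat \<Rightarrow> 'd::finite matr) \<Rightarrow> nat \<Rightarrow> 'd matr" where
  "right_prod A 0 = mat 1"
| "right_prod A (Suc n) = right_prod A n ** A n"

definition condition_D ::
    "'s env measure \<Rightarrow> ('s \<Rightarrow> 'd::finite matr) \<Rightarrow> ('s \<Rightarrow> 'd matr) \<Rightarrow>
     (int \<Rightarrow> 's env \<Rightarrow> 'd matr) \<Rightarrow> bool" where
  "condition_D P q r \<zeta> \<longleftrightarrow>
     (\<exists>l<0. (\<lambda>n. (1 / real n) *
        (\<integral>\<omega>. ln (max_onorm (left_prod (\<lambda>k. a_mat q r \<zeta> (int k + 1) \<omega>) n)) \<partial>P)) \<longlonglongrightarrow> l)"

definition pi_vec ::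
    "('s \<Rightarrow> 'd::finite matr) \<Rightarrow> ('s \<Rightarrow> 'd matr) \<Rightarrow> ('s \<Rightarrow> 'd matr) \<Rightarrow> 's env \<Rightarrow> real ^ 'd" where
  "pi_vec p q r \<omega> =
     (THE v. \<forall>i. (\<lambda>n. axis i 1 v* left_prod (\<lambda>k. eta p q r (- int k - 1) \<omega>) n) \<longlonglongrightarrow> v)"

text \<open>The \<open>i\<close>-th component of the series
  \<open>b\<^sub>0 + a\<^sub>0 b\<^sub>-\<^sub>1 + a\<^sub>0 a\<^sub>-\<^sub>1 b\<^sub>-\<^sub>2 + \<dots>\<close>, which may diverge to \<open>\<infinity>\<close>; under Condition C its terms are
  almost surely nonnegative.\<close>

definition crossing_series ::
    "('s \<Rightarrow> 'd::finite matr) \<Rightarrow> ('s \<Rightarrow> 'd matr) \<Rightarrow> (int \<Rightarrow> 's env \<Rightarrow> 'd matr) \<Rightarrow>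
     's env \<Rightarrow> 'd \<Rightarrow> ennreal" where
  "crossing_series q r \<zeta> \<omega> i =
     (\<Sum>k. ennreal ((right_prod (\<lambda>l. a_mat q r \<zeta> (- int l) \<omega>) k *v b_vec q r \<zeta> (- int k) \<omega>) $ i))"

definition mean_crossing_time ::
    "'s env measure \<Rightarrow> ('s \<Rightarrow> 'd::finite matr) \<Rightarrow> ('s \<Rightarrow> 'd matr) \<Rightarrow> ('s \<Rightarrow> 'd matr) \<Rightarrow>
     (int \<Rightarrow> 's env \<Rightarrow> 'd matr) \<Rightarrow> ennreal" where
  "mean_crossing_time P p q r \<zeta> =
     (\<integral>\<^sup>+\<omega>. (\<Sum>i\<in>UNIV. ennreal (pi_vec p q r \<omega> $ i) * crossing_series q r \<zeta> \<omega> i) \<partial>P)"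

end

theory Submission
  imports Defs
begin

text \<open>
  The recursion for \<open>\<zeta> - \<eta>\<close> multiplies it by the matrix \<open>a\<^sub>n\<close> in each step, so exponential decay
  of the products \<open>a\<^sub>n \<cdots> a\<^sub>1\<close> (Condition D) together with stationarity forces \<open>\<zeta> = \<eta>\<close>: every level is
  reached from below. The vector \<open>a\<^sub>n \<cdots> a\<^bsub>n-k+1\<^esub> b\<^bsub>n-k\<^esub>\<close> consists of the expected numbers of visits to
  level \<open>n - k\<close> before level \<open>n + 1\<close>. Summing over \<open>k\<close> gives the mean crossing time of level \<open>n\<close>, and
  summing over \<open>n\<close> with \<open>n - k = 0\<close> fixed gives transience to the right.

  If the walk starts from \<open>\<pi>\<^sub>\<omega>\<close>, the strong Markov property makes the successive crossing times of levels
  a stationary sequence with mean \<open>E\<^sub>P (\<pi> \<cdot> (b\<^sub>0 + a\<^sub>0 b\<^sub>-\<^sub>1 + \<cdots>))\<close>. Its ergodicity is not needed: the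
  event that \<open>limsup T\<^sub>n / n\<close> exceeds a constant has probability 0 or 1, the same for almost all
  environments and all starting points, by contraction of the positive matrices \<open>\<eta>\<^sub>n\<close> and ergodicity
  of the environment. Hence the one-sided bounds behind Birkhoff's theorem identify
  the limit of \<open>T\<^sub>n / n\<close> for every initial law, and the speed follows pathwise.
\<close>


section \<open>Markov chains on countable state spaces\<close>

text \<open>The mean crossing time may be infinite, so expectations live in \<open>ennreal\<close>,
  where a linear equation does not determine its solution: \<infinity> may solve it too. Truncated
  visit counts therefore supply finiteness before a matrix is inverted. Condition D speaks about
  means of logarithms. It enters through a single \<open>N\<close> with negative mean, which a
  blocking argument turns into pathwise decay. The stationary sequence of crossing times arises by
  integrating out environment and start, so its law could be a mixture and its averages need not
  converge to the mean. What transfers to it are bounds valid for almost every environment and every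
  start. An all-or-nothing event is of this kind: if the limsup exceeded some \<open>c > m\<close>,
  it would do so everywhere, and averaging would give \<open>c \<le> m\<close>. The lower bound
  applies the same argument to negated times. Hitting times alone do not confine the position
  between two new maxima. A walk with unit steps loses at most one level per time unit there, and
  for finite \<open>m\<close> this lasts only a small fraction of \<open>n\<close>. For infinite
  \<open>m\<close> transience gives the lower bound 0.\<close>

lemma measurable_coord [measurable]: "(\<lambda>X. X t) \<in> measurable path_space (count_space UNIV)"
  using measurable_component_singleton[of t UNIV "\<lambda>_. count_space UNIV"] by simp

lemma measurable_coord_fun: "(\<lambda>X. g (X t)) \<in> measurable path_space (count_space UNIV)"
  by (rule measurable_compose[OF measurable_coord]) simp

lemma measurable_coord_fst [measurable]: "(\<lambda>X. fst (X t)) \<in> measurable path_space (count_space UNIV)"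
  and measurable_coord_snd [measurable]: "(\<lambda>X. snd (X t)) \<in> measurable path_space (count_space UNIV)"
  by (rule measurable_coord_fun)+

lemma measurable_path_case_nat [measurable]: "case_nat x \<in> measurable path_space path_space"
proof (rule measurable_PiM_single')
  show "(\<lambda>X. case_nat x X i) \<in> measurable path_space (count_space UNIV)" for i
    by (cases i) auto
qed (auto simp: space_PiM)

definition path_after :: "nat \<Rightarrow> (nat \<Rightarrow> 'a) \<Rightarrow> nat \<Rightarrow> 'a" where
  "path_after t X = (\<lambda>s. X (s + t))"

lemma path_after_measurable [measurable]: "path_after t \<in> measurable path_space path_space"
  unfolding path_after_def by (rule measurable_PiM_single') (auto simp: space_PiM)

lemma path_after_apply [simp]: "path_after t X s = X (s + t)"
  by (simp add: path_after_def)

lemma path_after_0 [simp]: "path_after 0 X = X"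
  by (simp add: path_after_def)

lemma path_after_Suc_case_nat [simp]: "path_after (Suc t) (case_nat x X) = path_after t X"
  by (simp add: path_after_def)

lemma measurable_path_map: "(\<lambda>X s. g (X s)) \<in> measurable path_space path_space"
  by (rule measurable_PiM_single') (auto simp: space_PiM measurable_coord_fun)

definition chain :: "('a \<Rightarrow> 'a pmf) \<Rightarrow> 'a \<Rightarrow> (nat \<Rightarrow> 'a) measure" where
  "chain K x = markov_law (return_pmf x) K"

lemma sets_chain [simp, measurable_cong]: "sets (chain K x) = sets path_space"
  by (simp add: chain_def)

lemma space_chain [simp]: "space (chain K x) = UNIV"
  by (simp add: chain_def)

lemma prob_space_chain: "prob_space (chain K (x :: 'a::countable))"
  by (simp add: chain_def prob_space_markov_law)

lemma emeasure_chain_UNIV [simp]: "emeasure (chain K (x :: 'a::countable)) UNIV = 1"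
  using prob_space.emeasure_space_1[OF prob_space_chain[of K x]] by simp

lemma chain_in_subprob_algebra [simp]:
  "chain K (x :: 'a::countable) \<in> space (subprob_algebra path_space)"
  by (simp add: space_subprob_algebra prob_space_imp_subprob_space prob_space_chain)

lemma distr_chain_case_nat_in_subprob_algebra [simp]:
  "distr (chain K (x :: 'a::countable)) path_space (case_nat z) \<in> space (subprob_algebra path_space)"
  using prob_space_imp_subprob_space[OF prob_space.prob_space_distr[OF prob_space_chain[of K x],
        where f = "case_nat z" and M' = path_space]]
  by (simp add: space_subprob_algebra)

lemma chain_measurable [measurable]:
  "chain K \<in> measurable (measure_pmf \<nu>) (subprob_algebra (path_space :: (nat \<Rightarrow> 'a::countable) measure))"
  by (simp add: measurable_def)

lemma emeasure_chain_cylinder: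
  "emeasure (chain K (x :: 'a::countable)) (cylinder n y) =
     (if y 0 = x then ennreal (\<Prod>t<n. pmf (K (y t)) (y (Suc t))) else 0)"
  by (auto simp: chain_def emeasure_markov_law_cylinder)

text \<open>Cylinders form an intersection-stable generator. The countably many cylinders of length
  0 cover the space, so equality of the total masses need not be assumed.\<close>

lemma path_measure_eqI:
  fixes M N :: "(nat \<Rightarrow> 'a::countable) measure"
  assumes "sets M = sets path_space" "sets N = sets path_space" and "finite_measure M"
    and eq: "\<And>n x. emeasure M (cylinder n x) = emeasure N (cylinder n x)"
  shows "M = N"
proof (rule measure_eqI_generator_eq_countable[where \<Omega> = UNIV
      and E = "insert {} (range (\<lambda>(n, x). cylinder n x))" and A = "range (\<lambda>a. cylinder 0 (\<lambda>_. a))"])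
  show "Int_stable (insert {} (range (\<lambda>(n, x). cylinder n (x :: nat \<Rightarrow> 'a))))"
  proof (rule Int_stableI)
    fix a b assume "a \<in> insert {} (range (\<lambda>(n, x). cylinder n (x :: nat \<Rightarrow> 'a)))"
      "b \<in> insert {} (range (\<lambda>(n, x). cylinder n (x :: nat \<Rightarrow> 'a)))"
    then consider "a \<inter> b = {}"
      | n x m y where "a = cylinder n x" "b = cylinder m y"
      by fastforce
    then show "a \<inter> b \<in> insert {} (range (\<lambda>(n, x). cylinder n (x :: nat \<Rightarrow> 'a)))"
    proof cases
      case 2
      then show ?thesis using cylinder_Int[of n x m y]
        by (metis (mono_tags, lifting) case_prod_conv insertCI rangeI)
    qed simp
  qed
  show "sets M = sigma_sets UNIV (insert {} (range (\<lambda>(n, x). cylinder n (x :: nat \<Rightarrow> 'a))))"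
    "sets N = sigma_sets UNIV (insert {} (range (\<lambda>(n, x). cylinder n (x :: nat \<Rightarrow> 'a))))"
    using assms(1,2) sets_path_space_cylinder by metis+
  show "range (\<lambda>a. cylinder 0 (\<lambda>_. a)) \<subseteq> insert {} (range (\<lambda>(n, x). cylinder n (x :: nat \<Rightarrow> 'a)))"
    by auto
  show "\<Union> (range (\<lambda>a. cylinder 0 (\<lambda>_. a :: 'a))) = UNIV"
    by (auto simp: cylinder_def)
  show "countable (range (\<lambda>a. cylinder 0 (\<lambda>_. a :: 'a)))"
    by simp
qed (use eq finite_measure.emeasure_finite[OF assms(3)] in auto)

text \<open>Reduces random initial states to deterministic ones, so that the Markov property is
  needed only for \<open>chain\<close>.\<close>

lemma markov_law_eq_bind:
  fixes \<nu> :: "'a::countable pmf"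
  shows "markov_law \<nu> K = measure_pmf \<nu> \<bind> chain K"
proof (rule path_measure_eqI)
  show "sets (measure_pmf \<nu> \<bind> chain K) = sets path_space"
    by (rule sets_bind[where N = path_space]) auto
  show "finite_measure (markov_law \<nu> K)"
    using prob_space_markov_law[of \<nu> K] by (simp add: prob_space_def)
  fix n and x :: "nat \<Rightarrow> 'a"
  have "emeasure (measure_pmf \<nu> \<bind> chain K) (cylinder n x)
      = (\<integral>\<^sup>+y. emeasure (chain K y) (cylinder n x) \<partial>measure_pmf \<nu>)"
    by (rule emeasure_bind[where N = path_space]) auto
  also have "\<dots> = (\<integral>\<^sup>+y. ennreal (\<Prod>t<n. pmf (K (x t)) (x (Suc t))) * indicator {x 0} y \<partial>measure_pmf \<nu>)"
    by (intro nn_integral_cong) (auto simp: emeasure_chain_cylinder split: split_indicator)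
  also have "\<dots> = ennreal (\<Prod>t<n. pmf (K (x t)) (x (Suc t))) * ennreal (pmf \<nu> (x 0))"
    by (subst nn_integral_cmult_indicator) (auto simp: emeasure_pmf_single)
  also have "\<dots> = emeasure (markov_law \<nu> K) (cylinder n x)"
    by (simp add: emeasure_markov_law_cylinder ennreal_mult prod_nonneg mult.commute)
  finally show "emeasure (markov_law \<nu> K) (cylinder n x) = emeasure (measure_pmf \<nu> \<bind> chain K) (cylinder n x)"
    by simp
qed simp

text \<open>Markov property at time 1, checked on cylinders. The Markov properties at later and at
  random times are obtained by iterating this one.\<close>

lemma chain_eq_bind:
  fixes x :: "'a::countable"
  shows "chain K x = measure_pmf (K x) \<bind> (\<lambda>y. distr (chain K y) path_space (case_nat x))"
proof (rule path_measure_eqI)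
  have [measurable]: "(\<lambda>y. distr (chain K y) path_space (case_nat x)) \<in> measurable (measure_pmf (K x)) (subprob_algebra path_space)"
    by (simp add: measurable_def)
  show "sets (measure_pmf (K x) \<bind> (\<lambda>y. distr (chain K y) path_space (case_nat x))) = sets path_space"
    by (rule sets_bind[where N = path_space]) auto
  show "finite_measure (chain K x)"
    using prob_space_chain[of K x] by (simp add: prob_space_def)
  fix n and z :: "nat \<Rightarrow> 'a"
  have "emeasure (measure_pmf (K x) \<bind> (\<lambda>y. distr (chain K y) path_space (case_nat x))) (cylinder n z)
      = (\<integral>\<^sup>+y. emeasure (distr (chain K y) path_space (case_nat x)) (cylinder n z) \<partial>measure_pmf (K x))"
    by (rule emeasure_bind[where N = path_space]) auto
  also have "\<dots> = (\<integral>\<^sup>+y. emeasure (chain K y) (case_nat x -` cylinder n z) \<partial>measure_pmf (K x))"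
    by (intro nn_integral_cong, subst emeasure_distr) auto
  also have "\<dots> = emeasure (chain K x) (cylinder n z)"
  proof (cases n)
    case 0
    have "case_nat x -` cylinder n z = (if z 0 = x then UNIV else {})"
      by (auto simp: 0 cylinder_def)
    then show ?thesis by (simp add: emeasure_chain_cylinder 0)
  next
    case (Suc m)
    have "case_nat x -` cylinder n z = (if z 0 = x then cylinder m (\<lambda>t. z (Suc t)) else {})"
      by (auto simp: Suc cylinder_def less_Suc_eq_le[symmetric] All_less_Suc2)
    then have "(\<integral>\<^sup>+y. emeasure (chain K y) (case_nat x -` cylinder n z) \<partial>measure_pmf (K x))
       = (\<integral>\<^sup>+y. (if z 0 = x then ennreal (\<Prod>t<m. pmf (K (z (Suc t))) (z (Suc (Suc t)))) else 0) * indicator {z 1} y \<partial>measure_pmf (K x))"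
      by (intro nn_integral_cong) (auto simp: emeasure_chain_cylinder split: split_indicator)
    also have "\<dots> = (if z 0 = x then ennreal (\<Prod>t<m. pmf (K (z (Suc t))) (z (Suc (Suc t)))) else 0) * ennreal (pmf (K x) (z 1))"
      by (subst nn_integral_cmult_indicator) (auto simp: emeasure_pmf_single)
    also have "\<dots> = emeasure (chain K x) (cylinder n z)"
      by (simp add: emeasure_chain_cylinder Suc prod.lessThan_Suc_shift ennreal_mult prod_nonneg mult.commute del: prod.lessThan_Suc)
    finally show ?thesis .
  qed
  finally show "emeasure (chain K x) (cylinder n z) =
     emeasure (measure_pmf (K x) \<bind> (\<lambda>y. distr (chain K y) path_space (case_nat x))) (cylinder n z)"
    by simp
qed simp

lemma nn_integral_chain_step:
  fixes x :: "'a::countable"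
  assumes [measurable]: "f \<in> borel_measurable path_space"
  shows "(\<integral>\<^sup>+X. f X \<partial>chain K x) = (\<integral>\<^sup>+y. (\<integral>\<^sup>+X. f (case_nat x X) \<partial>chain K y) \<partial>measure_pmf (K x))"
proof -
  have [measurable]: "(\<lambda>y. distr (chain K y) path_space (case_nat x)) \<in> measurable (measure_pmf (K x)) (subprob_algebra path_space)"
    by (simp add: measurable_def)
  have "(\<integral>\<^sup>+X. f X \<partial>chain K x) = (\<integral>\<^sup>+y. (\<integral>\<^sup>+X. f X \<partial>distr (chain K y) path_space (case_nat x)) \<partial>measure_pmf (K x))"
    by (subst chain_eq_bind, rule nn_integral_bind[where B = path_space]) auto
  then show ?thesis
    by (simp add: nn_integral_distr)
qed

lemma AE_chain_step:
  fixes x :: "'a::countable"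
  assumes Q: "Measurable.pred path_space Q"
    and step: "\<And>y. y \<in> set_pmf (K x) \<Longrightarrow> AE X in chain K y. Q (case_nat x X)"
  shows "AE X in chain K x. Q X"
proof -
  have sets: "{X. \<not> Q X} \<in> sets path_space"
    using predE[OF pred_intros_logic(2)[OF Q]] by simp
  have "emeasure (chain K x) {X. \<not> Q X} = (\<integral>\<^sup>+X. indicator {X. \<not> Q X} X \<partial>chain K x)"
    using sets by simp
  also have "\<dots> = (\<integral>\<^sup>+y. (\<integral>\<^sup>+X. indicator {X. \<not> Q X} (case_nat x X) \<partial>chain K y) \<partial>measure_pmf (K x))"
    by (rule nn_integral_chain_step) (rule borel_measurable_indicator[OF sets])
  also have "\<dots> = (\<integral>\<^sup>+y. 0 \<partial>measure_pmf (K x))"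
  proof (rule nn_integral_cong_AE, unfold AE_measure_pmf_iff, intro ballI)
    fix y assume "y \<in> set_pmf (K x)"
    from step[OF this] have "(\<integral>\<^sup>+X. indicator {X. \<not> Q X} (case_nat x X) \<partial>chain K y) = (\<integral>\<^sup>+X. 0 \<partial>chain K y)"
      by (intro nn_integral_cong_AE) (auto elim!: eventually_mono)
    then show "(\<integral>\<^sup>+X. indicator {X. \<not> Q X} (case_nat x X) \<partial>chain K y) = 0" by simp
  qed
  finally show ?thesis
    using sets by (intro AE_I[of _ _ "{X. \<not> Q X}"]) auto
qed

lemma AE_chain_0: "AE X in chain K (x :: 'a::countable). X 0 = x"
  by (rule AE_chain_step, rule measurable_coord_fun) simp

lemma AE_chain_steps:
  fixes x :: "'a::countable"
  shows "AE X in chain K x. \<forall>t. X (Suc t) \<in> set_pmf (K (X t))"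
proof (subst AE_all_countable, rule allI)
  fix t
  have pred: "Measurable.pred path_space (\<lambda>X. X (Suc t) \<in> set_pmf (K (X t)))" for t
    by (rule measurable_compose_countable[where f = "\<lambda>y X. X (Suc t) \<in> set_pmf (K y)", OF measurable_coord_fun measurable_coord])
  show "AE X in chain K x. X (Suc t) \<in> set_pmf (K (X t))"
  proof (induction t arbitrary: x)
    case 0
    show ?case
    proof (rule AE_chain_step, rule pred)
      fix y assume "y \<in> set_pmf (K x)"
      with AE_chain_0[where K = K and x = y] show "AE X in chain K y. case_nat x X (Suc 0) \<in> set_pmf (K (case_nat x X 0))"
        by (auto elim: eventually_mono)
    qed
  next
    case (Suc t)
    show ?case
      by (rule AE_chain_step, rule pred) (simp add: Suc)
  qed
qed

definition first_at :: "'a set \<Rightarrow> nat \<Rightarrow> (nat \<Rightarrow> 'a) \<Rightarrow> bool" where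
  "first_at A t X \<longleftrightarrow> X t \<in> A \<and> (\<forall>s<t. X s \<notin> A)"

lemma first_at_measurable [measurable]: "Measurable.pred path_space (first_at A t)"
proof -
  have [measurable]: "Measurable.pred path_space (\<lambda>X. X s \<in> A)" for s
    by (rule measurable_coord_fun)
  show ?thesis unfolding first_at_def by measurable
qed

lemma first_at_0 [simp]: "first_at A 0 X \<longleftrightarrow> X 0 \<in> A"
  by (simp add: first_at_def)

lemma first_at_Suc_case_nat [simp]:
  "first_at A (Suc t) (case_nat x X) \<longleftrightarrow> x \<notin> A \<and> first_at A t X"
  by (auto simp: first_at_def All_less_Suc2)

lemma first_at_unique: "first_at A t X \<Longrightarrow> first_at A s X \<Longrightarrow> s = t"
  unfolding first_at_def by (metis linorder_neqE_nat)

lemma ex_first_at: "X t \<in> A \<Longrightarrow> \<exists>s\<le>t. first_at A s X"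
  unfolding first_at_def
  by (intro exI[of _ "LEAST t. X t \<in> A"] conjI allI impI)
    (auto intro: LeastI Least_le dest: not_less_Least)

text \<open>Strong Markov property on the event that the entrance happens at time \<open>t\<close>.
  Removing the first step of a path that starts outside \<open>A\<close> turns entrance at
  \<open>Suc t\<close> into entrance at \<open>t\<close>, hence the induction over all starting
  points.\<close>

lemma nn_integral_first_at:
  fixes x :: "'a::countable"
  assumes [measurable]: "f \<in> borel_measurable path_space"
  shows "(\<integral>\<^sup>+X. indicator {X. first_at A t X} X * f (path_after t X) \<partial>chain K x)
    = (\<integral>\<^sup>+X. indicator {X. first_at A t X} X * (\<integral>\<^sup>+X'. f X' \<partial>chain K (X t)) \<partial>chain K x)"
proof (induction t arbitrary: x)
  case 0
  have "(\<integral>\<^sup>+X. indicator {X. first_at A 0 X} X * f (path_after 0 X) \<partial>chain K x)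
     = (\<integral>\<^sup>+X. indicator A x * f X \<partial>chain K x)"
    by (rule nn_integral_cong_AE, rule AE_mp[OF AE_chain_0[where K = K and x = x]])
      (auto intro!: AE_I2 split: split_indicator)
  also have "\<dots> = (\<integral>\<^sup>+X. indicator A x * (\<integral>\<^sup>+X'. f X' \<partial>chain K x) \<partial>chain K x)"
    by (simp add: nn_integral_cmult)
  also have "\<dots> = (\<integral>\<^sup>+X. indicator {X. first_at A 0 X} X * (\<integral>\<^sup>+X'. f X' \<partial>chain K (X 0)) \<partial>chain K x)"
    by (rule nn_integral_cong_AE, rule AE_mp[OF AE_chain_0[where K = K and x = x]])
      (auto intro!: AE_I2 split: split_indicator)
  finally show ?case .
next
  case (Suc t)
  have [measurable]: "(\<lambda>X. \<integral>\<^sup>+X'. f X' \<partial>chain K (X t)) \<in> borel_measurable path_space" for t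
    by (rule measurable_compose[OF measurable_coord]) simp
  have "(\<integral>\<^sup>+X. indicator {X. first_at A (Suc t) X} X * f (path_after (Suc t) X) \<partial>chain K x)
     = (\<integral>\<^sup>+y. \<integral>\<^sup>+X. indicator (- A) x * (indicator {X. first_at A t X} X * f (path_after t X)) \<partial>chain K y \<partial>measure_pmf (K x))"
    by (subst nn_integral_chain_step) (auto intro!: nn_integral_cong split: split_indicator)
  also have "\<dots> = (\<integral>\<^sup>+y. indicator (- A) x * (\<integral>\<^sup>+X. indicator {X. first_at A t X} X * (\<integral>\<^sup>+X'. f X' \<partial>chain K (X t)) \<partial>chain K y) \<partial>measure_pmf (K x))"
    by (subst nn_integral_cmult) (auto simp: Suc)
  also have "\<dots> = (\<integral>\<^sup>+X. indicator {X. first_at A (Suc t) X} X * (\<integral>\<^sup>+X'. f X' \<partial>chain K (X (Suc t))) \<partial>chain K x)"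
    by (subst nn_integral_chain_step, measurable, subst nn_integral_cmult[symmetric])
      (auto intro!: nn_integral_cong split: split_indicator)
  finally show ?case .
qed

lemma distr_chain_map:
  fixes x :: "'a::countable" and \<phi> :: "'a \<Rightarrow> 'b::countable"
  assumes "bij \<phi>" and K: "\<And>x y. pmf (K' (\<phi> x)) (\<phi> y) = pmf (K x) y"
  shows "distr (chain K x) path_space (\<lambda>X t. \<phi> (X t)) = chain K' (\<phi> x)"
proof (rule path_measure_eqI)
  interpret prob_space "chain K x" by (rule prob_space_chain)
  have \<phi>: "(\<lambda>X t. \<phi> (X t)) \<in> measurable (chain K x) path_space"
    by (subst measurable_cong_sets[OF sets_chain refl]) (rule measurable_path_map)
  then have "prob_space (distr (chain K x) path_space (\<lambda>X t. \<phi> (X t)))"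
    by (rule prob_space_distr)
  then show "finite_measure (distr (chain K x) path_space (\<lambda>X t. \<phi> (X t)))"
    by (simp add: prob_space_def)
  fix n and z :: "nat \<Rightarrow> 'b"
  have inv: "\<phi> y = z \<longleftrightarrow> y = inv \<phi> z" for y z
    using assms(1) by (metis bij_inv_eq_iff)
  have vim: "(\<lambda>X t. \<phi> (X t)) -` cylinder n z = cylinder n (\<lambda>t. inv \<phi> (z t))"
    by (auto simp: cylinder_def inv)
  have "pmf (K (inv \<phi> y)) (inv \<phi> y') = pmf (K' y) y'" for y y'
    using K[of "inv \<phi> y" "inv \<phi> y'"] assms(1) by (simp add: bij_is_surj surj_f_inv_f)
  then show "emeasure (distr (chain K x) path_space (\<lambda>X t. \<phi> (X t))) (cylinder n z) = emeasure (chain K' (\<phi> x)) (cylinder n z)"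
    using inv[of x "z 0"] by (subst emeasure_distr[OF \<phi>]) (auto simp: vim emeasure_chain_cylinder)
qed auto

section \<open>Averages along orbits of measure-preserving maps\<close>

locale measure_preserving = prob_space M for M :: "'a measure" +
  fixes T :: "'a \<Rightarrow> 'a"
  assumes T_measurable [measurable]: "T \<in> measurable M M"
    and distr_T: "distr M M T = M"
begin

lemma funpow_T_measurable [measurable]: "T ^^ k \<in> measurable M M"
  by (induction k) (auto intro: measurable_comp)

lemma distr_funpow_T: "distr M M (T ^^ k) = M"
proof (induction k)
  case 0
  then show ?case by (simp add: id_def distr_id)
next
  case (Suc k)
  have "distr M M (T \<circ> (T ^^ k)) = distr (distr M M (T ^^ k)) M T"
    by (rule distr_distr[symmetric]) auto
  then show ?case by (simp add: Suc distr_T o_def)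
qed

lemma nn_integral_funpow_T:
  assumes [measurable]: "f \<in> borel_measurable M"
  shows "(\<integral>\<^sup>+x. f ((T ^^ k) x) \<partial>M) = (\<integral>\<^sup>+x. f x \<partial>M)"
  by (subst (2) distr_funpow_T[of k, symmetric]) (simp add: nn_integral_distr)

lemma AE_funpow_T:
  assumes "AE x in M. Q x"
  shows "AE x in M. Q ((T ^^ k) x)"
proof -
  from assms obtain N where N: "N \<in> null_sets M" "{x \<in> space M. \<not> Q x} \<subseteq> N"
    by (auto simp: eventually_ae_filter)
  from N have "AE x in distr M M (T ^^ k). x \<notin> N"
    by (simp add: distr_funpow_T AE_not_in)
  then have "AE x in M. (T ^^ k) x \<notin> N"
    by (rule AE_distrD[OF funpow_T_measurable])
  then show ?thesis
  proof (rule AE_mp, intro AE_I2 impI)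
    fix x assume x: "x \<in> space M" and "(T ^^ k) x \<notin> N"
    with N(2) measurable_space[OF funpow_T_measurable x] show "Q ((T ^^ k) x)" by blast
  qed
qed

lemma AE_T: "AE x in M. Q x \<Longrightarrow> AE x in M. Q (T x)"
  using AE_funpow_T[of Q 1] by simp

lemma nn_integral_birkhoff_sum:
  assumes [measurable]: "f \<in> borel_measurable M"
  shows "(\<integral>\<^sup>+x. (\<Sum>k<n. f ((T ^^ k) x)) \<partial>M) = of_nat n * (\<integral>\<^sup>+x. f x \<partial>M)"
  by (subst nn_integral_sum) (simp_all add: nn_integral_funpow_T)

lemma birkhoff_sum_add:
  fixes f :: "'a \<Rightarrow> 'b::comm_monoid_add"
  shows "(\<Sum>k<n + m. f ((T ^^ k) x)) = (\<Sum>k<n. f ((T ^^ k) x)) + (\<Sum>k<m. f ((T ^^ k) ((T ^^ n) x)))"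
proof -
  have "(\<Sum>k<n + m. f ((T ^^ k) x)) = (\<Sum>k<n. f ((T ^^ k) x)) + (\<Sum>k=n..<n + m. f ((T ^^ k) x))"
    by (simp add: lessThan_atLeast0 sum.atLeastLessThan_concat)
  also have "(\<Sum>k=n..<n + m. f ((T ^^ k) x)) = (\<Sum>k<m. f ((T ^^ (k + n)) x))"
    using sum.shift_bounds_nat_ivl[of "\<lambda>k. f ((T ^^ k) x)" 0 n m] by (simp add: lessThan_atLeast0 add.commute)
  finally show ?thesis by (simp add: funpow_add)
qed

text \<open>Both bounds follow the argument of Kamae and Katznelson--Weiss: up to a set of small measure
  the time needed to reach the average \<open>c\<close> is bounded by some \<open>N\<close>, so that an orbit segment can be
  cut into pieces of length at most \<open>N\<close> with average at least (at most) \<open>c\<close>.\<close>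

lemma le_nn_integral_if_averages_ge:
  fixes c :: real
  assumes f [measurable]: "f \<in> borel_measurable M" and c: "0 \<le> c"
    and ex: "AE x in M. \<exists>n\<ge>1. ennreal (c * real n) \<le> (\<Sum>k<n. f ((T ^^ k) x))"
  shows "ennreal c \<le> (\<integral>\<^sup>+x. f x \<partial>M)"
proof -
  define S where "S n x = (\<Sum>k<n. f ((T ^^ k) x))" for n x
  have [measurable]: "S n \<in> borel_measurable M" for n
    unfolding S_def by measurable
  define B where "B N = {x\<in>space M. \<forall>n\<in>{1..N}. \<not> ennreal (c * real n) \<le> S n x}" for N
  have B [measurable]: "B N \<in> sets M" for N
    unfolding B_def by measurable
  have bound: "ennreal c \<le> (\<integral>\<^sup>+x. f x \<partial>M) + ennreal c * emeasure M (B N)" if N: "1 \<le> N" for N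
  proof -
    \<comment> \<open>\<open>B N\<close> contains the points that need more than \<open>N\<close>
      steps to reach average \<open>c\<close>. Adding \<open>c\<close> there makes a single step an
      admissible piece, so every orbit can be cut with respect to \<open>g\<close>.\<close>
    define g where "g x = f x + ennreal c * indicator (B N) x" for x
    have [measurable]: "g \<in> borel_measurable M" unfolding g_def by measurable
    have fg: "f x \<le> g x" for x by (simp add: g_def)
    \<comment> \<open>Only the last piece, of length at most \<open>N\<close>, is uncontrolled; its
      cost does not depend on \<open>L\<close>.\<close>
    have cut: "ennreal (c * real L) \<le> (\<Sum>k<L. g ((T ^^ k) x)) + ennreal (c * real N)"
      if "x \<in> space M" for L x
      using that
    proof (induction L arbitrary: x rule: less_induct)
      case (less L)
      show ?case
      proof (cases "L \<le> N")
        case True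
        then have "ennreal (c * real L) \<le> ennreal (c * real N)"
          using c by (intro ennreal_leI mult_left_mono) auto
        then show ?thesis by (simp add: add_increasing)
      next
        case False
        have "\<exists>n\<in>{1..N}. ennreal (c * real n) \<le> (\<Sum>k<n. g ((T ^^ k) x))"
        proof (cases "x \<in> B N")
          case True
          then show ?thesis using N by (intro bexI[of _ 1]) (auto simp: g_def)
        next
          case False
          then obtain n where "n \<in> {1..N}" "ennreal (c * real n) \<le> S n x"
            using less.prems by (auto simp: B_def)
          moreover have "S n x \<le> (\<Sum>k<n. g ((T ^^ k) x))"
            unfolding S_def by (intro sum_mono fg)
          ultimately show ?thesis by (meson order_trans)
        qed
        then obtain n where n: "n \<in> {1..N}" "ennreal (c * real n) \<le> (\<Sum>k<n. g ((T ^^ k) x))" by blast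
        have "(T ^^ n) x \<in> space M" by (rule measurable_space[OF funpow_T_measurable less.prems])
        with less.IH[of "L - n" "(T ^^ n) x"] n False
        have IH: "ennreal (c * real (L - n)) \<le> (\<Sum>k<L - n. g ((T ^^ k) ((T ^^ n) x))) + ennreal (c * real N)"
          by auto
        have "ennreal (c * real L) = ennreal (c * real n) + ennreal (c * real (L - n))"
          using n False c by (subst ennreal_plus[symmetric]) (auto simp: algebra_simps of_nat_diff intro!: mult_left_mono)
        also have "\<dots> \<le> (\<Sum>k<n. g ((T ^^ k) x)) + ((\<Sum>k<L - n. g ((T ^^ k) ((T ^^ n) x))) + ennreal (c * real N))"
          by (intro add_mono n IH)
        also have "\<dots> = (\<Sum>k<n + (L - n). g ((T ^^ k) x)) + ennreal (c * real N)"
          by (simp only: birkhoff_sum_add add.assoc)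
        finally show ?thesis using n False by simp
      qed
    qed
    have int: "ennreal (c * real L) \<le> of_nat L * (\<integral>\<^sup>+x. g x \<partial>M) + ennreal (c * real N)" for L
    proof -
      have "ennreal (c * real L) = (\<integral>\<^sup>+x. ennreal (c * real L) \<partial>M)"
        by (simp add: emeasure_space_1)
      also have "\<dots> \<le> (\<integral>\<^sup>+x. (\<Sum>k<L. g ((T ^^ k) x)) + ennreal (c * real N) \<partial>M)"
        by (intro nn_integral_mono cut)
      also have "\<dots> = of_nat L * (\<integral>\<^sup>+x. g x \<partial>M) + ennreal (c * real N)"
        by (subst nn_integral_add) (simp_all add: nn_integral_birkhoff_sum emeasure_space_1)
      finally show ?thesis .
    qed
    have "ennreal c \<le> (\<integral>\<^sup>+x. g x \<partial>M)"
    proof (rule ccontr)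
      assume "\<not> ennreal c \<le> (\<integral>\<^sup>+x. g x \<partial>M)"
      then have lt: "(\<integral>\<^sup>+x. g x \<partial>M) < ennreal c" by simp
      then obtain G where G: "0 \<le> G" "(\<integral>\<^sup>+x. g x \<partial>M) = ennreal G"
        by (cases "\<integral>\<^sup>+x. g x \<partial>M") auto
      with lt have Gc: "G < c" by (simp add: ennreal_less_iff)
      \<comment> \<open>For this \<open>L\<close> the boundary term \<open>c * N\<close> can no
        longer compensate the deficit \<open>(c - G) * L\<close>.\<close>
      obtain L :: nat where L: "c * real N / (c - G) < real L" using reals_Archimedean2 by blast
      have "ennreal (c * real L) \<le> ennreal (real L * G + c * real N)"
        using int[of L] G c by (simp add: ennreal_of_nat_eq_real_of_nat ennreal_mult ennreal_plus)
      then have "c * real L \<le> real L * G + c * real N"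
        using G c by (subst (asm) ennreal_le_iff) auto
      with L Gc show False by (simp add: field_simps)
    qed
    also have "(\<integral>\<^sup>+x. g x \<partial>M) = (\<integral>\<^sup>+x. f x \<partial>M) + ennreal c * emeasure M (B N)"
      unfolding g_def by (subst nn_integral_add) (auto simp: nn_integral_cmult_indicator)
    finally show ?thesis .
  qed
  \<comment> \<open>The sets \<open>B N\<close> decrease to a null set by \<open>ex\<close>, so the
    correction vanishes in the limit.\<close>
  have "(\<lambda>N. emeasure M (B N)) \<longlonglongrightarrow> emeasure M (\<Inter>N. B N)"
    by (rule Lim_emeasure_decseq) (auto simp: decseq_def B_def)
  moreover have "emeasure M (\<Inter>N. B N) = 0"
  proof -
    have "AE x in M. x \<notin> (\<Inter>N. B N)"
      using ex
    proof (rule AE_mp, intro AE_I2 impI notI)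
      fix x assume "\<exists>n\<ge>1. ennreal (c * real n) \<le> (\<Sum>k<n. f ((T ^^ k) x))" and "x \<in> (\<Inter>N. B N)"
      then obtain n where "1 \<le> n" "ennreal (c * real n) \<le> S n x" "x \<in> B n" by (auto simp: S_def)
      then show False by (auto simp: B_def)
    qed
    then show ?thesis by (subst (asm) AE_iff_null_sets[symmetric]) auto
  qed
  ultimately have "(\<lambda>N. (\<integral>\<^sup>+x. f x \<partial>M) + ennreal c * emeasure M (B N)) \<longlonglongrightarrow> (\<integral>\<^sup>+x. f x \<partial>M) + ennreal c * 0"
    by (intro tendsto_add ennreal_tendsto_cmult tendsto_const) auto
  then show ?thesis
    by (intro LIMSEQ_le_const[of _ _ "ennreal c"]) (auto intro!: bound exI[of _ 1])
qed

lemma nn_integral_le_if_averages_le: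
  fixes c :: real
  assumes f [measurable]: "f \<in> borel_measurable M" and c: "0 \<le> c"
    and ex: "AE x in M. \<exists>n\<ge>1. (\<Sum>k<n. f ((T ^^ k) x)) \<le> ennreal (c * real n)"
  shows "(\<integral>\<^sup>+x. f x \<partial>M) \<le> ennreal c"
proof -
  define S where "S n x = (\<Sum>k<n. f ((T ^^ k) x))" for n x
  have [measurable]: "S n \<in> borel_measurable M" for n
    unfolding S_def by measurable
  define G where "G N = {x\<in>space M. \<exists>n\<in>{1..N}. S n x \<le> ennreal (c * real n)}" for N
  have G [measurable]: "G N \<in> sets M" for N
    unfolding G_def by measurable
  have bound: "(\<integral>\<^sup>+x. f x * indicator (G N) x \<partial>M) \<le> ennreal c" for N
  proof -
    \<comment> \<open>Here \<open>f\<close> is replaced by 0 at the points that need more than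
      \<open>N\<close> steps, so that a single step from such a point has average 0, hence at most
      \<open>c\<close>.\<close>
    define g where "g x = f x * indicator (G N) x" for x
    have [measurable]: "g \<in> borel_measurable M" unfolding g_def by measurable
    have gf: "g x \<le> f x" for x by (simp add: g_def split: split_indicator)
    \<comment> \<open>On \<open>G N\<close> the value \<open>f x\<close> is one summand of a sum
      bounded by \<open>c * n\<close> with \<open>n \<le> N\<close>. The bound controls the last
      piece and makes the integral of \<open>g\<close> finite, which the contradiction below
      requires.\<close>
    have g_le: "g x \<le> ennreal (c * real N)" for x
    proof (cases "x \<in> G N")
      case True
      then obtain n where n: "n \<in> {1..N}" "S n x \<le> ennreal (c * real n)" by (auto simp: G_def)
      then obtain m where m: "n = Suc m" by (cases n) auto
      have "g x \<le> f x" by (rule gf)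
      also have "\<dots> \<le> S n x" unfolding S_def m by (subst sum.lessThan_Suc_shift) (simp add: add_increasing2)
      also have "\<dots> \<le> ennreal (c * real n)" by (rule n)
      also have "\<dots> \<le> ennreal (c * real N)" using n c by (intro ennreal_leI mult_left_mono) auto
      finally show ?thesis .
    qed (simp add: g_def)
    have cut: "(\<Sum>k<L. g ((T ^^ k) x)) \<le> ennreal (c * real L) + of_nat N * ennreal (c * real N)"
      if "x \<in> space M" for L x
      using that
    proof (induction L arbitrary: x rule: less_induct)
      case (less L)
      show ?case
      proof (cases "L \<le> N")
        case True
        have "(\<Sum>k<L. g ((T ^^ k) x)) \<le> (\<Sum>k<L. ennreal (c * real N))" by (intro sum_mono g_le)
        also have "\<dots> = of_nat L * ennreal (c * real N)" by simp
        also have "\<dots> \<le> of_nat N * ennreal (c * real N)" using True by (intro mult_right_mono) auto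
        finally show ?thesis by (simp add: add_increasing)
      next
        case False
        have "\<exists>n. 1 \<le> n \<and> n \<le> L \<and> (\<Sum>k<n. g ((T ^^ k) x)) \<le> ennreal (c * real n)"
        proof (cases "x \<in> G N")
          case False
          then show ?thesis using \<open>\<not> L \<le> N\<close> by (intro exI[of _ 1]) (auto simp: g_def)
        next
          case True
          then obtain n where "n \<in> {1..N}" "S n x \<le> ennreal (c * real n)"
            by (auto simp: G_def)
          moreover have "(\<Sum>k<n. g ((T ^^ k) x)) \<le> S n x"
            unfolding S_def by (intro sum_mono gf)
          ultimately show ?thesis using False by (intro exI[of _ n]) auto
        qed
        then obtain n where n: "1 \<le> n" "n \<le> L" "(\<Sum>k<n. g ((T ^^ k) x)) \<le> ennreal (c * real n)" by blast
        have "(T ^^ n) x \<in> space M" by (rule measurable_space[OF funpow_T_measurable less.prems])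
        with less.IH[of "L - n" "(T ^^ n) x"] n
        have IH: "(\<Sum>k<L - n. g ((T ^^ k) ((T ^^ n) x))) \<le> ennreal (c * real (L - n)) + of_nat N * ennreal (c * real N)"
          by auto
        have "(\<Sum>k<L. g ((T ^^ k) x)) = (\<Sum>k<n + (L - n). g ((T ^^ k) x))" using n by simp
        also have "\<dots> = (\<Sum>k<n. g ((T ^^ k) x)) + (\<Sum>k<L - n. g ((T ^^ k) ((T ^^ n) x)))"
          by (rule birkhoff_sum_add)
        also have "\<dots> \<le> ennreal (c * real n) + (ennreal (c * real (L - n)) + of_nat N * ennreal (c * real N))"
          by (intro add_mono n IH)
        also have "\<dots> = ennreal (c * real L) + of_nat N * ennreal (c * real N)"
          using n c by (subst add.assoc[symmetric], subst ennreal_plus[symmetric]) (auto simp: algebra_simps of_nat_diff intro!: mult_left_mono)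
        finally show ?thesis .
      qed
    qed
    have int: "of_nat L * (\<integral>\<^sup>+x. g x \<partial>M) \<le> ennreal (c * real L) + of_nat N * ennreal (c * real N)" for L
    proof -
      have "of_nat L * (\<integral>\<^sup>+x. g x \<partial>M) = (\<integral>\<^sup>+x. (\<Sum>k<L. g ((T ^^ k) x)) \<partial>M)"
        by (simp add: nn_integral_birkhoff_sum)
      also have "\<dots> \<le> (\<integral>\<^sup>+x. ennreal (c * real L) + of_nat N * ennreal (c * real N) \<partial>M)"
        by (intro nn_integral_mono cut)
      finally show ?thesis by (simp add: emeasure_space_1)
    qed
    have "(\<integral>\<^sup>+x. g x \<partial>M) \<le> (\<integral>\<^sup>+x. ennreal (c * real N) \<partial>M)" by (intro nn_integral_mono g_le)
    then obtain r where r: "0 \<le> r" "(\<integral>\<^sup>+x. g x \<partial>M) = ennreal r"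
      by (cases "\<integral>\<^sup>+x. g x \<partial>M") (auto simp: emeasure_space_1 top_unique)
    have "r \<le> c"
    proof (rule ccontr)
      assume "\<not> r \<le> c"
      then have rc: "c < r" by simp
      obtain L :: nat where L: "real N * (c * real N) / (r - c) < real L" using reals_Archimedean2 by blast
      have "ennreal (real L * r) \<le> ennreal (c * real L + real N * (c * real N))"
        using int[of L] r c by (simp add: ennreal_of_nat_eq_real_of_nat ennreal_mult ennreal_plus)
      then have "real L * r \<le> c * real L + real N * (c * real N)"
        using c by (subst (asm) ennreal_le_iff) auto
      with L rc show False by (simp add: field_simps)
    qed
    then show ?thesis using r c by (simp add: g_def)
  qed
  \<comment> \<open>The sets \<open>G N\<close> increase and cover almost every point, so the bound
    passes to \<open>f\<close> by monotone convergence.\<close>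
  have "(\<integral>\<^sup>+x. f x \<partial>M) = (\<integral>\<^sup>+x. (SUP N. f x * indicator (G N) x) \<partial>M)"
  proof (rule nn_integral_cong_AE, use ex in \<open>rule AE_mp\<close>, intro AE_I2 impI)
    fix x assume x: "x \<in> space M" and "\<exists>n\<ge>1. (\<Sum>k<n. f ((T ^^ k) x)) \<le> ennreal (c * real n)"
    then obtain n where "1 \<le> n" "S n x \<le> ennreal (c * real n)" by (auto simp: S_def)
    with x have n: "x \<in> G n" by (auto simp: G_def intro!: bexI[of _ n])
    show "f x = (SUP N. f x * indicator (G N) x)"
    proof (rule antisym)
      have "f x * indicator (G n) x \<le> (SUP N. f x * indicator (G N) x)" by (rule SUP_upper) simp
      with n show "f x \<le> (SUP N. f x * indicator (G N) x)" by simp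
    qed (auto intro!: SUP_least split: split_indicator)
  qed
  also have "\<dots> = (SUP N. \<integral>\<^sup>+x. f x * indicator (G N) x \<partial>M)"
  proof (rule nn_integral_monotone_convergence_SUP)
    show "incseq (\<lambda>N x. f x * indicator (G N) x)"
      by (auto simp: incseq_def le_fun_def G_def split: split_indicator)
  qed auto
  also have "\<dots> \<le> ennreal c" by (intro SUP_least bound)
  finally show ?thesis .
qed

end

text \<open>This is \<open>limsup s n / n > c\<close>. The margin \<open>1 / Suc m\<close>, fixed
  before \<open>N\<close>, survives bounded changes of \<open>s\<close> and shifts of the index, and
  the countable quantifiers keep the event measurable.\<close>

definition exceeds :: "real \<Rightarrow> (nat \<Rightarrow> real) \<Rightarrow> bool" where
  "exceeds c s \<longleftrightarrow> (\<exists>m::nat. \<forall>N. \<exists>n\<ge>N. (c + 1 / Suc m) * real n < s n)"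

lemma exceeds_measurable [measurable]:
  assumes [measurable]: "\<And>n. (\<lambda>x. s x n) \<in> borel_measurable M"
  shows "Measurable.pred M (\<lambda>x. exceeds c (s x))"
  unfolding exceeds_def by measurable

lemma exceeds_frequently: "exceeds c s \<Longrightarrow> \<exists>n\<ge>N. c * real n < s n"
proof -
  assume "exceeds c s"
  then obtain m n where "n \<ge> N" "(c + 1 / Suc m) * real n < s n" unfolding exceeds_def by blast
  moreover have "c * real n \<le> (c + 1 / Suc m) * real n" by (intro mult_right_mono) auto
  ultimately show ?thesis by (intro exI[of _ n]) auto
qed

lemma not_exceeds_eventually:
  assumes "\<not> exceeds c s" "c < c'"
  shows "\<forall>\<^sub>F n in sequentially. s n \<le> c' * real n"
proof -
  obtain m where m: "1 / Suc m < c' - c" using assms(2) nat_approx_posE[of "c' - c"] by auto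
  from assms(1) obtain N where N: "\<And>n. n \<ge> N \<Longrightarrow> s n \<le> (c + 1 / Suc m) * real n"
    unfolding exceeds_def by (meson not_less)
  show ?thesis
    unfolding eventually_sequentially
  proof (intro exI[of _ N] allI impI)
    fix n assume "N \<le> n"
    then have "s n \<le> (c + 1 / Suc m) * real n" by (rule N)
    also have "\<dots> \<le> c' * real n" using m by (intro mult_right_mono) auto
    finally show "s n \<le> c' * real n" .
  qed
qed

text \<open>Half of the margin is spent on the constant \<open>C\<close> and on moving the index by
  at most one; the other half remains.\<close>

lemma exceeds_perturb:
  assumes "exceeds c s"
    and near: "\<And>n. n \<ge> n0 \<Longrightarrow> \<exists>n'. n \<le> n' + 1 \<and> n' \<le> n + 1 \<and> s n - C \<le> s' n'"
  shows "exceeds c s'"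
proof -
  obtain m where m: "\<And>N. \<exists>n\<ge>N. (c + 1 / Suc m) * real n < s n"
    using assms(1) unfolding exceeds_def by blast
  \<comment> \<open>Half of the given margin, again of the form \<open>1 / Suc _\<close> because
    \<open>Suc (2 * m + 1) = 2 * Suc m\<close>.\<close>
  define \<delta> where "\<delta> = 1 / real (Suc (2 * m + 1))"
  have \<delta>: "\<delta> > 0" "1 / real (Suc m) = 2 * \<delta>" by (auto simp: \<delta>_def field_simps)
  show ?thesis
    unfolding exceeds_def
  proof (rule exI[of _ "2 * m + 1"], rule allI, fold \<delta>_def)
    fix N
    \<comment> \<open>From \<open>K\<close> on, \<open>\<delta> * n\<close> outweighs
      \<open>C\<close> together with the cost \<open>\<bar>c + \<delta>\<bar>\<close> of replacing
      \<open>n\<close> by \<open>n'\<close>.\<close>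
    obtain K :: nat where K: "(C + \<bar>c + \<delta>\<bar>) / \<delta> < real K" using reals_Archimedean2 by blast
    obtain n where n: "n \<ge> max (max n0 (N + 1)) K" "(c + 1 / Suc m) * real n < s n" using m by blast
    obtain n' where n': "n \<le> n' + 1" "n' \<le> n + 1" "s n - C \<le> s' n'" using near[of n] n by auto
    have "C + \<bar>c + \<delta>\<bar> < \<delta> * real K" using K \<delta> by (simp add: field_simps)
    also have "\<dots> \<le> \<delta> * real n" using n \<delta> by (intro mult_left_mono) auto
    finally have 1: "C + \<bar>c + \<delta>\<bar> < \<delta> * real n" .
    have "\<bar>(c + \<delta>) * (real n' - real n)\<bar> \<le> \<bar>c + \<delta>\<bar> * 1"
      unfolding abs_mult using n' by (intro mult_left_mono) auto
    then have 2: "(c + \<delta>) * real n' \<le> (c + \<delta>) * real n + \<bar>c + \<delta>\<bar>"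
      by (simp add: algebra_simps)
    have 3: "c * real n + 2 * (\<delta> * real n) < s n"
      using n(2) unfolding \<delta>(2) by (simp add: algebra_simps)
    have "(c + \<delta>) * real n' < s' n'"
      using 1 2 3 n'(3) by (simp add: algebra_simps)
    then show "\<exists>n\<ge>N. (c + \<delta>) * real n < s' n"
      using n n' by (intro exI[of _ n']) auto
  qed
qed

lemma exceeds_cong_shift: "exceeds c (\<lambda>n. s (Suc n) + C) \<longleftrightarrow> exceeds c s"
proof
  assume "exceeds c (\<lambda>n. s (Suc n) + C)"
  then show "exceeds c s"
  proof (rule exceeds_perturb[of _ _ 0 C])
    fix n :: nat
    show "\<exists>n'. n \<le> n' + 1 \<and> n' \<le> n + 1 \<and> s (Suc n) + C - C \<le> s n'"
      by (intro exI[of _ "Suc n"]) auto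
  qed
next
  assume "exceeds c s"
  then show "exceeds c (\<lambda>n. s (Suc n) + C)"
  proof (rule exceeds_perturb[of _ _ 1 "- C"])
    fix n :: nat assume "1 \<le> n"
    then show "\<exists>n'. n \<le> n' + 1 \<and> n' \<le> n + 1 \<and> s n - (- C) \<le> s (Suc n') + C"
      by (intro exI[of _ "n - 1"]) auto
  qed
qed

lemma exceeds_cong_eventually:
  assumes "\<And>n. n \<ge> n0 \<Longrightarrow> s' n = s n + C"
  shows "exceeds c s' \<longleftrightarrow> exceeds c s"
proof
  assume "exceeds c s'"
  then show "exceeds c s"
  proof (rule exceeds_perturb[of _ _ n0 C])
    fix n assume "n0 \<le> n"
    with assms show "\<exists>n'. n \<le> n' + 1 \<and> n' \<le> n + 1 \<and> s' n - C \<le> s n'"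
      by (intro exI[of _ n]) auto
  qed
next
  assume "exceeds c s"
  then show "exceeds c s'"
  proof (rule exceeds_perturb[of _ _ n0 "- C"])
    fix n assume "n0 \<le> n"
    with assms show "\<exists>n'. n \<le> n' + 1 \<and> n' \<le> n + 1 \<and> s n - (- C) \<le> s' n'"
      by (intro exI[of _ n]) auto
  qed
qed

section \<open>Zero-one law, recurrence and upper Birkhoff bounds for ergodic maps\<close>

locale ergodic_system = measure_preserving +
  assumes ergodic: "A \<in> sets M \<Longrightarrow> T -` A \<inter> space M = A \<Longrightarrow> prob A = 0 \<or> prob A = 1"
begin

text \<open>Ergodicity is assumed for strictly invariant sets, while \<open>Q\<close> is invariant
  only almost surely. The set \<open>A\<close> of points whose orbit satisfies \<open>Q\<close>
  infinitely often is strictly invariant and agrees with \<open>Q\<close> up to a null set.\<close>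

lemma AE_zero_one:
  assumes Q [measurable]: "Measurable.pred M Q" and inv: "AE x in M. Q (T x) \<longleftrightarrow> Q x"
  shows "(AE x in M. Q x) \<or> (AE x in M. \<not> Q x)"
proof -
  define A where "A = {x\<in>space M. \<forall>N. \<exists>n\<ge>N. Q ((T ^^ n) x)}"
  have [measurable]: "Measurable.pred M (\<lambda>x. Q ((T ^^ n) x))" for n
    by (rule measurable_compose[OF funpow_T_measurable Q])
  have A [measurable]: "A \<in> sets M" unfolding A_def by measurable
  have "T -` A \<inter> space M = A"
  proof -
    have "(\<forall>N. \<exists>n\<ge>N. Q ((T ^^ n) (T x))) \<longleftrightarrow> (\<forall>N. \<exists>n\<ge>N. Q ((T ^^ n) x))" for x
      unfolding funpow_Suc_right[THEN fun_cong, unfolded comp_def, symmetric]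
      by (metis Suc_leD Suc_le_D Suc_le_mono)
    then show ?thesis using measurable_space[OF T_measurable] by (auto simp: A_def)
  qed
  from ergodic[OF A this] have 01: "prob A = 0 \<or> prob A = 1" .
  have "AE x in M. \<forall>n. Q ((T ^^ n) (T x)) \<longleftrightarrow> Q ((T ^^ n) x)"
    unfolding AE_all_countable
    using AE_funpow_T[OF inv] by (simp add: funpow_swap1)
  then have AQ: "AE x in M. x \<in> A \<longleftrightarrow> Q x"
  proof (rule AE_mp, intro AE_I2 impI)
    fix x assume x: "x \<in> space M" and *: "\<forall>n. Q ((T ^^ n) (T x)) \<longleftrightarrow> Q ((T ^^ n) x)"
    have "Q ((T ^^ n) x) \<longleftrightarrow> Q x" for n
      by (induction n) (use * in \<open>auto simp: funpow_swap1\<close>)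
    then show "x \<in> A \<longleftrightarrow> Q x" using x by (auto simp: A_def)
  qed
  show ?thesis
  proof (cases "prob A = 1")
    case True
    then have "AE x in M. x \<in> A" by (simp add: prob_eq_1)
    with AQ have "AE x in M. Q x" by eventually_elim auto
    then show ?thesis ..
  next
    case False
    with 01 have "AE x in M. x \<notin> A" by (simp add: prob_eq_0)
    with AQ have "AE x in M. \<not> Q x" by eventually_elim auto
    then show ?thesis ..
  qed
qed

text \<open>The event is strictly invariant, hence has probability 0 or 1. Probability 0 is
  impossible: the decreasing sets \<open>D N\<close> would have measure tending to 0, but each
  contains a preimage of \<open>Q\<close> under \<open>T ^^ N\<close>, which has the fixed positive
  measure of \<open>Q\<close>.\<close>

lemma AE_infinitely_often:
  assumes Q [measurable]: "Measurable.pred M Q" and pos: "\<not> (AE x in M. \<not> Q x)"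
  shows "AE x in M. \<forall>N. \<exists>n\<ge>N. Q ((T ^^ n) x)"
proof -
  have [measurable]: "Measurable.pred M (\<lambda>x. Q ((T ^^ n) x))" for n
    by (rule measurable_compose[OF funpow_T_measurable Q])
  define R where "R x \<longleftrightarrow> (\<forall>N. \<exists>n\<ge>N. Q ((T ^^ n) x))" for x
  have R [measurable]: "Measurable.pred M R" unfolding R_def by measurable
  have "R (T x) \<longleftrightarrow> R x" for x
    unfolding R_def funpow_Suc_right[THEN fun_cong, unfolded comp_def, symmetric]
    by (metis Suc_leD Suc_le_D Suc_le_mono)
  then have "(AE x in M. R x) \<or> (AE x in M. \<not> R x)" by (intro AE_zero_one) auto
  moreover have "\<not> (AE x in M. \<not> R x)"
  proof
    assume nR: "AE x in M. \<not> R x"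
    define D where "D N = {x\<in>space M. \<exists>n\<ge>N. Q ((T ^^ n) x)}" for N
    have D [measurable]: "D N \<in> sets M" for N unfolding D_def by measurable
    have "(\<lambda>N. emeasure M (D N)) \<longlonglongrightarrow> emeasure M (\<Inter>N. D N)"
      by (rule Lim_emeasure_decseq) (auto simp: decseq_def D_def intro: order_trans)
    moreover have "emeasure M (\<Inter>N. D N) = 0"
    proof -
      have "AE x in M. x \<notin> (\<Inter>N. D N)"
        using nR by (rule AE_mp) (auto simp: D_def R_def intro!: AE_I2)
      then show ?thesis by (subst (asm) AE_iff_null_sets[symmetric]) auto
    qed
    ultimately have lim: "(\<lambda>N. emeasure M (D N)) \<longlonglongrightarrow> 0" by simp
    have "emeasure M {x\<in>space M. Q x} \<le> emeasure M (D N)" for N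
    proof -
      have "emeasure M {x\<in>space M. Q x} = emeasure (distr M M (T ^^ N)) {x\<in>space M. Q x}"
        by (simp add: distr_funpow_T)
      also have "\<dots> = emeasure M ((T ^^ N) -` {x\<in>space M. Q x} \<inter> space M)"
        by (rule emeasure_distr) auto
      also have "\<dots> \<le> emeasure M (D N)"
        by (rule emeasure_mono) (auto simp: D_def)
      finally show ?thesis .
    qed
    with LIMSEQ_le_const[OF lim] have "emeasure M {x\<in>space M. Q x} \<le> 0" by blast
    then have "AE x in M. \<not> Q x" by (intro AE_I[of _ _ "{x\<in>space M. Q x}"]) auto
    with pos show False ..
  qed
  ultimately show ?thesis by (simp add: R_def)
qed

text \<open>Having a limsup of averages above \<open>c0\<close> is an invariant event. If it had
  probability 1, the averaging bound would make the integral at least \<open>c0\<close>.\<close>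

lemma AE_birkhoff_sum_le_nonneg:
  fixes g :: "'a \<Rightarrow> real"
  assumes [measurable]: "g \<in> borel_measurable M" and nonneg: "\<And>x. 0 \<le> g x"
    and less: "(\<integral>\<^sup>+x. ennreal (g x) \<partial>M) < ennreal c"
  shows "AE x in M. \<forall>\<^sub>F n in sequentially. (\<Sum>k<n. g ((T ^^ k) x)) \<le> c * real n"
proof -
  \<comment> \<open>Room on both sides: \<open>c0\<close> above the integral for the contradiction,
    below \<open>c\<close> because failure of \<open>exceeds c0\<close> gives an eventual bound only
    for larger constants.\<close>
  obtain c0 where c0: "(\<integral>\<^sup>+x. ennreal (g x) \<partial>M) < ennreal c0" "0 < c0" "c0 < c"
  proof -
    obtain d where d: "0 \<le> d" "(\<integral>\<^sup>+x. ennreal (g x) \<partial>M) = ennreal d"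
      using less by (cases "\<integral>\<^sup>+x. ennreal (g x) \<partial>M") auto
    with less have "d < c" by (simp add: ennreal_less_iff)
    with d that[of "(d + c) / 2"] show ?thesis by (auto simp: ennreal_less_iff)
  qed
  define Q where "Q x \<longleftrightarrow> exceeds c0 (\<lambda>n. \<Sum>k<n. g ((T ^^ k) x))" for x
  have [measurable]: "Measurable.pred M Q" unfolding Q_def by measurable
  have "Q (T x) \<longleftrightarrow> Q x" for x
  proof -
    have "(\<Sum>k<n. g ((T ^^ k) (T x))) = (\<Sum>k<Suc n. g ((T ^^ k) x)) + (- g x)" for n
      by (subst sum.lessThan_Suc_shift) (simp add: funpow_swap1)
    then show ?thesis unfolding Q_def using exceeds_cong_shift[of c0 "\<lambda>n. \<Sum>k<n. g ((T ^^ k) x)" "- g x"] by simp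
  qed
  then have "(AE x in M. Q x) \<or> (AE x in M. \<not> Q x)" by (intro AE_zero_one) auto
  moreover have "\<not> (AE x in M. Q x)"
  proof
    assume "AE x in M. Q x"
    then have "AE x in M. \<exists>n\<ge>1. ennreal (c0 * real n) \<le> (\<Sum>k<n. ennreal (g ((T ^^ k) x)))"
    proof eventually_elim
      case (elim x)
      from exceeds_frequently[OF this[unfolded Q_def], of 1] obtain n
        where "n \<ge> 1" "c0 * real n < (\<Sum>k<n. g ((T ^^ k) x))" by blast
      then show ?case by (intro exI[of _ n]) (auto simp: sum_ennreal nonneg intro!: ennreal_leI)
    qed
    with le_nn_integral_if_averages_ge[of "\<lambda>x. ennreal (g x)" c0] c0 show False by auto
  qed
  ultimately have "AE x in M. \<not> Q x" by blast
  then show ?thesis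
    by eventually_elim (use c0 not_exceeds_eventually in \<open>auto simp: Q_def\<close>)
qed

text \<open>Truncation at \<open>- m\<close> from below increases the sums and changes the mean
  arbitrarily little for large \<open>m\<close>; adding \<open>m\<close> then reduces to the
  nonnegative case.\<close>

lemma AE_birkhoff_sum_le:
  fixes g :: "'a \<Rightarrow> real"
  assumes g: "integrable M g" and less: "(\<integral>x. g x \<partial>M) < c"
  shows "AE x in M. \<forall>\<^sub>F n in sequentially. (\<Sum>k<n. g ((T ^^ k) x)) \<le> c * real n"
proof -
  have [measurable]: "g \<in> borel_measurable M" using g by auto
  have "(\<lambda>m. \<integral>x. max (g x) (- real m) \<partial>M) \<longlonglongrightarrow> (\<integral>x. g x \<partial>M)"
  proof (rule integral_dominated_convergence[where w = "\<lambda>x. \<bar>g x\<bar>"])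
    show "AE x in M. (\<lambda>m. max (g x) (- real m)) \<longlonglongrightarrow> g x"
    proof (rule AE_I2, rule tendsto_eventually)
      fix x
      obtain m :: nat where "- g x \<le> real m" using real_arch_simple by blast
      then show "\<forall>\<^sub>F m in sequentially. max (g x) (- real m) = g x"
        unfolding eventually_sequentially by (intro exI[of _ m]) auto
    qed
  qed (use g in auto)
  from order_tendstoD(2)[OF this less] obtain m :: nat where m: "(\<integral>x. max (g x) (- real m) \<partial>M) < c"
    by (auto simp: eventually_sequentially)
  define h where "h x = max (g x) (- real m) + real m" for x
  have h0: "0 \<le> h x" for x by (auto simp: h_def)
  have int: "integrable M (\<lambda>x. max (g x) (- real m))" using g by auto
  have "(\<integral>\<^sup>+x. ennreal (h x) \<partial>M) = ennreal (\<integral>x. h x \<partial>M)"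
    using int h0 by (intro nn_integral_eq_integral) (auto simp: h_def)
  also have "(\<integral>x. h x \<partial>M) = (\<integral>x. max (g x) (- real m) \<partial>M) + real m"
    unfolding h_def using int by (simp add: prob_space)
  also have "ennreal \<dots> < ennreal (c + real m)"
    using m h0 Bochner_Integration.integral_nonneg[of M h] \<open>(\<integral>x. h x \<partial>M) = _\<close> by (intro ennreal_lessI) auto
  finally have "AE x in M. \<forall>\<^sub>F n in sequentially. (\<Sum>k<n. h ((T ^^ k) x)) \<le> (c + real m) * real n"
    by (intro AE_birkhoff_sum_le_nonneg h0) (auto simp: h_def)
  then show ?thesis
  proof eventually_elim
    case (elim x)
    then show ?case
    proof eventually_elim
      case (elim n)
      have "(\<Sum>k<n. g ((T ^^ k) x)) \<le> (\<Sum>k<n. h ((T ^^ k) x) - real m)"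
        by (intro sum_mono) (auto simp: h_def)
      then show ?case using elim by (simp add: sum_subtractf algebra_simps)
    qed
  qed
qed

end

section \<open>Nonnegative matrices\<close>

lemma infnorm_cart_leI:
  fixes x :: "real ^ 'n::finite"
  assumes "\<And>i. \<bar>x $ i\<bar> \<le> B"
  shows "infnorm x \<le> B"
  unfolding infnorm_cart by (rule cSup_least) (use assms in auto)

lemma max_onorm_bdd_above:
  fixes A :: "'n::finite matr"
  shows "bdd_above (range (\<lambda>x. infnorm (A *v x) / infnorm x))"
proof (rule bdd_aboveI2)
  fix x
  let ?B = "\<Sum>i\<in>UNIV. \<Sum>j\<in>UNIV. \<bar>A $ i $ j\<bar>"
  have "infnorm (A *v x) \<le> ?B * infnorm x"
  proof (rule infnorm_cart_leI)
    fix i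
    have "\<bar>(A *v x) $ i\<bar> \<le> (\<Sum>j\<in>UNIV. \<bar>A $ i $ j\<bar> * infnorm x)"
      unfolding matrix_vector_mult_def
      by (auto intro!: order_trans[OF sum_abs] sum_mono mult_left_mono simp: abs_mult component_le_infnorm_cart)
    also have "\<dots> = (\<Sum>j\<in>UNIV. \<bar>A $ i $ j\<bar>) * infnorm x" by (simp add: sum_distrib_right)
    also have "\<dots> \<le> ?B * infnorm x"
      by (intro mult_right_mono member_le_sum[of i UNIV "\<lambda>i. \<Sum>j\<in>UNIV. \<bar>A $ i $ j\<bar>"]) (auto simp: infnorm_pos_le sum_nonneg)
    finally show "\<bar>(A *v x) $ i\<bar> \<le> ?B * infnorm x" .
  qed
  then show "infnorm (A *v x) / infnorm x \<le> ?B"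
    by (cases "infnorm x = 0") (auto simp: divide_le_eq infnorm_pos_le sum_nonneg order_less_le)
qed

lemma infnorm_mult_le_max_onorm:
  fixes A :: "'n::finite matr"
  shows "infnorm (A *v x) \<le> max_onorm A * infnorm x"
proof (cases "x = 0")
  case False
  have "infnorm (A *v x) / infnorm x \<le> max_onorm A"
    unfolding max_onorm_def by (intro cSUP_upper max_onorm_bdd_above) auto
  then show ?thesis using False by (simp add: divide_le_eq infnorm_pos_lt)
qed (simp add: infnorm_0)

lemma max_onorm_leI:
  fixes A :: "'n::finite matr"
  assumes "0 \<le> K" "\<And>x. infnorm (A *v x) \<le> K * infnorm x"
  shows "max_onorm A \<le> K"
  unfolding max_onorm_def
  using assms by (intro cSUP_least) (auto simp: divide_le_eq infnorm_pos_le order_less_le infnorm_eq_0)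

lemma max_onorm_nonneg: "0 \<le> max_onorm (A :: 'n::finite matr)"
proof -
  have "infnorm (A *v 0) / infnorm (0 :: real ^ 'n) \<le> max_onorm A"
    unfolding max_onorm_def by (intro cSUP_upper max_onorm_bdd_above) auto
  then show ?thesis by (simp add: infnorm_0)
qed

lemma max_onorm_mult: "max_onorm (A ** B) \<le> max_onorm A * max_onorm (B :: 'n::finite matr)"
proof (rule max_onorm_leI)
  fix x
  have "infnorm ((A ** B) *v x) \<le> max_onorm A * infnorm (B *v x)"
    by (simp add: matrix_vector_mul_assoc[symmetric] infnorm_mult_le_max_onorm)
  also have "\<dots> \<le> max_onorm A * (max_onorm B * infnorm x)"
    by (intro mult_left_mono infnorm_mult_le_max_onorm max_onorm_nonneg)
  finally show "infnorm ((A ** B) *v x) \<le> max_onorm A * max_onorm B * infnorm x" by (simp add: mult.assoc)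
qed (simp add: max_onorm_nonneg)

lemma max_onorm_mat_1_le: "max_onorm (mat 1 :: 'n::finite matr) \<le> 1"
  by (rule max_onorm_leI) auto

definition nonneg_matrix :: "'n::finite matr \<Rightarrow> bool" where
  "nonneg_matrix A \<longleftrightarrow> (\<forall>i j. 0 \<le> A $ i $ j)"

definition row_sum :: "'n::finite matr \<Rightarrow> 'n \<Rightarrow> real" where
  "row_sum A i = (\<Sum>j\<in>UNIV. A $ i $ j)"

lemma stochastic_iff: "stochastic A \<longleftrightarrow> nonneg_matrix A \<and> (\<forall>i. row_sum A i = 1)"
  by (simp add: stochastic_def nonneg_matrix_def row_sum_def)

lemma row_sum_eq_mult_one: "row_sum A i = (A *v (\<chi> i. 1)) $ i"
  by (simp add: row_sum_def matrix_vector_mult_def)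

lemma row_sum_add: "row_sum (A + B) i = row_sum A i + row_sum B i"
  by (simp add: row_sum_def sum.distrib)

lemma row_sum_nonneg: "nonneg_matrix A \<Longrightarrow> 0 \<le> row_sum A i"
  by (auto simp: row_sum_def nonneg_matrix_def intro: sum_nonneg)

lemma nonneg_matrix_add: "nonneg_matrix A \<Longrightarrow> nonneg_matrix B \<Longrightarrow> nonneg_matrix (A + B)"
  by (simp add: nonneg_matrix_def)

lemma nonneg_matrix_mult: "nonneg_matrix A \<Longrightarrow> nonneg_matrix B \<Longrightarrow> nonneg_matrix (A ** B)"
  by (auto simp: nonneg_matrix_def matrix_matrix_mult_def intro!: sum_nonneg)

lemma mult_vec_mono:
  assumes "nonneg_matrix A" "\<And>j. x $ j \<le> y $ j"
  shows "(A *v x) $ i \<le> (A *v y) $ i"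
  using assms by (auto simp: matrix_vector_mult_def nonneg_matrix_def intro!: sum_mono mult_left_mono)

lemma mult_vec_nonneg: "nonneg_matrix A \<Longrightarrow> (\<And>j. 0 \<le> x $ j) \<Longrightarrow> 0 \<le> (A *v x) $ i"
  using mult_vec_mono[of A 0 x i] by simp

lemma mult_vec_const: "(A *v (\<chi> i. c)) $ i = row_sum A i * c"
  by (simp add: row_sum_def matrix_vector_mult_def sum_distrib_right)

lemma row_sum_mult_le:
  assumes "nonneg_matrix A" "\<And>i. row_sum B i \<le> k"
  shows "row_sum (A ** B) i \<le> row_sum A i * k"
proof -
  have "row_sum (A ** B) i = (A *v (B *v (\<chi> i. 1))) $ i"
    by (simp add: row_sum_eq_mult_one matrix_vector_mul_assoc)
  also have "\<dots> \<le> (A *v (\<chi> i. k)) $ i"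
    using assms by (intro mult_vec_mono) (auto simp flip: row_sum_eq_mult_one)
  finally show ?thesis by (simp add: mult_vec_const)
qed

lemma row_sum_mult_stochastic:
  assumes "stochastic B"
  shows "row_sum (A ** B) i = row_sum A i"
proof -
  have "B *v (\<chi> i. 1) = (\<chi> i. 1)"
    using assms by (simp add: vec_eq_iff stochastic_iff flip: row_sum_eq_mult_one)
  then show ?thesis
    by (simp add: row_sum_eq_mult_one flip: matrix_vector_mul_assoc)
qed

lemma stochastic_mult: "stochastic A \<Longrightarrow> stochastic B \<Longrightarrow> stochastic (A ** B)"
  by (metis stochastic_iff nonneg_matrix_mult row_sum_mult_stochastic)

lemma stochastic_mat_1: "stochastic (mat 1)"
  by (auto simp: stochastic_def mat_def)

lemma row_sum_le_max_onorm: "row_sum A i \<le> max_onorm (A :: 'n::finite matr)"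
proof -
  have "row_sum A i \<le> infnorm (A *v (\<chi> i. 1))"
    using component_le_infnorm_cart[of "A *v (\<chi> i. 1)" i] by (simp add: row_sum_eq_mult_one)
  also have "\<dots> \<le> max_onorm A * infnorm (\<chi> i::'n. (1::real))" by (rule infnorm_mult_le_max_onorm)
  also have "\<dots> \<le> max_onorm A * 1" by (intro mult_left_mono infnorm_cart_leI max_onorm_nonneg) auto
  finally show ?thesis by simp
qed

lemma max_onorm_le_row_sum:
  fixes A :: "'n::finite matr"
  assumes "nonneg_matrix A" "\<And>i. row_sum A i \<le> k"
  shows "max_onorm A \<le> k"
proof (rule max_onorm_leI)
  show "0 \<le> k" using assms(2) row_sum_nonneg[OF assms(1)] by (meson order_trans)
  fix x :: "real ^ 'n"
  show "infnorm (A *v x) \<le> k * infnorm x"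
  proof (rule infnorm_cart_leI)
    fix i
    have "\<bar>(A *v x) $ i\<bar> \<le> (\<Sum>j\<in>UNIV. A $ i $ j * infnorm x)"
      unfolding matrix_vector_mult_def using assms(1)
      by (auto intro!: order_trans[OF sum_abs] sum_mono mult_mono simp: abs_mult component_le_infnorm_cart nonneg_matrix_def)
    also have "\<dots> = row_sum A i * infnorm x" by (simp add: row_sum_def sum_distrib_right)
    also have "\<dots> \<le> k * infnorm x" by (intro mult_right_mono assms infnorm_pos_le)
    finally show "\<bar>(A *v x) $ i\<bar> \<le> k * infnorm x" .
  qed
qed

lemma matrix_diff_rdistrib: "(A - B) ** C = A ** C - B ** (C :: 'n::finite matr)"
  by (simp add: vec_eq_iff matrix_matrix_mult_def sum_subtractf left_diff_distrib)

lemma matrix_diff_ldistrib: "A ** (B - C) = A ** B - A ** (C :: 'n::finite matr)"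
  by (simp add: vec_eq_iff matrix_matrix_mult_def sum_subtractf right_diff_distrib)

section \<open>Inverses of \<open>I - K\<close> for strictly substochastic \<open>K\<close>, and
  contraction of oscillations\<close>

locale strictly_substochastic =
  fixes K :: "'n::finite matr" and k :: real
  assumes nonneg: "nonneg_matrix K" and row_sum_le: "row_sum K i \<le> k" and less_1: "k < 1"
begin

abbreviation "G \<equiv> matrix_inv (mat 1 - K)"

text \<open>The minimum principle: at an index where \<open>x\<close> is minimal, \<open>x\<^sub>i \<ge> (K x)\<^sub>i \<ge> k x\<^sub>i\<close> if that minimum
  is negative.\<close>

lemma superharmonic_nonneg:
  assumes "\<And>i. (K *v x) $ i \<le> x $ i"
  shows "0 \<le> x $ i"
proof -
  obtain l where l: "\<And>j. x $ l \<le> x $ j"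
  proof -
    have "Min (range (\<lambda>j. x $ j)) \<in> range (\<lambda>j. x $ j)" by (rule Min_in) auto
    then obtain l where "x $ l = Min (range (\<lambda>j. x $ j))" by (metis imageE)
    then show ?thesis using that[of l] by simp
  qed
  have "0 \<le> x $ l"
  proof (rule ccontr)
    assume neg: "\<not> 0 \<le> x $ l"
    have "k * x $ l \<le> row_sum K l * x $ l" using neg row_sum_le by (intro mult_right_mono_neg) auto
    also have "\<dots> \<le> (K *v x) $ l"
      unfolding mult_vec_const[symmetric] by (rule mult_vec_mono[OF nonneg]) (simp add: l)
    also have "\<dots> \<le> x $ l" by (rule assms)
    finally have "0 \<le> (1 - k) * x $ l" by (simp add: algebra_simps)
    then show False using neg less_1 by (simp add: zero_le_mult_iff)
  qed
  with l show ?thesis by (meson order_trans)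
qed

text \<open>Comparison of a subsolution \<open>x\<close> with a supersolution \<open>z\<close> of
  the same equation: the difference \<open>z - x\<close> is superharmonic.\<close>

lemma superharmonic_le:
  assumes "\<And>i. (K *v x) $ i + y $ i \<ge> x $ i" "\<And>i. (K *v z) $ i + y $ i \<le> z $ i"
  shows "x $ i \<le> z $ i"
proof -
  have "0 \<le> (z - x) $ i"
  proof (rule superharmonic_nonneg)
    fix i
    have "(K *v (z - x)) $ i = (K *v z) $ i - (K *v x) $ i" by (simp add: matrix_vector_mult_diff_distrib)
    then show "(K *v (z - x)) $ i \<le> (z - x) $ i" using assms[of i] by simp
  qed
  then show ?thesis by simp
qed

text \<open>For a kernel vector, both the vector and its negative are superharmonic, so both are
  nonnegative.\<close>

lemma invertible: "invertible (mat 1 - K)"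
  unfolding invertible_left_inverse matrix_left_invertible_ker
proof (intro allI impI)
  fix x assume "(mat 1 - K) *v x = 0"
  then have x: "K *v x = x" by (simp add: matrix_vector_mult_diff_rdistrib)
  have "K *v (- x) = - x" using x matrix_vector_mult_diff_distrib[of K 0 x] by simp
  then have "0 \<le> x $ i" "0 \<le> (- x) $ i" for i
    by (intro superharmonic_nonneg, simp add: x, intro superharmonic_nonneg, simp)
  then show "x = 0" by (simp add: vec_eq_iff antisym)
qed

lemma inverse_left: "G ** (mat 1 - K) = mat 1" and inverse_right: "(mat 1 - K) ** G = mat 1"
  using someI_ex[OF invertible[unfolded invertible_def]] by (auto simp: matrix_inv_def)

lemma solution_unique:
  fixes X Y :: "'n matr"
  assumes "X = K ** X + Y"
  shows "X = G ** Y"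
proof -
  have "(mat 1 - K) ** X = X - K ** X"
    by (simp add: matrix_diff_rdistrib)
  also have "\<dots> = Y"
    by (subst (1) assms) simp
  finally have "(mat 1 - K) ** X = Y" .
  then have "G ** Y = (G ** (mat 1 - K)) ** X" by (simp flip: matrix_mul_assoc)
  then show ?thesis by (simp add: inverse_left)
qed

lemma solution_unique_vec:
  assumes "x = K *v x + y"
  shows "x = G *v y"
proof -
  have "(mat 1 - K) *v x = y"
    using assms by (simp add: matrix_vector_mult_diff_rdistrib algebra_simps)
  then have "G *v y = (G ** (mat 1 - K)) *v x" by (simp flip: matrix_vector_mul_assoc)
  then show ?thesis by (simp add: inverse_left)
qed

lemma inverse_vec_eq: "G *v y = K *v (G *v y) + y"
proof -
  have "(mat 1 - K) *v (G *v y) = y" by (simp add: matrix_vector_mul_assoc inverse_right)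
  then show ?thesis by (simp add: matrix_vector_mult_diff_rdistrib algebra_simps)
qed

lemma inverse_vec_nonneg:
  assumes "\<And>i. 0 \<le> y $ i"
  shows "0 \<le> (G *v y) $ i"
proof (rule superharmonic_nonneg)
  fix i
  have "(G *v y) $ i = (K *v (G *v y)) $ i + y $ i" using inverse_vec_eq[of y] by (metis vector_add_component)
  then show "(K *v (G *v y)) $ i \<le> (G *v y) $ i" using assms[of i] by simp
qed

lemma inverse_vec_ge:
  assumes "\<And>i. 0 \<le> y $ i"
  shows "y $ i \<le> (G *v y) $ i"
proof -
  have "(G *v y) $ i = (K *v (G *v y)) $ i + y $ i" using inverse_vec_eq[of y] by (metis vector_add_component)
  then show ?thesis using mult_vec_nonneg[OF nonneg inverse_vec_nonneg[OF assms], of i] by simp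
qed

lemma nonneg_inverse: "nonneg_matrix G"
  unfolding nonneg_matrix_def
proof (intro allI)
  fix i j
  have "G $ i $ j = (G *v axis j 1) $ i" by (simp add: matrix_vector_mult_basis column_def)
  also have "0 \<le> \<dots>" by (rule inverse_vec_nonneg) (simp add: axis_def)
  finally show "0 \<le> G $ i $ j" .
qed

text \<open>The constant vector \<open>1 / (1 - k)\<close> is a supersolution of
  \<open>x = K x + 1\<close>, whose solution is the vector of row sums of the inverse.\<close>

lemma row_sum_inverse_le: "row_sum G i \<le> 1 / (1 - k)"
proof -
  have "(G *v (\<chi> i. 1)) $ i \<le> (\<chi> i. 1 / (1 - k)) $ i"
  proof (rule superharmonic_le[where y = "\<chi> i. 1"])
    fix i
    show "(K *v (G *v (\<chi> i. 1))) $ i + (\<chi> i. 1) $ i \<ge> (G *v (\<chi> i. 1)) $ i"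
      using inverse_vec_eq[of "\<chi> i. 1"] by (metis order_refl vector_add_component)
    have "row_sum K i * (1 / (1 - k)) + 1 \<le> k * (1 / (1 - k)) + 1"
      using less_1 row_sum_le by (intro add_right_mono mult_right_mono) auto
    also have "\<dots> = 1 / (1 - k)" using less_1 by (simp add: field_simps)
    finally show "(K *v (\<chi> i. 1 / (1 - k))) $ i + (\<chi> i. 1) $ i \<le> (\<chi> i. 1 / (1 - k)) $ i"
      by (simp add: mult_vec_const)
  qed
  then show ?thesis by (simp add: row_sum_eq_mult_one)
qed

end

text \<open>Row \<open>i\<close> gives mass at least \<open>e\<close> to an index where
  \<open>x\<close> is minimal, which pulls \<open>(A x) $ i\<close> below the maximum by
  \<open>e\<close> times the oscillation. For row \<open>j\<close> the trivial lower bound by the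
  minimum suffices.\<close>

lemma stochastic_contraction:
  fixes A :: "'n::finite matr"
  assumes A: "stochastic A" and e: "\<And>i j. e \<le> A $ i $ j" "0 \<le> e"
    and osc: "\<And>i j. x $ i - x $ j \<le> D"
  shows "(A *v x) $ i - (A *v x) $ j \<le> (1 - e) * D"
proof -
  obtain a where a: "\<And>j. x $ j \<le> x $ a"
  proof -
    have "Max (range (\<lambda>j. x $ j)) \<in> range (\<lambda>j. x $ j)" by (rule Max_in) auto
    then obtain l where "x $ l = Max (range (\<lambda>j. x $ j))" by (metis imageE)
    then show ?thesis using that[of l] by simp
  qed
  obtain b where b: "\<And>j. x $ b \<le> x $ j"
  proof -
    have "Min (range (\<lambda>j. x $ j)) \<in> range (\<lambda>j. x $ j)" by (rule Min_in) auto
    then obtain l where "x $ l = Min (range (\<lambda>j. x $ j))" by (metis imageE)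
    then show ?thesis using that[of l] by simp
  qed
  have nn: "0 \<le> A $ i $ j" and sum1: "(\<Sum>j\<in>UNIV. A $ i $ j) = 1" for i j
    using A by (auto simp: stochastic_def)
  have "x $ b = (\<Sum>l\<in>UNIV. A $ j $ l * x $ b)" by (simp flip: sum_distrib_right add: sum1)
  also have "\<dots> \<le> (A *v x) $ j"
    unfolding matrix_vector_mult_def using nn b by (auto intro!: sum_mono mult_left_mono)
  finally have low: "x $ b \<le> (A *v x) $ j" .
  have "e * (x $ a - x $ b) \<le> A $ i $ b * (x $ a - x $ b)"
    using e b by (intro mult_right_mono) auto
  also have "\<dots> \<le> (\<Sum>l\<in>UNIV. A $ i $ l * (x $ a - x $ l))"
    using nn a by (intro member_le_sum) auto
  also have "\<dots> = x $ a - (A *v x) $ i"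
    by (simp add: matrix_vector_mult_def algebra_simps sum_subtractf) (simp flip: sum_distrib_left sum_distrib_right add: sum1)
  finally have "(A *v x) $ i \<le> x $ a - e * (x $ a - x $ b)" by simp
  with low have "(A *v x) $ i - (A *v x) $ j \<le> (1 - e) * (x $ a - x $ b)" by (simp add: algebra_simps)
  also have "\<dots> \<le> (1 - e) * D"
  proof (rule mult_left_mono[OF osc])
    have "A $ i $ b \<le> (\<Sum>l\<in>UNIV. A $ i $ l)" using nn by (intro member_le_sum) auto
    with e(1)[of i b] show "0 \<le> 1 - e" by (simp add: sum1)
  qed
  finally show ?thesis .
qed

section \<open>Walks on a strip in a fixed environment\<close>

definition level :: "int \<Rightarrow> (int \<times> 'd) set" where
  "level n = {x. fst x = n}"

lemma in_level [simp]: "x \<in> level n \<longleftrightarrow> fst x = n"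
  by (simp add: level_def)

text \<open>The functional \<open>f\<close> of the path restarted at its first entrance into level
  \<open>L\<close>, and 0 without entrance. As a series with at most one nonzero term it is
  measurable and can be integrated termwise.\<close>

definition at_level :: "int \<Rightarrow> ((nat \<Rightarrow> int \<times> 'd) \<Rightarrow> ennreal) \<Rightarrow> (nat \<Rightarrow> int \<times> 'd) \<Rightarrow> ennreal" where
  "at_level L f X = (\<Sum>t. indicator {X. first_at (level L) t X} X * f (path_after t X))"

definition hits :: "int \<Rightarrow> (nat \<Rightarrow> int \<times> 'd) \<Rightarrow> bool" where
  "hits L X \<longleftrightarrow> (\<exists>t. fst (X t) = L)"

definition hits_in :: "int \<Rightarrow> 'd \<Rightarrow> (nat \<Rightarrow> int \<times> 'd) \<Rightarrow> bool" where
  "hits_in L j X \<longleftrightarrow> (\<exists>t. first_at (level L) t X \<and> snd (X t) = j)"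

lemma hits_measurable [measurable]: "Measurable.pred path_space (hits L)"
  unfolding hits_def by measurable

lemma hits_in_measurable [measurable]:
  "Measurable.pred path_space (hits_in L j :: (nat \<Rightarrow> int \<times> 'd::countable) \<Rightarrow> bool)"
  unfolding hits_in_def by measurable

lemma UNIV_in_path_sets [simp]: "UNIV \<in> sets path_space"
  using sets.top[of path_space] by simp

lemma Collect_in_path_sets: "Measurable.pred path_space Q \<Longrightarrow> Collect Q \<in> sets path_space"
  by (drule predE) simp

lemma Collect_hits_sets [measurable, simp]: "Collect (hits L) \<in> sets path_space"
  by (rule Collect_in_path_sets) measurable

lemma Collect_hits_in_sets [measurable, simp]:
  "Collect (hits_in L (j :: 'd::countable)) \<in> sets path_space"
  by (rule Collect_in_path_sets) measurable

lemma at_level_measurable [measurable]: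
  assumes [measurable]: "f \<in> borel_measurable path_space"
  shows "at_level L f \<in> borel_measurable path_space"
  unfolding at_level_def by measurable

lemma at_level_first:
  assumes "first_at (level L) t X"
  shows "at_level L f X = f (path_after t X)"
proof -
  have "indicator {X. first_at (level L) s X} X * f (path_after s X)
      = (if s = t then f (path_after s X) else 0)" for s
  proof (cases "s = t")
    case False
    then have "\<not> first_at (level L) s X" using first_at_unique[OF assms] by blast
    with False show ?thesis by simp
  qed (simp add: assms)
  then have "at_level L f X = (\<Sum>s. if s = t then f (path_after s X) else 0)"
    by (simp add: at_level_def)
  also have "\<dots> = f (path_after t X)"
    using sums_unique[OF sums_single[of t "\<lambda>s. f (path_after s X)"]] by simp
  finally show ?thesis .
qed

lemma hits_iff_first_at: "hits L X \<longleftrightarrow> (\<exists>t. first_at (level L) t X)"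
proof
  assume "hits L X"
  then obtain t where "X t \<in> level L" by (auto simp: hits_def)
  from ex_first_at[of X t "level L", OF this] show "\<exists>t. first_at (level L) t X" by blast
qed (auto simp: hits_def first_at_def)

lemma at_level_not_hits:
  assumes "\<not> hits L X"
  shows "at_level L f X = 0"
  using assms by (simp add: at_level_def hits_iff_first_at)

lemma hits_eq_ex_hits_in: "hits L X \<longleftrightarrow> (\<exists>j. hits_in L j X)"
  by (auto simp: hits_iff_first_at hits_in_def)

lemma hits_in_unique: "hits_in L i X \<Longrightarrow> hits_in L j X \<Longrightarrow> i = j"
  by (auto simp: hits_in_def dest: first_at_unique)

definition skip_free :: "(nat \<Rightarrow> int \<times> 'd) \<Rightarrow> bool" where
  "skip_free X \<longleftrightarrow> (\<forall>t. \<bar>fst (X (Suc t)) - fst (X t)\<bar> \<le> 1)"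

lemma skip_free_measurable [measurable]: "Measurable.pred path_space (skip_free :: (nat \<Rightarrow> int \<times> 'd::countable) \<Rightarrow> bool)"
  unfolding skip_free_def by measurable

text \<open>A discrete intermediate value argument: unit steps cannot jump over
  \<open>L\<close>.\<close>

lemma skip_free_less:
  assumes "skip_free X" "fst (X 0) < L" "\<forall>s\<le>t. fst (X s) \<noteq> L"
  shows "fst (X t) < L"
  using assms(3)
proof (induction t)
  case (Suc t)
  then have "fst (X t) < L" "fst (X (Suc t)) \<noteq> L" by auto
  moreover have "\<bar>fst (X (Suc t)) - fst (X t)\<bar> \<le> 1" using assms(1) by (simp add: skip_free_def)
  ultimately show ?case by linarith
qed (use assms in simp)

lemma first_at_level_mono:
  assumes "skip_free X" "fst (X 0) \<le> n" "first_at (level (n + 1)) t X"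
  shows "\<exists>s\<le>t. first_at (level n) s X"
proof (cases "fst (X 0) = n")
  case True
  then show ?thesis by (intro exI[of _ 0]) auto
next
  case False
  then have "\<not> (\<forall>s\<le>t. fst (X s) \<noteq> n)"
    using skip_free_less[OF assms(1), of n t] assms by (auto simp: first_at_def)
  then obtain s where "s \<le> t" "X s \<in> level n" by auto
  with ex_first_at[of X s "level n"] show ?thesis by (meson order_trans)
qed

text \<open>Level \<open>n\<close> must be met before level \<open>n + 1\<close>, so restarting at
  the first entrance into \<open>n\<close> does not affect the first entrance into
  \<open>n + 1\<close>. This is the pathwise reason for which hitting matrices multiply.\<close>

lemma at_level_at_level:
  assumes "skip_free X" "fst (X 0) \<le> n"
  shows "at_level (n + 1) f X = at_level n (at_level (n + 1) f) X"
proof (cases "hits n X")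
  case True
  then obtain t where t: "first_at (level n) t X" by (auto simp: hits_iff_first_at)
  have before: "fst (X s) \<noteq> n + 1" if "s < t" for s
  proof
    assume "fst (X s) = n + 1"
    then obtain u where "u \<le> s" "first_at (level (n + 1)) u X" using ex_first_at[of X s "level (n + 1)"] by auto
    then obtain v where "v \<le> u" "first_at (level n) v X" using first_at_level_mono[OF assms] by blast
    with first_at_unique[OF t] \<open>u \<le> s\<close> that show False by auto
  qed
  have iff: "first_at (level (n + 1)) s (path_after t X) \<longleftrightarrow> first_at (level (n + 1)) (s + t) X" for s
  proof
    assume *: "first_at (level (n + 1)) s (path_after t X)"
    show "first_at (level (n + 1)) (s + t) X"
      unfolding first_at_def
    proof (intro conjI allI impI)
      show "X (s + t) \<in> level (n + 1)" using * by (simp add: first_at_def)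
      fix u assume "u < s + t"
      show "X u \<notin> level (n + 1)"
      proof (cases "u < t")
        case False
        then have "path_after t X (u - t) = X u" "u - t < s" using \<open>u < s + t\<close> by auto
        with * show ?thesis unfolding first_at_def by metis
      qed (use before in simp)
    qed
  qed (auto simp: first_at_def)
  show ?thesis
  proof (cases "hits (n + 1) X")
    case True
    then obtain u where u: "first_at (level (n + 1)) u X" by (auto simp: hits_iff_first_at)
    have "t \<le> u" using before u by (meson first_at_def in_level not_less)
    then have "first_at (level (n + 1)) (u - t) (path_after t X)" using u iff[of "u - t"] by simp
    from at_level_first[OF this] at_level_first[OF u] at_level_first[OF t] \<open>t \<le> u\<close>
    show ?thesis by (simp add: path_after_def)
  next
    case False
    then have "\<not> hits (n + 1) (path_after t X)" by (auto simp: hits_def)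
    then show ?thesis using False by (simp add: at_level_first[OF t] at_level_not_hits)
  qed
next
  case False
  then have "\<not> hits (n + 1) X" using first_at_level_mono[OF assms] by (auto simp: hits_iff_first_at)
  with False show ?thesis by (simp add: at_level_not_hits)
qed

locale strip_walk =
  fixes p q r :: "int \<Rightarrow> 'd::finite matr" and K :: "int \<times> 'd \<Rightarrow> (int \<times> 'd) pmf"
  assumes nonneg: "nonneg_matrix (p n)" "nonneg_matrix (q n)" "nonneg_matrix (r n)"
    and row_sum: "row_sum (p n) i + row_sum (q n) i + row_sum (r n) i = 1"
    and pmf_K: "pmf (K (n, i)) (m, j) =
      (if m = n + 1 then p n $ i $ j else if m = n then r n $ i $ j
       else if m = n - 1 then q n $ i $ j else 0)"
begin

lemma set_pmf_K: "y \<in> set_pmf (K x) \<Longrightarrow> \<bar>fst y - fst x\<bar> \<le> 1"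
  using pmf_K[of "fst x" "snd x" "fst y" "snd y"] by (auto simp: set_pmf_iff split: if_splits)

lemma nn_integral_K:
  "(\<integral>\<^sup>+y. f y \<partial>measure_pmf (K (n, i))) = (\<Sum>j\<in>UNIV. ennreal (p n $ i $ j) * f (n + 1, j))
    + (\<Sum>j\<in>UNIV. ennreal (r n $ i $ j) * f (n, j)) + (\<Sum>j\<in>UNIV. ennreal (q n $ i $ j) * f (n - 1, j))"
proof -
  have "(\<integral>\<^sup>+y. f y \<partial>measure_pmf (K (n, i))) = (\<Sum>y\<in>{n - 1, n, n + 1} \<times> UNIV. f y * pmf (K (n, i)) y)"
  proof (rule nn_integral_measure_pmf_support)
    fix y assume "y \<in> set_pmf (K (n, i))" "y \<notin> {n - 1, n, n + 1} \<times> (UNIV :: 'd set)"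
    with set_pmf_K[of y "(n, i)"] show "f y = 0" by (cases y) auto
  qed auto
  also have "\<dots> = (\<Sum>m\<in>{n - 1, n, n + 1}. \<Sum>j\<in>UNIV. f (m, j) * pmf (K (n, i)) (m, j))"
    by (simp add: sum.cartesian_product)
  finally show ?thesis by (simp add: pmf_K ac_simps)
qed

abbreviation "law \<equiv> chain K"

lemma AE_skip_free: "AE X in law x. X 0 = x \<and> skip_free X"
  using AE_chain_0[where K = K and x = x] AE_chain_steps[where K = K and x = x]
  by eventually_elim (use set_pmf_K in \<open>auto simp: skip_free_def\<close>)

definition hit :: "int \<Rightarrow> int \<times> 'd \<Rightarrow> 'd \<Rightarrow> real" where
  "hit L x j = measure (law x) {X. hits_in L j X}"

text \<open>The matrix \<eta> at site \<open>n\<close>, expressed by starting the walk on level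
  \<open>n\<close> instead of shifting the environment. At this stage it is known only to be
  substochastic.\<close>

definition h :: "int \<Rightarrow> 'd matr" where
  "h n = (\<chi> i j. hit (n + 1) (n, i) j)"

lemma emeasure_hits_in: "emeasure (law x) {X. hits_in L j X} = ennreal (hit L x j)"
proof -
  interpret prob_space "law x" by (rule prob_space_chain)
  show ?thesis by (simp add: hit_def emeasure_eq_measure)
qed

lemma hit_nonneg: "0 \<le> hit L x j" by (simp add: hit_def)

lemma nonneg_h: "nonneg_matrix (h n)"
  by (simp add: nonneg_matrix_def h_def hit_nonneg)

lemma sum_hit: "ennreal (\<Sum>j\<in>UNIV. hit L x j) = emeasure (law x) {X. hits L X}"
proof -
  have U: "{X. hits L X} = (\<Union>j. {X. hits_in L j X})"
    by (auto simp: hits_eq_ex_hits_in)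
  have "emeasure (law x) {X. hits L X} = (\<Sum>j\<in>UNIV. emeasure (law x) {X. hits_in L j X})"
    unfolding U by (rule sum_emeasure[symmetric]) (auto simp: disjoint_family_on_def dest: hits_in_unique)
  then show ?thesis by (simp add: emeasure_hits_in hit_nonneg)
qed

lemma sum_hit_le_1: "(\<Sum>j\<in>UNIV. hit L x j) \<le> 1"
proof -
  interpret prob_space "law x" by (rule prob_space_chain)
  have "ennreal (\<Sum>j\<in>UNIV. hit L x j) \<le> 1" unfolding sum_hit by (rule emeasure_le_1)
  then show ?thesis by simp
qed

lemma row_sum_h_le_1: "row_sum (h n) i \<le> 1"
  using sum_hit_le_1[of "n + 1" "(n, i)"] by (simp add: row_sum_def h_def)

text \<open>The identities at fixed entrance times are summed over \<open>t\<close>; the result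
  depends on the path only through the entrance position, which on a level has finitely many
  values.\<close>

lemma strong_markov:
  assumes [measurable]: "f \<in> borel_measurable path_space"
  shows "(\<integral>\<^sup>+X. at_level L f X \<partial>law x) = (\<Sum>j\<in>UNIV. ennreal (hit L x j) * (\<integral>\<^sup>+X. f X \<partial>law (L, j)))"
proof -
  define F where "F y = (\<integral>\<^sup>+X. f X \<partial>law y)" for y
  have [measurable]: "(\<lambda>X. F (X t)) \<in> borel_measurable path_space" for t
    by (rule measurable_compose[OF measurable_coord]) simp
  have [measurable]: "(\<lambda>X. F (X 0)) \<in> borel_measurable path_space"
    by measurable
  have pointwise: "at_level L (\<lambda>X. F (X 0)) X = (\<Sum>j\<in>UNIV. indicator {X. hits_in L j X} X * F (L, j))" for X
  proof (cases "hits L X")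
    case True
    then obtain t where t: "first_at (level L) t X" by (auto simp: hits_iff_first_at)
    have "indicator {X. hits_in L j X} X * F (L, j) = (if j = snd (X t) then F (L, j) else 0)" for j
      using t by (auto simp: hits_in_def dest: first_at_unique[OF t] split: split_indicator)
    moreover have "X t = (L, snd (X t))" using t by (auto simp: first_at_def prod_eq_iff)
    ultimately show ?thesis using at_level_first[OF t, of "\<lambda>X. F (X 0)"] by simp
  qed (auto simp: at_level_not_hits hits_eq_ex_hits_in)
  have "(\<integral>\<^sup>+X. at_level L f X \<partial>law x) =
     (\<Sum>t. \<integral>\<^sup>+X. indicator {X. first_at (level L) t X} X * f (path_after t X) \<partial>law x)"
    unfolding at_level_def by (rule nn_integral_suminf) measurable
  also have "\<dots> = (\<Sum>t. \<integral>\<^sup>+X. indicator {X. first_at (level L) t X} X * F (X t) \<partial>law x)"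
    by (simp add: nn_integral_first_at F_def)
  also have "\<dots> = (\<integral>\<^sup>+X. (\<Sum>t. indicator {X. first_at (level L) t X} X * F (X t)) \<partial>law x)"
    by (rule nn_integral_suminf[symmetric]) measurable
  also have "\<dots> = (\<integral>\<^sup>+X. at_level L (\<lambda>X. F (X 0)) X \<partial>law x)"
    by (simp add: at_level_def)
  also have "\<dots> = (\<integral>\<^sup>+X. (\<Sum>j\<in>UNIV. indicator {X. hits_in L j X} X * F (L, j)) \<partial>law x)"
    by (simp only: pointwise)
  also have "\<dots> = (\<Sum>j\<in>UNIV. ennreal (hit L x j) * F (L, j))"
    by (subst nn_integral_sum) (auto simp: nn_integral_multc emeasure_hits_in)
  finally show ?thesis by (simp add: F_def)
qed

lemma at_level_indicator_hits_in:
  fixes X :: "nat \<Rightarrow> int \<times> 'd"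
  assumes "skip_free X" "fst (X 0) \<le> n"
  shows "indicator {X. hits_in (n + 1) j X} X = at_level n (indicator {X. hits_in (n + 1) j X}) X"
proof -
  \<comment> \<open>Reading off the column in which the restarted path begins writes the indicator
    of \<open>hits_in\<close> in the form \<open>at_level\<close>, so that
    \<open>at_level_at_level\<close> applies.\<close>
  define f :: "(nat \<Rightarrow> int \<times> 'd) \<Rightarrow> ennreal" where "f Y = indicator {j} (snd (Y 0))" for Y
  have "indicator {X. hits_in L j X} Y = at_level L f Y" for L Y
  proof (cases "hits L Y")
    case True
    then obtain t where t: "first_at (level L) t Y" by (auto simp: hits_iff_first_at)
    then show ?thesis using at_level_first[OF t, of f]
      by (auto simp: f_def hits_in_def dest: first_at_unique[OF t] split: split_indicator)
  qed (auto simp: at_level_not_hits hits_eq_ex_hits_in)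
  then have "indicator {X. hits_in (n + 1) j X} = at_level (n + 1) f" by auto
  then show ?thesis using at_level_at_level[OF assms, of f] by simp
qed

lemma hit_below:
  assumes "m \<le> n"
  shows "hit (n + 1) (m, i) j = (\<Sum>l\<in>UNIV. hit n (m, i) l * h n $ l $ j)"
proof -
  have "ennreal (hit (n + 1) (m, i) j) = (\<integral>\<^sup>+X. indicator {X. hits_in (n + 1) j X} X \<partial>law (m, i))"
    by (simp add: emeasure_hits_in)
  also have "\<dots> = (\<integral>\<^sup>+X. at_level n (indicator {X. hits_in (n + 1) j X}) X \<partial>law (m, i))"
    by (rule nn_integral_cong_AE, rule AE_mp[OF AE_skip_free[of "(m, i)"]])
      (auto intro!: AE_I2 at_level_indicator_hits_in simp: assms)
  also have "\<dots> = (\<Sum>l\<in>UNIV. ennreal (hit n (m, i) l) * ennreal (h n $ l $ j))"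
    by (subst strong_markov) (auto simp: emeasure_hits_in h_def)
  also have "\<dots> = ennreal (\<Sum>l\<in>UNIV. hit n (m, i) l * h n $ l $ j)"
    by (simp add: hit_nonneg h_def flip: ennreal_mult)
  finally show ?thesis
    by (subst (asm) ennreal_inj) (auto intro!: sum_nonneg mult_nonneg_nonneg simp: hit_nonneg h_def)
qed

lemma hits_in_case_nat:
  "hits_in L j (case_nat x X) \<longleftrightarrow> (if fst x = L then snd x = j else hits_in L j X)"
proof (cases "fst x = L")
  case True
  then have "first_at (level L) t (case_nat x X) \<longleftrightarrow> t = 0" for t
    by (cases t) auto
  with True show ?thesis by (auto simp: hits_in_def)
next
  case False
  have "(\<exists>t. first_at (level L) t (case_nat x X) \<and> snd (case_nat x X t) = j)
    \<longleftrightarrow> (\<exists>t. first_at (level L) (Suc t) (case_nat x X) \<and> snd (case_nat x X (Suc t)) = j)"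
    using False by (metis first_at_0 in_level not0_implies_Suc old.nat.simps(4))
  with False show ?thesis by (simp add: hits_in_def)
qed

lemma hit_self: "hit L (L, i) j = (if i = j then 1 else 0)"
proof -
  interpret prob_space "law (L, i)" by (rule prob_space_chain)
  have "AE X in law (L, i). hits_in L j X \<longleftrightarrow> i = j"
    using AE_skip_free[of "(L, i)"]
  proof eventually_elim
    case (elim X)
    then have "first_at (level L) t X \<longleftrightarrow> t = 0" for t
      using first_at_unique[of "level L" 0 X t] by auto
    with elim show ?case by (auto simp: hits_in_def)
  qed
  then have "prob {X. hits_in L j X} = prob {X. i = j}"
    by (intro measure_eq_AE) auto
  then show ?thesis using prob_space by (auto simp: hit_def)
qed

text \<open>A step to the right ends on the target level, a step within the level starts afresh, and
  after a step to the left level \<open>n\<close> must be passed again, which gives the product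
  \<open>h (n - 1) ** h n\<close>. It is the equation that \<zeta> satisfies.\<close>

lemma h_first_step: "h n = (q n ** h (n - 1) + r n) ** h n + p n"
proof -
  have "h n $ i $ j = ((q n ** h (n - 1) + r n) ** h n + p n) $ i $ j" for i j
  proof -
    have after: "indicator {X. hits_in (n + 1) j X} (case_nat (n, i) X)
        = (indicator {X. hits_in (n + 1) j X} X :: ennreal)" for X
      by (simp add: indicator_def hits_in_case_nat)
    have "ennreal (h n $ i $ j) = (\<integral>\<^sup>+X. indicator {X. hits_in (n + 1) j X} X \<partial>law (n, i))"
      by (simp add: emeasure_hits_in h_def)
    also have "\<dots> = (\<integral>\<^sup>+y. (\<integral>\<^sup>+X. indicator {X. hits_in (n + 1) j X} (case_nat (n, i) X) \<partial>law y) \<partial>measure_pmf (K (n, i)))"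
      by (rule nn_integral_chain_step) measurable
    also have "\<dots> = (\<integral>\<^sup>+y. ennreal (hit (n + 1) y j) \<partial>measure_pmf (K (n, i)))"
      by (simp add: after emeasure_hits_in)
    also have "\<dots> = ennreal ((\<Sum>l\<in>UNIV. p n $ i $ l * hit (n + 1) (n + 1, l) j)
       + (\<Sum>l\<in>UNIV. r n $ i $ l * h n $ l $ j) + (\<Sum>l\<in>UNIV. q n $ i $ l * hit (n + 1) (n - 1, l) j))"
      unfolding nn_integral_K using nonneg[of n]
      by (simp add: nonneg_matrix_def hit_nonneg h_def ennreal_plus sum_nonneg flip: ennreal_mult)
    finally have "h n $ i $ j = (\<Sum>l\<in>UNIV. p n $ i $ l * hit (n + 1) (n + 1, l) j)
       + (\<Sum>l\<in>UNIV. r n $ i $ l * h n $ l $ j) + (\<Sum>l\<in>UNIV. q n $ i $ l * hit (n + 1) (n - 1, l) j)"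
      using nonneg[of n] by (subst (asm) ennreal_inj)
        (auto simp: nonneg_matrix_def hit_nonneg h_def intro!: add_nonneg_nonneg sum_nonneg)
    moreover have "(\<Sum>l\<in>UNIV. p n $ i $ l * hit (n + 1) (n + 1, l) j) = p n $ i $ j"
      by (simp add: hit_self if_distrib cong: if_cong)
    moreover have "hit (n + 1) (n - 1, l) j = (h (n - 1) ** h n) $ l $ j" for l
      using hit_below[of "n - 1" n l j] by (simp add: matrix_matrix_mult_def h_def)
    ultimately have "h n $ i $ j = p n $ i $ j + (r n ** h n) $ i $ j + (q n ** (h (n - 1) ** h n)) $ i $ j"
      by (simp add: matrix_matrix_mult_def)
    also have "\<dots> = ((q n ** h (n - 1) + r n) ** h n + p n) $ i $ j"
      by (simp add: matrix_mul_assoc) (simp add: matrix_matrix_mult_def sum.distrib distrib_right)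
    finally show ?thesis .
  qed
  then show ?thesis by (simp add: vec_eq_iff)
qed

end

section \<open>Expected numbers of visits\<close>

definition visit :: "int \<Rightarrow> int \<Rightarrow> nat \<Rightarrow> (nat \<Rightarrow> int \<times> 'd) \<Rightarrow> ennreal" where
  "visit m L t X = (if fst (X t) = m \<and> (\<forall>s\<le>t. fst (X s) \<noteq> L) then 1 else 0)"

definition visits :: "int \<Rightarrow> int \<Rightarrow> (nat \<Rightarrow> int \<times> 'd) \<Rightarrow> ennreal" where
  "visits m L X = (\<Sum>t. visit m L t X)"

text \<open>The truncation has finite expectation. It is needed because the equation for the mean of
  \<open>visits\<close> does not exclude the value \<infinity>.\<close>

definition visits_upto :: "nat \<Rightarrow> int \<Rightarrow> int \<Rightarrow> (nat \<Rightarrow> int \<times> 'd) \<Rightarrow> ennreal" where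
  "visits_upto \<tau> m L X = (\<Sum>t<\<tau>. visit m L t X)"

text \<open>The hitting time of \<open>L\<close> as the number of times before it, infinite if
  \<open>L\<close> is never reached. In this form it splits into visits to the individual
  levels.\<close>

definition passage_time :: "int \<Rightarrow> (nat \<Rightarrow> int \<times> 'd) \<Rightarrow> ennreal" where
  "passage_time L X = (\<Sum>t. if \<forall>s\<le>t. fst (X s) \<noteq> L then 1 else 0)"

lemma visit_measurable [measurable]: "visit m L t \<in> borel_measurable path_space"
  unfolding visit_def by measurable

lemma visits_measurable [measurable]: "visits m L \<in> borel_measurable path_space"
  unfolding visits_def by measurable

lemma visits_upto_measurable [measurable]: "visits_upto \<tau> m L \<in> borel_measurable path_space"
  unfolding visits_upto_def by measurable

lemma suminf_ennreal_offset: "(\<Sum>t. f t) = (\<Sum>t<n. f t) + (\<Sum>t. f (t + n) :: ennreal)"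
  by (subst suminf_offset[of f n]) (auto simp: add.commute)

lemma visit_case_nat_Suc:
  "visit m L (Suc t) (case_nat x X) = (if fst x = L then 0 else visit m L t X)"
  by (auto simp: visit_def All_less_Suc2 simp flip: less_Suc_eq_le)

lemma visit_case_nat_0:
  "visit m L 0 (case_nat x X) = (if fst x = L then 0 else indicator {m} (fst x))"
  by (auto simp: visit_def split: split_indicator)

lemma visits_case_nat:
  "visits m L (case_nat x X) = (if fst x = L then 0 else indicator {m} (fst x) + visits m L X)"
  unfolding visits_def by (subst suminf_ennreal_offset[of _ 1]) (simp add: visit_case_nat_Suc visit_case_nat_0)

lemma visits_upto_case_nat:
  "visits_upto (Suc \<tau>) m L (case_nat x X) = (if fst x = L then 0 else indicator {m} (fst x) + visits_upto \<tau> m L X)"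
  unfolding visits_upto_def by (subst sum.lessThan_Suc_shift) (simp add: visit_case_nat_Suc visit_case_nat_0)

lemma visits_start:
  assumes "fst (X 0) = L"
  shows "visits m L X = 0" "visits_upto \<tau> m L X = 0"
proof -
  have "visit m L t X = 0" for t using assms by (auto simp: visit_def)
  then show "visits m L X = 0" "visits_upto \<tau> m L X = 0" by (auto simp: visits_def visits_upto_def)
qed

lemma visits_self: "visits m m X = 0"
proof -
  have "visit m m t X = 0" for t by (auto simp: visit_def)
  then show ?thesis by (simp add: visits_def)
qed

lemma visits_upto_le_visits: "visits_upto \<tau> m L X \<le> visits m L X"
  unfolding visits_upto_def visits_def by (rule sum_le_suminf) auto

lemma visits_upto_mono: "\<tau> \<le> \<tau>' \<Longrightarrow> visits_upto \<tau> m L X \<le> visits_upto \<tau>' m L X"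
  unfolding visits_upto_def by (rule sum_mono2) auto

lemma visits_eq_SUP: "visits m L X = (SUP \<tau>. visits_upto \<tau> m L X)"
  unfolding visits_def visits_upto_def by (rule suminf_eq_SUP)

lemma visit_before_first:
  assumes "skip_free X" "fst (X 0) \<le> n" "\<forall>s\<le>t. fst (X s) \<noteq> n"
  shows "visit m (n + 1) t X = visit m n t X"
proof -
  have "fst (X 0) \<noteq> n" using assms(3) by simp
  with assms(2) have start: "fst (X 0) < n" by simp
  have "fst (X s) \<noteq> n + 1" if "s \<le> t" for s
  proof -
    have "fst (X u) \<noteq> n" if "u \<le> s" for u
      using assms(3)[rule_format, of u] that \<open>s \<le> t\<close> by simp
    then have "\<forall>u\<le>s. fst (X u) \<noteq> n" by blast
    from skip_free_less[OF assms(1) start this] show ?thesis by simp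
  qed
  with assms(3) show ?thesis by (simp add: visit_def)
qed

lemma visit_after_first:
  assumes "skip_free X" "fst (X 0) \<le> n" "first_at (level n) u X"
  shows "visit m (n + 1) (t + u) X = visit m (n + 1) t (path_after u X)"
proof -
  have before: "fst (X s) \<noteq> n + 1" if "s < u" for s
  proof -
    have not: "fst (X v) \<noteq> n" if "v < u" for v
      using assms(3) that by (simp add: first_at_def)
    have "fst (X 0) < n"
      using assms(2) not[of 0] that by (cases "u = 0") auto
    moreover have "\<forall>v\<le>s. fst (X v) \<noteq> n"
    proof (intro allI impI)
      fix v assume "v \<le> s"
      with that not[of v] show "fst (X v) \<noteq> n" by simp
    qed
    ultimately have "fst (X s) < n" by (rule skip_free_less[OF assms(1)])
    then show ?thesis by simp
  qed
  have "(\<forall>s\<le>t + u. fst (X s) \<noteq> n + 1) \<longleftrightarrow> (\<forall>s\<le>t. fst (X (s + u)) \<noteq> n + 1)"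
  proof (intro iffI allI impI)
    fix s assume *: "\<forall>s\<le>t. fst (X (s + u)) \<noteq> n + 1" "s \<le> t + u"
    show "fst (X s) \<noteq> n + 1"
    proof (cases "s < u")
      case False
      then show ?thesis using *(1)[rule_format, of "s - u"] *(2) by auto
    qed (rule before)
  qed auto
  then show ?thesis by (simp add: visit_def)
qed

text \<open>The path is split at its first entrance \<open>u\<close> into level \<open>n\<close>:
  before \<open>u\<close> neither \<open>n\<close> nor \<open>n + 1\<close> has been met, so both
  counts agree, and from \<open>u\<close> on the restarted path is counted.\<close>

lemma visits_decompose:
  assumes "skip_free X" "fst (X 0) \<le> n"
  shows "visits m (n + 1) X = visits m n X + at_level n (visits m (n + 1)) X"
    and "visits_upto \<tau> m (n + 1) X \<le> visits m n X + at_level n (visits_upto \<tau> m (n + 1)) X"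
proof -
  consider (hit) u where "first_at (level n) u X" | (never) "\<not> hits n X"
    by (auto simp: hits_iff_first_at)
  then have "visits m (n + 1) X = visits m n X + at_level n (visits m (n + 1)) X \<and>
    visits_upto \<tau> m (n + 1) X \<le> visits m n X + at_level n (visits_upto \<tau> m (n + 1)) X"
  proof cases
    case (hit u)
    have before: "visit m (n + 1) t X = visit m n t X" if "t < u" for t
      using hit that by (intro visit_before_first assms) (auto simp: first_at_def)
    have "visit m n (t + u) X = 0" for t
      using hit by (auto simp: visit_def first_at_def intro!: exI[of _ u])
    then have v: "visits m n X = (\<Sum>t<u. visit m n t X)"
      unfolding visits_def by (subst suminf_ennreal_offset[of _ u]) simp
    have 1: "visits m (n + 1) X = visits m n X + visits m (n + 1) (path_after u X)"
      unfolding v unfolding visits_def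
      by (subst suminf_ennreal_offset[of _ u]) (simp add: before visit_after_first[OF assms hit])
    \<comment> \<open>The restarted path is granted all of its \<open>\<tau>\<close> steps instead
      of the remaining ones. This is why the truncated version is only an inequality.\<close>
    have "visits_upto \<tau> m (n + 1) X \<le> visits_upto (\<tau> + u) m (n + 1) X"
      by (rule visits_upto_mono) simp
    also have "\<dots> = (\<Sum>t<u. visit m (n + 1) t X) + (\<Sum>t=u..<\<tau> + u. visit m (n + 1) t X)"
      unfolding visits_upto_def by (simp add: lessThan_atLeast0 sum.atLeastLessThan_concat)
    also have "(\<Sum>t=u..<\<tau> + u. visit m (n + 1) t X) = (\<Sum>t<\<tau>. visit m (n + 1) (t + u) X)"
      using sum.shift_bounds_nat_ivl[of "\<lambda>t. visit m (n + 1) t X" 0 u \<tau>] by (simp add: lessThan_atLeast0)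
    finally have "visits_upto \<tau> m (n + 1) X \<le> visits m n X + visits_upto \<tau> m (n + 1) (path_after u X)"
      unfolding v by (simp add: before visit_after_first[OF assms hit] visits_upto_def)
    with 1 show ?thesis by (simp add: at_level_first[OF hit])
  next
    case never
    then have "visits m (n + 1) X = visits m n X"
      unfolding visits_def by (subst visit_before_first[OF assms]) (auto simp: hits_def)
    then show ?thesis using visits_upto_le_visits[of \<tau> m "n + 1" X] by (simp add: at_level_not_hits never)
  qed
  then show "visits m (n + 1) X = visits m n X + at_level n (visits m (n + 1)) X"
    and "visits_upto \<tau> m (n + 1) X \<le> visits m n X + at_level n (visits_upto \<tau> m (n + 1)) X" by auto
qed

text \<open>Until \<open>n + 1\<close> is reached the path stays on levels at most \<open>n\<close>,
  so each time belongs to exactly one \<open>k\<close>.\<close>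

lemma passage_time_eq_sum_visits:
  assumes "skip_free X" "fst (X 0) = n"
  shows "passage_time (n + 1) X = (\<Sum>k. visits (n - int k) (n + 1) X)"
proof -
  have pointwise: "(\<Sum>k. visit (n - int k) (n + 1) t X) = (if \<forall>s\<le>t. fst (X s) \<noteq> n + 1 then 1 else 0)" for t
  proof (cases "\<forall>s\<le>t. fst (X s) \<noteq> n + 1")
    case True
    have "fst (X t) < n + 1" using assms(2) by (intro skip_free_less[OF assms(1) _ True]) simp
    then have "fst (X t) = n - int k \<longleftrightarrow> k = nat (n - fst (X t))" for k
      by linarith
    then have "visit (n - int k) (n + 1) t X = (if k = nat (n - fst (X t)) then 1 else 0)" for k
      using True by (simp add: visit_def)
    then show ?thesis using True sums_unique[OF sums_single[of "nat (n - fst (X t))" "\<lambda>_. 1::ennreal"]] by simp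
  next
    case False
    then have "visit m (n + 1) t X = 0" for m by (simp only: visit_def if_False simp_thms)
    then show ?thesis using False by simp
  qed
  have "passage_time (n + 1) X = (\<integral>\<^sup>+t. (\<Sum>k. visit (n - int k) (n + 1) t X) \<partial>count_space UNIV)"
    by (simp only: passage_time_def nn_integral_count_space_nat pointwise)
  also have "\<dots> = (\<Sum>k. \<integral>\<^sup>+t. visit (n - int k) (n + 1) t X \<partial>count_space UNIV)"
    by (rule nn_integral_suminf) simp
  finally show ?thesis by (simp add: visits_def nn_integral_count_space_nat)
qed

context strip_walk
begin

lemma nn_integral_visits_below:
  "(\<integral>\<^sup>+X. visits m (n + 1) X \<partial>law (l, i)) = (\<integral>\<^sup>+X. visits m n X \<partial>law (l, i))
     + (\<Sum>j\<in>UNIV. ennreal (hit n (l, i) j) * (\<integral>\<^sup>+X. visits m (n + 1) X \<partial>law (n, j)))" (is ?eq)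
  and nn_integral_visits_upto_below:
  "(\<integral>\<^sup>+X. visits_upto \<tau> m (n + 1) X \<partial>law (l, i)) \<le> (\<integral>\<^sup>+X. visits m n X \<partial>law (l, i))
     + (\<Sum>j\<in>UNIV. ennreal (hit n (l, i) j) * (\<integral>\<^sup>+X. visits_upto \<tau> m (n + 1) X \<partial>law (n, j)))" (is ?le)
  if "l \<le> n"
proof -
  have "(\<integral>\<^sup>+X. visits m (n + 1) X \<partial>law (l, i))
      = (\<integral>\<^sup>+X. visits m n X + at_level n (visits m (n + 1)) X \<partial>law (l, i))"
    by (rule nn_integral_cong_AE, rule AE_mp[OF AE_skip_free[of "(l, i)"]])
      (auto intro!: AE_I2 visits_decompose simp: that)
  then show ?eq by (simp add: nn_integral_add strong_markov)
  have "(\<integral>\<^sup>+X. visits_upto \<tau> m (n + 1) X \<partial>law (l, i))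
      \<le> (\<integral>\<^sup>+X. visits m n X + at_level n (visits_upto \<tau> m (n + 1)) X \<partial>law (l, i))"
    by (rule nn_integral_mono_AE, rule AE_mp[OF AE_skip_free[of "(l, i)"]])
      (auto intro!: AE_I2 visits_decompose simp: that)
  then show ?le by (simp add: nn_integral_add strong_markov)
qed

lemma nn_integral_visits_start: "(\<integral>\<^sup>+X. visits m L X \<partial>law (L, i)) = 0"
  "(\<integral>\<^sup>+X. visits_upto \<tau> m L X \<partial>law (L, i)) = 0"
proof -
  have "AE X in law (L, i). fst (X 0) = L"
    using AE_skip_free[of "(L, i)"] by eventually_elim simp
  then have "AE X in law (L, i). visits m L X = 0" "AE X in law (L, i). visits_upto \<tau> m L X = 0"
    by (auto elim!: eventually_mono simp: visits_start)
  then show "(\<integral>\<^sup>+X. visits m L X \<partial>law (L, i)) = 0" "(\<integral>\<^sup>+X. visits_upto \<tau> m L X \<partial>law (L, i)) = 0"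
    by (simp_all add: nn_integral_0_iff_AE)
qed

text \<open>A step to the right contributes nothing, since a path starting on level
  \<open>n + 1\<close> has no counted visits.\<close>

lemma nn_integral_visits_first_step:
  "(\<integral>\<^sup>+X. visits m (n + 1) X \<partial>law (n, i)) = indicator {m} n
    + (\<Sum>j\<in>UNIV. ennreal (r n $ i $ j) * (\<integral>\<^sup>+X. visits m (n + 1) X \<partial>law (n, j)))
    + (\<Sum>j\<in>UNIV. ennreal (q n $ i $ j) * (\<integral>\<^sup>+X. visits m (n + 1) X \<partial>law (n - 1, j)))"
proof -
  have "(\<integral>\<^sup>+X. visits m (n + 1) X \<partial>law (n, i))
    = (\<integral>\<^sup>+y. (\<integral>\<^sup>+X. visits m (n + 1) (case_nat (n, i) X) \<partial>law y) \<partial>measure_pmf (K (n, i)))"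
    by (rule nn_integral_chain_step) measurable
  also have "\<dots> = (\<integral>\<^sup>+y. indicator {m} n + (\<integral>\<^sup>+X. visits m (n + 1) X \<partial>law y) \<partial>measure_pmf (K (n, i)))"
    by (simp add: visits_case_nat nn_integral_add)
  also have "\<dots> = indicator {m} n + (\<integral>\<^sup>+y. (\<integral>\<^sup>+X. visits m (n + 1) X \<partial>law y) \<partial>measure_pmf (K (n, i)))"
    by (subst nn_integral_add) auto
  finally show ?thesis
    by (simp add: nn_integral_K nn_integral_visits_start add.assoc)
qed

lemma nn_integral_visits_upto_first_step:
  "(\<integral>\<^sup>+X. visits_upto (Suc \<tau>) m (n + 1) X \<partial>law (n, i)) = indicator {m} n
    + (\<Sum>j\<in>UNIV. ennreal (r n $ i $ j) * (\<integral>\<^sup>+X. visits_upto \<tau> m (n + 1) X \<partial>law (n, j)))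
    + (\<Sum>j\<in>UNIV. ennreal (q n $ i $ j) * (\<integral>\<^sup>+X. visits_upto \<tau> m (n + 1) X \<partial>law (n - 1, j)))"
proof -
  have "(\<integral>\<^sup>+X. visits_upto (Suc \<tau>) m (n + 1) X \<partial>law (n, i))
    = (\<integral>\<^sup>+y. (\<integral>\<^sup>+X. visits_upto (Suc \<tau>) m (n + 1) (case_nat (n, i) X) \<partial>law y) \<partial>measure_pmf (K (n, i)))"
    by (rule nn_integral_chain_step) measurable
  also have "\<dots> = (\<integral>\<^sup>+y. indicator {m} n + (\<integral>\<^sup>+X. visits_upto \<tau> m (n + 1) X \<partial>law y) \<partial>measure_pmf (K (n, i)))"
    by (simp add: visits_upto_case_nat nn_integral_add)
  also have "\<dots> = indicator {m} n + (\<integral>\<^sup>+y. (\<integral>\<^sup>+X. visits_upto \<tau> m (n + 1) X \<partial>law y) \<partial>measure_pmf (K (n, i)))"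
    by (subst nn_integral_add) auto
  finally show ?thesis
    by (simp add: nn_integral_K nn_integral_visits_start add.assoc)
qed

end

text \<open>Here \<open>h\<close>, \<open>g\<close> and \<open>a\<close> are \<open>\<eta>\<close>, \<open>\<gamma>\<close> and \<open>a\<close> with \<open>\<eta>\<close> in place of \<open>\<zeta>\<close>, and
  \<open>w n m = a\<^sub>n \<cdots> a\<^bsub>n-m+1\<^esub> b\<^bsub>n-m\<^esub>\<close>.\<close>

locale strip_walk_exit = strip_walk p q r K
  for p q r :: "int \<Rightarrow> 'd::finite matr" and K +
  fixes k :: "int \<Rightarrow> real"
  assumes row_sum_qr_le: "row_sum (q n) i + row_sum (r n) i \<le> k n" and k_less_1: "k n < 1"
begin

text \<open>Transition matrix of one return to level \<open>n\<close> before \<open>n + 1\<close> is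
  met: a step within the level, or a step to the left followed by the next entrance into
  \<open>n\<close>.\<close>

definition loop :: "int \<Rightarrow> 'd matr" where
  "loop n = q n ** h (n - 1) + r n"

sublocale loop: strictly_substochastic "loop n" "k n" for n
proof
  show "nonneg_matrix (loop n)"
    unfolding loop_def by (intro nonneg_matrix_add nonneg_matrix_mult nonneg nonneg_h)
  show "row_sum (loop n) i \<le> k n" for i
    using row_sum_mult_le[OF nonneg(2)[of n] row_sum_h_le_1[of "n - 1"], of i] row_sum_qr_le[of n i]
    by (simp add: loop_def row_sum_add)
  show "k n < 1" by (rule k_less_1)
qed

definition g :: "int \<Rightarrow> 'd matr" where
  "g n = matrix_inv (mat 1 - q n ** h (n - 1) - r n)"

lemma g_eq: "g n = matrix_inv (mat 1 - loop n)"
  by (simp add: g_def loop_def diff_diff_eq)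

definition a :: "int \<Rightarrow> 'd matr" where
  "a n = g n ** q n"

fun w :: "int \<Rightarrow> nat \<Rightarrow> real ^ 'd" where
  "w n 0 = g n *v (\<chi> i. 1)"
| "w n (Suc m) = a n *v w (n - 1) m"

lemma nonneg_g: "nonneg_matrix (g n)"
  unfolding g_eq by (rule loop.nonneg_inverse)

lemma nonneg_a: "nonneg_matrix (a n)"
  unfolding a_def by (intro nonneg_matrix_mult nonneg_g nonneg)

lemma w_nonneg: "0 \<le> w n m $ i"
  by (induction n m arbitrary: i rule: w.induct)
    (auto intro!: mult_vec_nonneg nonneg_g nonneg_a)

text \<open>The means \<open>W\<close> solve \<open>W = y + loop W\<close>, but possibly with
  infinite values. Iterating the inequality for the truncated means \<open>V\<close> from 0 gives a
  bound uniform in \<open>\<tau>\<close>, hence finiteness of \<open>W\<close>; then the real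
  equation has a unique solution.\<close>

lemma nn_integral_visits_step:
  assumes IH: "\<And>j. (\<integral>\<^sup>+X. visits m n X \<partial>law (n - 1, j)) = ennreal (v $ j)" and v: "\<And>j. 0 \<le> v $ j"
  shows "(\<integral>\<^sup>+X. visits m (n + 1) X \<partial>law (n, i)) = ennreal ((g n *v ((\<chi> i. indicator {m} n) + q n *v v)) $ i)"
proof -
  define y where "y = (\<chi> i. indicator {m} n) + q n *v v"
  define W where "W i = (\<integral>\<^sup>+X. visits m (n + 1) X \<partial>law (n, i))" for i
  define V where "V \<tau> i = (\<integral>\<^sup>+X. visits_upto \<tau> m (n + 1) X \<partial>law (n, i))" for \<tau> i
  have nn: "0 \<le> q n $ i $ j" "0 \<le> r n $ i $ j" "0 \<le> h n $ i $ j" for n i j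
    using nonneg nonneg_h by (auto simp: nonneg_matrix_def)
  have loop_nn: "0 \<le> loop n $ i $ j" for i j
    using loop.nonneg[of n] by (simp add: nonneg_matrix_def)
  have qv: "0 \<le> (q n *v v) $ i" for i
    by (intro mult_vec_nonneg nonneg v)
  have y: "0 \<le> y $ i" for i
    using qv[of i] by (simp add: y_def)
  have hit_h: "hit n (n - 1, j) l = h (n - 1) $ j $ l" for j l
    by (simp add: h_def)
  \<comment> \<open>After a step to the left, \<open>v\<close> counts the visits before the return
    to level \<open>n\<close>, and \<open>h (n - 1)\<close> distributes the position of that return.
    The identity collects both into \<open>y\<close> and \<open>loop\<close>.\<close>
  have rhs: "indicator {m} n + (\<Sum>j\<in>UNIV. ennreal (r n $ i $ j) * F j)
      + (\<Sum>j\<in>UNIV. ennreal (q n $ i $ j) * (ennreal (v $ j) + (\<Sum>l\<in>UNIV. ennreal (h (n - 1) $ j $ l) * F l)))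
     = ennreal (y $ i) + (\<Sum>l\<in>UNIV. ennreal (loop n $ i $ l) * F l)" for F i
  proof -
    have "(\<Sum>j\<in>UNIV. ennreal (q n $ i $ j) * ennreal (v $ j)) = ennreal ((q n *v v) $ i)"
      using nn v by (simp add: matrix_vector_mult_def sum_nonneg flip: ennreal_mult)
    moreover have "ennreal (y $ i) = indicator {m} n + ennreal ((q n *v v) $ i)"
      using qv by (auto simp: y_def ennreal_plus split: split_indicator)
    moreover have "(\<Sum>j\<in>UNIV. ennreal (q n $ i $ j) * (\<Sum>l\<in>UNIV. ennreal (h (n - 1) $ j $ l) * F l))
       = (\<Sum>l\<in>UNIV. ennreal ((q n ** h (n - 1)) $ i $ l) * F l)"
    proof -
      have "(\<Sum>j\<in>UNIV. ennreal (q n $ i $ j) * (\<Sum>l\<in>UNIV. ennreal (h (n - 1) $ j $ l) * F l))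
         = (\<Sum>j\<in>UNIV. \<Sum>l\<in>UNIV. ennreal (q n $ i $ j * h (n - 1) $ j $ l) * F l)"
        using nn by (simp add: sum_distrib_left ennreal_mult mult.assoc)
      also have "\<dots> = (\<Sum>l\<in>UNIV. \<Sum>j\<in>UNIV. ennreal (q n $ i $ j * h (n - 1) $ j $ l) * F l)"
        by (rule sum.swap)
      also have "\<dots> = (\<Sum>l\<in>UNIV. ennreal ((q n ** h (n - 1)) $ i $ l) * F l)"
        using nn by (simp add: matrix_matrix_mult_def flip: sum_distrib_right)
      finally show ?thesis .
    qed
    moreover have "0 \<le> (q n ** h (n - 1)) $ i $ l" for l
      using nonneg_matrix_mult[OF nonneg(2)[of n] nonneg_h[of "n - 1"]] by (simp add: nonneg_matrix_def)
    then have "(\<Sum>l\<in>UNIV. ennreal (loop n $ i $ l) * F l)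
       = (\<Sum>l\<in>UNIV. ennreal ((q n ** h (n - 1)) $ i $ l) * F l) + (\<Sum>l\<in>UNIV. ennreal (r n $ i $ l) * F l)"
      using nn by (simp add: loop_def ennreal_plus distrib_right sum.distrib)
    ultimately show ?thesis by (simp add: distrib_left sum.distrib ac_simps)
  qed
  have W: "W i = ennreal (y $ i) + (\<Sum>l\<in>UNIV. ennreal (loop n $ i $ l) * W l)" for i
    unfolding rhs[symmetric] using nn_integral_visits_first_step[where m = m and n = n and i = i] nn_integral_visits_below[where l = "n - 1" and n = n and m = m]
    by (simp add: W_def IH hit_h)
  have V: "V (Suc \<tau>) i \<le> ennreal (y $ i) + (\<Sum>l\<in>UNIV. ennreal (loop n $ i $ l) * V \<tau> l)" for \<tau> i
  proof -
    have "V (Suc \<tau>) i \<le> indicator {m} n + (\<Sum>j\<in>UNIV. ennreal (r n $ i $ j) * V \<tau> j)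
      + (\<Sum>j\<in>UNIV. ennreal (q n $ i $ j) * (ennreal (v $ j) + (\<Sum>l\<in>UNIV. ennreal (h (n - 1) $ j $ l) * V \<tau> l)))"
      unfolding V_def nn_integral_visits_upto_first_step
      using nn_integral_visits_upto_below[where l = "n - 1" and n = n and m = m and \<tau> = \<tau>]
      by (intro add_mono order_refl sum_mono mult_left_mono) (auto simp: IH hit_h)
    then show ?thesis unfolding rhs .
  qed
  \<comment> \<open>The fixed point of \<open>B = infnorm y + k n * B\<close>, so the iteration
    preserves the bound.\<close>
  define B where "B = infnorm y / (1 - k n)"
  have B: "0 \<le> B" using k_less_1[of n] by (simp add: B_def infnorm_pos_le)
  have "V \<tau> i \<le> ennreal B" for \<tau> i
  proof (induction \<tau> arbitrary: i)
    case 0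
    then show ?case by (simp add: V_def visits_upto_def)
  next
    case (Suc \<tau>)
    have "V (Suc \<tau>) i \<le> ennreal (y $ i) + (\<Sum>l\<in>UNIV. ennreal (loop n $ i $ l) * ennreal B)"
      by (rule order_trans[OF V]) (intro add_left_mono sum_mono mult_left_mono Suc, simp)
    also have "\<dots> = ennreal (y $ i + row_sum (loop n) i * B)"
      using loop_nn B y by (simp add: row_sum_def sum_distrib_right sum_nonneg ennreal_plus flip: ennreal_mult)
    also have "\<dots> \<le> ennreal (infnorm y + k n * B)"
      using component_le_infnorm_cart[of y i] loop.row_sum_le B
      by (intro ennreal_leI add_mono mult_right_mono) auto
    also have "infnorm y + k n * B = B"
      using k_less_1[of n] by (simp add: B_def field_simps)
    finally show ?case .
  qed
  moreover have "W i = (SUP \<tau>. V \<tau> i)" for i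
    unfolding W_def V_def visits_eq_SUP
    by (rule nn_integral_monotone_convergence_SUP) (auto simp: incseq_def le_fun_def visits_upto_mono)
  ultimately have "W i \<le> ennreal B" for i by (simp add: SUP_least)
  then have fin: "W i < \<top>" for i by (metis ennreal_less_top le_less_trans)
  define x where "x = (\<chi> i. enn2real (W i))"
  have Wx: "W i = ennreal (x $ i)" for i using fin by (simp add: x_def)
  have x0: "0 \<le> x $ i" for i by (simp add: x_def)
  have "x = loop n *v x + y"
  proof -
    have lx: "0 \<le> (loop n *v x) $ i" for i by (rule mult_vec_nonneg[OF loop.nonneg x0])
    have "ennreal (x $ i) = ennreal (y $ i + (loop n *v x) $ i)" for i
      using W[of i] x0 y loop_nn
      by (simp add: Wx matrix_vector_mult_def sum_nonneg ennreal_plus flip: ennreal_mult)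
    then have "x $ i = y $ i + (loop n *v x) $ i" for i
      using x0 y lx
      by (subst (asm) ennreal_inj) (auto intro: add_nonneg_nonneg)
    then show ?thesis by (simp add: vec_eq_iff)
  qed
  then have "x = g n *v y" unfolding g_eq by (rule loop.solution_unique_vec)
  then show ?thesis using Wx[of i] by (simp add: W_def y_def)
qed

lemma nn_integral_visits_eq:
  "(\<integral>\<^sup>+X. visits (n - int m) (n + 1) X \<partial>law (n, i)) = ennreal (w n m $ i)"
proof (induction n m arbitrary: i rule: w.induct)
  case (1 n)
  have "(\<integral>\<^sup>+X. visits n (n + 1) X \<partial>law (n, i)) = ennreal ((g n *v ((\<chi> i. indicator {n} n) + q n *v 0)) $ i)"
    by (rule nn_integral_visits_step) (auto simp: visits_self)
  then show ?case by simp
next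
  case (2 n m)
  have "(\<integral>\<^sup>+X. visits (n - int (Suc m)) (n + 1) X \<partial>law (n, i))
     = ennreal ((g n *v ((\<chi> i. indicator {n - int (Suc m)} n) + q n *v w (n - 1) m)) $ i)"
    by (rule nn_integral_visits_step) (use 2 in \<open>auto simp: w_nonneg algebra_simps\<close>)
  moreover have "(\<chi> i. indicator {n - int (Suc m)} n) = (0 :: real ^ 'd)"
    by (simp add: vec_eq_iff)
  ultimately show ?case by (simp add: a_def matrix_vector_mul_assoc)
qed

lemma nn_integral_passage_time:
  "(\<integral>\<^sup>+X. passage_time (n + 1) X \<partial>law (n, i)) = (\<Sum>m. ennreal (w n m $ i))"
proof -
  have "(\<integral>\<^sup>+X. passage_time (n + 1) X \<partial>law (n, i)) = (\<integral>\<^sup>+X. (\<Sum>m. visits (n - int m) (n + 1) X) \<partial>law (n, i))"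
    by (rule nn_integral_cong_AE, rule AE_mp[OF AE_skip_free[of "(n, i)"]])
      (auto intro!: AE_I2 passage_time_eq_sum_visits)
  also have "\<dots> = (\<Sum>m. ennreal (w n m $ i))"
    by (subst nn_integral_suminf) (auto simp: nn_integral_visits_eq)
  finally show ?thesis .
qed

text \<open>Between the first passages of levels \<open>N\<close> and \<open>N + 1\<close> level 0
  receives on average at most \<open>s N\<close> visits. Summability makes the expected total
  finite.\<close>

lemma AE_finite_visits:
  assumes s: "\<And>n i. w (int n) n $ i \<le> s n" and summable: "summable s"
  shows "AE X in law (0, i). finite {t. fst (X t) = 0}"
proof -
  have s0: "0 \<le> s n" for n using order_trans[OF w_nonneg s] .
  have bound: "(\<integral>\<^sup>+X. visits 0 (int N) X \<partial>law (0, i)) \<le> ennreal (\<Sum>n<N. s n)" for N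
  proof (induction N)
    case 0
    then show ?case by (simp add: visits_self)
  next
    case (Suc N)
    have "(\<integral>\<^sup>+X. visits 0 (int N + 1) X \<partial>law (0, i)) = (\<integral>\<^sup>+X. visits 0 (int N) X \<partial>law (0, i))
     + (\<Sum>j\<in>UNIV. ennreal (hit (int N) (0, i) j) * ennreal (w (int N) N $ j))"
      using nn_integral_visits_eq[where n = "int N" and m = N] by (subst nn_integral_visits_below) auto
    also have "\<dots> \<le> ennreal (\<Sum>n<N. s n) + (\<Sum>j\<in>UNIV. ennreal (hit (int N) (0, i) j) * ennreal (s N))"
      by (intro add_mono Suc sum_mono mult_left_mono ennreal_leI s) auto
    also have "(\<Sum>j\<in>UNIV. ennreal (hit (int N) (0, i) j) * ennreal (s N)) = ennreal ((\<Sum>j\<in>UNIV. hit (int N) (0, i) j) * s N)"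
      using s0 by (simp add: sum_distrib_right hit_nonneg sum_nonneg flip: ennreal_mult)
    also have "ennreal (\<Sum>n<N. s n) + \<dots> \<le> ennreal (\<Sum>n<N. s n) + ennreal (1 * s N)"
      by (intro add_left_mono ennreal_leI mult_right_mono sum_hit_le_1 s0)
    finally show ?case using s0 by (simp add: ennreal_plus sum_nonneg add.commute)
  qed
  define total :: "(nat \<Rightarrow> int \<times> 'd) \<Rightarrow> ennreal" where "total X = (\<Sum>t. if fst (X t) = 0 then 1 else 0)" for X
  have [measurable]: "total \<in> borel_measurable path_space" unfolding total_def by measurable
  have "(\<integral>\<^sup>+X. total X \<partial>law (0, i)) = (\<Sum>t. \<integral>\<^sup>+X. (if fst (X t) = 0 then 1 else 0) \<partial>law (0, i))"
    unfolding total_def by (rule nn_integral_suminf) measurable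
  also have "\<dots> \<le> ennreal (\<Sum>n. s n)"
  proof (rule suminf_le_const)
    fix \<tau>
    have "(\<Sum>t<\<tau>. \<integral>\<^sup>+X. (if fst (X t) = 0 then 1 else 0) \<partial>law (0, i))
      = (\<integral>\<^sup>+X. (\<Sum>t<\<tau>. if fst (X t) = 0 then 1 else 0) \<partial>law (0, i))"
      by (rule nn_integral_sum[symmetric]) measurable
    also have "\<dots> \<le> (\<integral>\<^sup>+X. visits 0 (int \<tau>) X \<partial>law (0, i))"
    proof (rule nn_integral_mono_AE, rule AE_mp[OF AE_skip_free[of "(0, i)"]], intro AE_I2 impI)
      fix X :: "nat \<Rightarrow> int \<times> 'd" assume X: "X 0 = (0, i) \<and> skip_free X"
      \<comment> \<open>Level \<open>\<tau>\<close> cannot be reached before time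
        \<open>\<tau>\<close>, so the visits counted up to then all precede it. Hence the bound does
        not presuppose that high levels are ever reached.\<close>
      have "fst (X t) \<le> int t" for t
      proof (induction t)
        case (Suc t)
        moreover have "\<bar>fst (X (Suc t)) - fst (X t)\<bar> \<le> 1" using X by (simp add: skip_free_def)
        ultimately show ?case by linarith
      qed (use X in simp)
      then have "fst (X s) \<noteq> int \<tau>" if "s < \<tau>" for s
        using that by (metis linorder_not_le of_nat_less_iff)
      then have "(\<Sum>t<\<tau>. if fst (X t) = 0 then 1 else 0) = visits_upto \<tau> 0 (int \<tau>) X"
        unfolding visits_upto_def visit_def by (intro sum.cong) auto
      then show "(\<Sum>t<\<tau>. if fst (X t) = 0 then 1 else 0) \<le> visits 0 (int \<tau>) X"
        using visits_upto_le_visits by simp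
    qed
    also have "\<dots> \<le> ennreal (\<Sum>n<\<tau>. s n)" by (rule bound)
    also have "\<dots> \<le> ennreal (\<Sum>n. s n)" by (intro ennreal_leI sum_le_suminf summable s0) auto
    finally show "(\<Sum>t<\<tau>. \<integral>\<^sup>+X. (if fst (X t) = 0 then 1 else 0) \<partial>law (0, i)) \<le> ennreal (\<Sum>n. s n)" .
  qed auto
  finally have "(\<integral>\<^sup>+X. total X \<partial>law (0, i)) < \<infinity>"
    by (rule order.strict_trans1) simp
  then have "AE X in law (0, i). total X \<noteq> \<infinity>"
    by (intro nn_integral_noteq_infinite) (auto simp: less_top)
  then show ?thesis
  proof eventually_elim
    case (elim X)
    have "total X = (\<integral>\<^sup>+t. indicator {t. fst (X t) = 0} t \<partial>count_space UNIV)"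
      unfolding total_def nn_integral_count_space_nat
      by (intro arg_cong[where f = suminf] ext) (simp add: indicator_def)
    also have "\<dots> = emeasure (count_space UNIV) {t. fst (X t) = 0}" by simp
    finally show ?case using elim by (auto simp: emeasure_count_space split: if_splits)
  qed
qed

end

section \<open>A zero-one law for hitting times\<close>

definition transient_path :: "(nat \<Rightarrow> int \<times> 'd) \<Rightarrow> bool" where
  "transient_path X \<longleftrightarrow> skip_free X \<and> (\<exists>L0. \<forall>L\<ge>L0. hits L X)"

text \<open>A natural number, unspecified if the level is missed; it is meaningful only on paths
  that hit the level.\<close>

definition first_time :: "(nat \<Rightarrow> int \<times> 'd) \<Rightarrow> nat \<Rightarrow> nat" where
  "first_time X n = (LEAST t. fst (X t) = int n)"

lemma first_time_measurable [measurable]: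
  "(\<lambda>X. first_time X n) \<in> measurable path_space (count_space UNIV)"
  unfolding first_time_def by measurable

lemma first_time_eq: "first_at (level (int n)) t X \<Longrightarrow> first_time X n = t"
  unfolding first_time_def by (rule Least_equality) (auto simp: first_at_def intro: leI)

lemma first_at_first_time: "hits (int n) X \<Longrightarrow> first_at (level (int n)) (first_time X n) X"
  by (auto simp: hits_iff_first_at first_time_eq)

lemma first_time_path_after:
  assumes "hits (int n) X" "\<And>s. s < t \<Longrightarrow> fst (X s) \<noteq> int n"
  shows "first_time X n = t + first_time (path_after t X) n"
proof -
  define u where "u = first_time X n"
  have u: "first_at (level (int n)) u X" unfolding u_def by (rule first_at_first_time[OF assms(1)])
  then have tu: "t \<le> u" using assms(2)[of u] by (auto simp: first_at_def not_less[symmetric])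
  have "first_at (level (int n)) (u - t) (path_after t X)"
    using u tu by (auto simp: first_at_def)
  from first_time_eq[OF this] tu show ?thesis by (simp add: u_def)
qed

lemma eventually_first_time_path_after:
  assumes "transient_path X"
  shows "\<exists>n0. \<forall>n\<ge>n0. first_time X n = t + first_time (path_after t X) n"
proof -
  from assms obtain L0 where L0: "\<And>L. L \<ge> L0 \<Longrightarrow> hits L X" by (auto simp: transient_path_def)
  \<comment> \<open>Levels from here on are reached, and lie above everything visited up to time
    \<open>t\<close>, so they are first reached after time \<open>t\<close>.\<close>
  define n0 where "n0 = nat (max L0 (Max ((\<lambda>s. fst (X s)) ` {..t}) + 1))"
  have "first_time X n = t + first_time (path_after t X) n" if n: "n0 \<le> n" for n
  proof (rule first_time_path_after)
    show "hits (int n) X" using n by (intro L0) (auto simp: n0_def)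
    fix s assume "s < t"
    then have "fst (X s) \<le> Max ((\<lambda>s. fst (X s)) ` {..t})" by (intro Max_ge) auto
    with n show "fst (X s) \<noteq> int n" by (auto simp: n0_def)
  qed
  then show ?thesis by blast
qed

context strip_walk
begin

lemma sum_hit_eq_1:
  assumes st: "\<And>n. stochastic (h n)" and "m \<le> n"
  shows "(\<Sum>j\<in>UNIV. hit n (m, i) j) = 1"
  using \<open>m \<le> n\<close>
proof (induction n rule: int_ge_induct)
  case base
  then show ?case by (simp add: hit_self)
next
  case (step n)
  have "(\<Sum>j\<in>UNIV. hit (n + 1) (m, i) j) = (\<Sum>j\<in>UNIV. \<Sum>l\<in>UNIV. hit n (m, i) l * h n $ l $ j)"
    using step.hyps by (simp add: hit_below)
  also have "\<dots> = (\<Sum>l\<in>UNIV. hit n (m, i) l * row_sum (h n) l)"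
    by (subst sum.swap) (simp add: row_sum_def sum_distrib_left)
  also have "\<dots> = 1" using st step.IH by (simp add: stochastic_iff)
  finally show ?case .
qed

lemma AE_hits:
  assumes "\<And>n. stochastic (h n)" "fst x \<le> L"
  shows "AE X in law x. hits L X"
proof -
  interpret prob_space "law x" by (rule prob_space_chain)
  have "emeasure (law x) {X. hits L X} = 1"
    using sum_hit_eq_1[OF assms(1), of "fst x" L "snd x"] assms(2) by (simp flip: sum_hit)
  then have "prob {X. hits L X} = 1" by (simp add: emeasure_eq_measure)
  then show ?thesis by (subst (asm) prob_eq_1) auto
qed

lemma AE_transient_path:
  assumes "\<And>n. stochastic (h n)"
  shows "AE X in law x. X 0 = x \<and> skip_free X \<and> (\<forall>L\<ge>fst x. hits L X)"
proof -
  have "AE X in law x. \<forall>L. fst x \<le> L \<longrightarrow> hits L X"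
    unfolding AE_all_countable by (intro allI AE_impI AE_hits assms)
  with AE_skip_free[of x] show ?thesis by eventually_elim auto
qed

lemma AE_transient:
  assumes "\<And>n. stochastic (h n)"
  shows "AE X in law x. transient_path X"
  using AE_transient_path[OF assms, of x] by eventually_elim (auto simp: transient_path_def)

text \<open>A tail event has the same probability from every starting point, because its probability is
  harmonic and the hitting matrices contract oscillations. By the Markov property it is then
  independent of every cylinder, hence of itself.\<close>

lemma tail_zero_one:
  assumes st: "\<And>n. stochastic (h n)"
    and e: "0 < e" "\<And>N. \<exists>m\<ge>N. \<forall>i j. e \<le> h (int m) $ i $ j"
    and Q [measurable]: "Measurable.pred path_space Q"
    and tail: "\<And>X t. transient_path X \<Longrightarrow> Q (path_after t X) \<longleftrightarrow> Q X"
  shows "(\<forall>x. AE X in law x. Q X) \<or> (\<forall>x. AE X in law x. \<not> Q X)"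
proof -
  have sets [measurable]: "Collect Q \<in> sets path_space" by (rule Collect_in_path_sets[OF Q])
  define H where "H x = measure (law x) (Collect Q)" for x
  have eH: "emeasure (law x) (Collect Q) = ennreal (H x)" for x
  proof -
    interpret prob_space "law x" by (rule prob_space_chain)
    show ?thesis by (simp add: H_def emeasure_eq_measure)
  qed
  have H01: "0 \<le> H x" "H x \<le> 1" for x
    by (auto simp: H_def intro: prob_space.prob_le_1[OF prob_space_chain])
  have harm: "H (n, i) = (\<Sum>j\<in>UNIV. h n $ i $ j * H (n + 1, j))" for n i
  proof -
    have "ennreal (H (n, i)) = (\<integral>\<^sup>+X. indicator (Collect Q) X \<partial>law (n, i))"
      by (simp add: eH)
    also have "\<dots> = (\<integral>\<^sup>+X. at_level (n + 1) (indicator (Collect Q)) X \<partial>law (n, i))"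
    proof (rule nn_integral_cong_AE)
      show "AE X in law (n, i). indicator (Collect Q) X = at_level (n + 1) (indicator (Collect Q)) X"
        using AE_transient[OF st, of "(n, i)"] AE_hits[OF st, of "(n, i)" "n + 1", simplified]
      proof eventually_elim
        case (elim X)
        then obtain t where t: "first_at (level (n + 1)) t X" by (auto simp: hits_iff_first_at)
        show ?case using tail[OF elim(1), of t] by (simp add: at_level_first[OF t] indicator_def)
      qed
    qed
    also have "\<dots> = (\<Sum>j\<in>UNIV. ennreal (h n $ i $ j) * ennreal (H (n + 1, j)))"
      by (subst strong_markov) (auto simp: eH h_def)
    also have "\<dots> = ennreal (\<Sum>j\<in>UNIV. h n $ i $ j * H (n + 1, j))"
      using H01 nonneg_h[of n] by (simp add: nonneg_matrix_def flip: ennreal_mult)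
    finally show ?thesis
      using H01 nonneg_h[of n] by (subst (asm) ennreal_inj) (auto simp: nonneg_matrix_def intro!: sum_nonneg)
  qed
  have contract: "H (n, i) - H (n, j) \<le> (1 - e') * D"
    if D: "\<And>i j. H (n + 1, i) - H (n + 1, j) \<le> D" and e': "\<And>i j. e' \<le> h n $ i $ j" "0 \<le> e'" for n i j e' D
    using stochastic_contraction[OF st[of n] e', of "\<chi> i. H (n + 1, i)" D i j] D
    by (simp add: harm[of n] matrix_vector_mult_def)
  have nn: "0 \<le> h n $ i $ j" for n i j using nonneg_h[of n] by (simp add: nonneg_matrix_def)
  \<comment> \<open>With the trivial lower bound 0 for the entries, oscillation does not grow when
    passing to lower levels.\<close>
  have backwards: "H (n, i) - H (n, j) \<le> D" if "n \<le> m" "\<And>i j. H (m, i) - H (m, j) \<le> D" for n m :: int and i j D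
    using that(1)
  proof (induction n arbitrary: i j rule: int_le_induct)
    case base
    show ?case by (rule that(2))
  next
    case (step n)
    have "H (n - 1, i) - H (n - 1, j) \<le> (1 - 0) * D"
      by (rule contract) (use step.IH nn in auto)
    then show ?case by simp
  qed
  have e1: "e \<le> 1"
  proof -
    obtain m where "\<forall>i j. e \<le> h (int m) $ i $ j" using e(2) by blast
    then have "e \<le> hit (int m + 1) (int m, undefined) undefined" by (simp add: h_def)
    also have "\<dots> \<le> 1" by (simp add: hit_def prob_space.prob_le_1[OF prob_space_chain])
    finally show ?thesis .
  qed
  \<comment> \<open>\<open>k\<close> counts uniformly positive levels above \<open>n\<close>. The
    bound 1 holds on every level; each such level passed on the way down contributes a factor
    \<open>1 - e\<close>.\<close>
  have osc: "H (n, i) - H (n, j) \<le> (1 - e) ^ k" for n i j k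
  proof (induction k arbitrary: n i j)
    case 0
    show ?case using H01[of "(n, i)"] H01[of "(n, j)"] by simp
  next
    case (Suc k)
    obtain m where m: "nat n \<le> m" "\<forall>i j. e \<le> h (int m) $ i $ j" using e(2) by blast
    show ?case
    proof (rule backwards[of n "int m"])
      show "n \<le> int m" using m by simp
      show "H (int m, i) - H (int m, j) \<le> (1 - e) ^ Suc k" for i j
        using contract[of "int m" "(1 - e) ^ k" e i j] Suc m e(1) by simp
    qed
  qed
  have "H (n, i) - H (n, j) \<le> 0" for n i j
  proof (rule LIMSEQ_le_const)
    show "(\<lambda>k. (1 - e) ^ k) \<longlonglongrightarrow> 0" using e(1) e1 by (intro LIMSEQ_power_zero) auto
    show "\<exists>N. \<forall>k\<ge>N. H (n, i) - H (n, j) \<le> (1 - e) ^ k" using osc by blast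
  qed
  from this have same: "H (n, i) = H (n, j)" for n i j by (meson antisym diff_le_0_iff_le)
  have up: "H (n, i) = H (n + 1, i)" for n i
  proof -
    have "H (n, i) = row_sum (h n) i * H (n + 1, i)"
      unfolding harm[of n i] row_sum_def sum_distrib_right by (intro sum.cong refl arg_cong2[where f = "(*)"] same)
    then show ?thesis using st by (simp add: stochastic_iff)
  qed
  define c where "c = H (0, undefined)"
  have "H (n, undefined) = c" for n
  proof (induction n rule: int_induct[where k = 0])
    case (step2 n)
    then show ?case using up[of "n - 1" undefined] by simp
  qed (use up in \<open>auto simp: c_def\<close>)
  then have const: "H x = c" for x by (metis same surj_pair)
  have c01: "0 \<le> c" "c \<le> 1" using H01 const by metis+
  \<comment> \<open>Independence of cylinders: by the tail property the first step may be dropped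
    from the event, and the remaining probability is \<open>c\<close> from every state.\<close>
  have cyl: "(\<integral>\<^sup>+X. indicator (Collect Q) X * indicator (cylinder m y) X \<partial>law x) = ennreal c * emeasure (law x) (cylinder m y)" for x m y
  proof (induction m arbitrary: x y)
    case 0
    have "(\<integral>\<^sup>+X. indicator (Collect Q) X * indicator (cylinder 0 y) X \<partial>law x)
       = (\<integral>\<^sup>+X. indicator (Collect Q) X * indicator {y 0} x \<partial>law x)"
      by (rule nn_integral_cong_AE, rule AE_mp[OF AE_chain_0[where K = K and x = x]])
        (auto intro!: AE_I2 simp: cylinder_def split: split_indicator)
    also have "\<dots> = ennreal c * indicator {y 0} x" by (simp add: nn_integral_multc eH const)
    also have "indicator {y 0} x = emeasure (law x) (cylinder 0 y)" by (simp add: emeasure_chain_cylinder)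
    finally show ?case .
  next
    case (Suc m)
    have vim: "indicator (cylinder (Suc m) y) (case_nat x X)
        = (indicator {y 0} x * indicator (cylinder m (\<lambda>t. y (Suc t))) X :: ennreal)" for X
      by (auto simp: cylinder_def less_Suc_eq_le[symmetric] All_less_Suc2 split: split_indicator)
    have "(\<integral>\<^sup>+X. indicator (Collect Q) X * indicator (cylinder (Suc m) y) X \<partial>law x)
       = (\<integral>\<^sup>+X. indicator (Collect Q) (path_after 1 X) * indicator (cylinder (Suc m) y) X \<partial>law x)"
      by (rule nn_integral_cong_AE, rule AE_mp[OF AE_transient[OF st, of x]])
        (auto intro!: AE_I2 simp: tail split: split_indicator)
    also have "\<dots> = (\<integral>\<^sup>+z. (\<integral>\<^sup>+X. indicator {y 0} x * (indicator (Collect Q) X * indicator (cylinder m (\<lambda>t. y (Suc t))) X) \<partial>law z) \<partial>measure_pmf (K x))"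
      by (subst nn_integral_chain_step) (auto simp: vim path_after_Suc_case_nat[of 0, simplified] ac_simps)
    also have "\<dots> = (\<integral>\<^sup>+z. indicator {y 0} x * (ennreal c * emeasure (law z) (cylinder m (\<lambda>t. y (Suc t)))) \<partial>measure_pmf (K x))"
      by (simp add: nn_integral_cmult Suc)
    also have "\<dots> = ennreal c * (\<integral>\<^sup>+z. (\<integral>\<^sup>+X. indicator (cylinder (Suc m) y) (case_nat x X) \<partial>law z) \<partial>measure_pmf (K x))"
      by (simp add: vim nn_integral_cmult ac_simps)
    also have "(\<integral>\<^sup>+z. (\<integral>\<^sup>+X. indicator (cylinder (Suc m) y) (case_nat x X) \<partial>law z) \<partial>measure_pmf (K x))
      = (\<integral>\<^sup>+X. indicator (cylinder (Suc m) y) X \<partial>law x)"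
      by (rule nn_integral_chain_step[symmetric]) measurable
    finally show ?case by simp
  qed
  have c_sq: "c = c * c"
  proof -
    fix x
    \<comment> \<open>Agreement on cylinders extends to all measurable sets, in particular to the
      event itself, where it reads \<open>c = c * c\<close>.\<close>
    have eq: "density (law x) (indicator (Collect Q)) = scale_measure (ennreal c) (law x)"
    proof (rule path_measure_eqI)
      interpret prob_space "law x" by (rule prob_space_chain)
      show "finite_measure (density (law x) (indicator (Collect Q)))"
        by (rule finite_measureI) (simp add: emeasure_density eH)
      show "emeasure (density (law x) (indicator (Collect Q))) (cylinder m y)
          = emeasure (scale_measure (ennreal c) (law x)) (cylinder m y)" for m y
        by (simp add: emeasure_density cyl)
    qed auto
    have "emeasure (density (law x) (indicator (Collect Q))) (Collect Q) = ennreal c"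
      by (simp add: emeasure_density eH const flip: indicator_inter_arith)
    moreover have "emeasure (scale_measure (ennreal c) (law x)) (Collect Q) = ennreal (c * c)"
      using c01 by (simp add: eH const ennreal_mult)
    ultimately show "c = c * c" using c01 by (simp add: eq)
  qed
  then have "c = 0 \<or> c = 1" by auto
  then show ?thesis
  proof
    assume "c = 1"
    have "AE X in law x. Q X" for x
    proof -
      interpret prob_space "law x" by (rule prob_space_chain)
      have "prob (Collect Q) = 1" using const[of x] \<open>c = 1\<close> by (simp add: H_def)
      then show ?thesis by (subst (asm) prob_eq_1) auto
    qed
    then show ?thesis by blast
  next
    assume "c = 0"
    have "AE X in law x. \<not> Q X" for x
    proof -
      interpret prob_space "law x" by (rule prob_space_chain)
      have "prob (Collect Q) = 0" using const[of x] \<open>c = 0\<close> by (simp add: H_def)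
      then show ?thesis by (subst (asm) prob_eq_0) auto
    qed
    then show ?thesis by blast
  qed
qed

text \<open>Restarting the path changes \<open>first_time\<close> only by a constant for large
  \<open>n\<close>. The factor \<open>s\<close> will be 1 or -1, so that limsup and liminf are
  treated together.\<close>

lemma first_time_zero_one:
  assumes "\<And>n. stochastic (h n)" "0 < e" "\<And>N. \<exists>m\<ge>N. \<forall>i j. e \<le> h (int m) $ i $ j"
  shows "(\<forall>x. AE X in law x. exceeds c (\<lambda>n. s * real (first_time X n)))
    \<or> (\<forall>x. AE X in law x. \<not> exceeds c (\<lambda>n. s * real (first_time X n)))"
proof (rule tail_zero_one[OF assms])
  show "Measurable.pred path_space (\<lambda>X. exceeds c (\<lambda>n. s * real (first_time (X :: nat \<Rightarrow> int \<times> 'd) n)))"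
    by measurable
  fix X :: "nat \<Rightarrow> int \<times> 'd" and t assume "transient_path X"
  from eventually_first_time_path_after[OF this, of t] obtain n0
    where "\<And>n. n \<ge> n0 \<Longrightarrow> first_time X n = t + first_time (path_after t X) n" by blast
  then show "exceeds c (\<lambda>n. s * real (first_time (path_after t X) n)) \<longleftrightarrow> exceeds c (\<lambda>n. s * real (first_time X n))"
    by (intro exceeds_cong_eventually[of n0 _ _ "- s * real t"]) (auto simp: algebra_simps)
qed

end

section \<open>Speed of a single path\<close>

lemma skip_free_ge:
  assumes "skip_free X" "s \<le> t"
  shows "fst (X s) - int (t - s) \<le> fst (X t)"
  using assms(2)
proof (induction t rule: dec_induct)
  case (step t)
  have "\<bar>fst (X (Suc t)) - fst (X t)\<bar> \<le> 1" using assms(1) by (simp add: skip_free_def)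
  with step show ?case by (auto simp: of_nat_diff)
qed simp

lemma hitting_time_first_at:
  assumes t: "first_at (level L) t X"
  shows "hitting_time X L = enat t"
  unfolding hitting_time_def
proof (rule antisym)
  show "Inf {enat t |t. fst (X t) = L} \<le> enat t"
    using t by (intro Inf_lower) (auto simp: first_at_def)
  show "enat t \<le> Inf {enat t |t. fst (X t) = L}"
    using t by (intro Inf_greatest) (auto simp: first_at_def not_less[symmetric])
qed

lemma hitting_time_eq: "hits (int n) X \<Longrightarrow> hitting_time X (int n) = enat (first_time X n)"
  by (intro hitting_time_first_at first_at_first_time)

context
  fixes X :: "nat \<Rightarrow> int \<times> 'd" and m :: ennreal
  assumes sf: "skip_free X" and start: "fst (X 0) = 0" and hits: "\<And>L. 0 \<le> L \<Longrightarrow> hits L X"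
    and m: "1 \<le> m"
    and up: "\<And>c. 0 < c \<Longrightarrow> m < ennreal c \<Longrightarrow> \<forall>\<^sub>F n in sequentially. real (first_time X n) \<le> c * real n"
    and low: "\<And>c. 0 < c \<Longrightarrow> ennreal c < m \<Longrightarrow> \<forall>\<^sub>F n in sequentially. c * real n \<le> real (first_time X n)"
    and nonneg: "\<forall>\<^sub>F n in sequentially. 0 \<le> fst (X n)"
begin

text \<open>If the path is on level \<open>j\<close> at time \<open>n\<close>, then level
  \<open>j\<close> was first reached by time \<open>n\<close>, so
  \<open>c * j \<le> n\<close>.\<close>

lemma position_le:
  assumes c: "0 < c" "ennreal c < m" and u: "1 < c * u"
  shows "\<forall>\<^sub>F n in sequentially. real_of_int (fst (X n)) \<le> u * real n"
proof -
  have u0: "0 < u" using c u by (metis less_trans mult.commute zero_less_mult_pos zero_less_one)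
  from low[OF c] obtain j0 where j0: "\<And>j. j \<ge> j0 \<Longrightarrow> c * real j \<le> real (first_time X j)"
    unfolding eventually_sequentially by blast
  \<comment> \<open>Takes care of the positions below \<open>j0\<close>, for which the bound on
    hitting times is not yet available.\<close>
  obtain n0 :: nat where n0: "real j0 / u \<le> real n0" using real_arch_simple by blast
  show ?thesis
    unfolding eventually_sequentially
  proof (intro exI[of _ n0] allI impI)
    fix n assume n: "n0 \<le> n"
    show "real_of_int (fst (X n)) \<le> u * real n"
    proof (cases "fst (X n) \<le> int j0")
      case True
      then have "real_of_int (fst (X n)) \<le> real j0" by (metis of_int_le_iff of_int_of_nat_eq)
      also have "\<dots> \<le> u * real n0" using n0 u0 by (simp add: field_simps)
      also have "\<dots> \<le> u * real n" using n u0 by simp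
      finally show ?thesis .
    next
      case False
      define j where "j = nat (fst (X n))"
      have j: "int j = fst (X n)" "j0 \<le> j" using False by (auto simp: j_def)
      have "first_time X j \<le> n" unfolding first_time_def using j by (intro Least_le) simp
      then have "c * real j \<le> real n" using j0[OF j(2)] by linarith
      also have "\<dots> \<le> (c * u) * real n" using u by (simp add: mult_le_cancel_right1)
      finally have "real j \<le> u * real n" using c by simp
      then show ?thesis using j by (metis of_int_of_nat_eq)
    qed
  qed
qed

text \<open>Level \<open>k\<close>, about \<open>n / c\<close>, has been reached by time
  \<open>n\<close>, and at least \<open>d * k\<close> time units had passed by then. In the at most
  \<open>n - d * k\<close> remaining steps the walk loses at most that many levels. For
  \<open>c\<close> and \<open>d\<close> near a finite \<open>m\<close> the resulting rate
  \<open>(1 + d) / c - 1\<close> tends to \<open>1 / m\<close>.\<close>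

lemma position_ge:
  assumes c: "m < ennreal c" and d: "0 < d" "ennreal d < m" and l: "l < (1 + d) / c - 1"
  shows "\<forall>\<^sub>F n in sequentially. l * real n \<le> real_of_int (fst (X n))"
proof -
  have c0: "0 < c" using c by (metis ennreal_neg leI not_less_zero)
  have "\<forall>\<^sub>F k in sequentially. real (first_time X k) \<le> c * real k \<and> d * real k \<le> real (first_time X k)"
    using up[OF c0 c] low[OF d] by eventually_elim auto
  then obtain k0 where k0: "\<And>k. k \<ge> k0 \<Longrightarrow> real (first_time X k) \<le> c * real k \<and> d * real k \<le> real (first_time X k)"
    unfolding eventually_sequentially by blast
  define e where "e = (1 + d) / c - 1 - l"
  have e: "0 < e" using l by (simp add: e_def)
  \<comment> \<open>The first bound puts \<open>k\<close> beyond \<open>k0\<close>; the second lets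
    the gap \<open>e\<close> absorb the loss \<open>1 + d\<close> from rounding
    \<open>n / c\<close>.\<close>
  obtain n0 :: nat where n0: "max (c * (real k0 + 1)) ((1 + d) / e) \<le> real n0" using real_arch_simple by blast
  show ?thesis
    unfolding eventually_sequentially
  proof (intro exI[of _ n0] allI impI)
    fix n assume n: "n0 \<le> n"
    define k where "k = nat \<lfloor>real n / c\<rfloor>"
    have kc: "real k \<le> real n / c" "real n / c < real k + 1"
      using c0 unfolding k_def by (auto simp: of_nat_nat)
    have "c * (real k0 + 1) \<le> real n" using n0 n by linarith
    then have "real k0 + 1 \<le> real n / c" using c0 by (simp add: field_simps)
    with kc have "k0 \<le> k" by linarith
    note k = k0[OF this]
    have "c * real k \<le> real n" using kc c0 by (simp add: field_simps)
    with k have le: "first_time X k \<le> n" by linarith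
    have "fst (X (first_time X k)) = int k" using first_at_first_time[OF hits[of "int k"]] by (simp add: first_at_def)
    with skip_free_ge[OF sf le] le have "int k - (int n - int (first_time X k)) \<le> fst (X n)" by (simp add: of_nat_diff)
    then have "real k - (real n - real (first_time X k)) \<le> real_of_int (fst (X n))" by linarith
    with k have 1: "(1 + d) * real k - real n \<le> real_of_int (fst (X n))" by (simp add: algebra_simps)
    have "(1 + d) * (real n / c - 1) \<le> (1 + d) * real k"
      using kc d by (intro mult_left_mono) auto
    then have 2: "((1 + d) / c - 1) * real n - (1 + d) \<le> (1 + d) * real k - real n"
      by (simp add: field_simps)
    have "(1 + d) / e \<le> real n" using n0 n by linarith
    then have "1 + d \<le> e * real n" using e by (simp add: field_simps)
    then show "l * real n \<le> real_of_int (fst (X n))"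
      using 1 2 by (simp add: e_def algebra_simps)
  qed
qed

lemma speed_of_position: "(\<lambda>n. real_of_int (fst (X n)) / real n) \<longlonglongrightarrow> enn2real (1 / m)"
proof (rule order_tendstoI)
  define v where "v = enn2real (1 / m)"
  have pos: "\<forall>\<^sub>F n in sequentially. 0 < n" by (rule eventually_gt_at_top)
  have v: "(m = \<top> \<and> v = 0) \<or> (\<exists>r\<ge>1. m = ennreal r \<and> v = 1 / r)"
  proof (cases m)
    case (real r)
    then have "1 \<le> r" using m by simp
    then show ?thesis using real by (intro disjI2 exI[of _ r]) (simp add: v_def divide_ennreal flip: ennreal_1)
  qed (simp add: v_def)
  {
    fix a assume a: "enn2real (1 / m) < a"
    \<comment> \<open>Any \<open>c\<close> strictly between \<open>1 / u\<close> and
      \<open>m\<close>, where \<open>u\<close> is the midpoint of \<open>v\<close> and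
      \<open>a\<close>; since \<open>u > v\<close>, there is one, also for infinite
      \<open>m\<close>.\<close>
    obtain c where c: "0 < c" "ennreal c < m" "1 < c * ((v + a) / 2)"
    proof (cases "m = \<top>")
      case True
      with v a have "0 < (v + a) / 2" by (auto simp: v_def)
      then show ?thesis using that[of "2 / ((v + a) / 2)"] True by (auto simp: field_simps)
    next
      case False
      with v obtain r where r: "1 \<le> r" "m = ennreal r" "v = 1 / r" by auto
      define u where "u = (v + a) / 2"
      have "v < u" using a by (simp add: u_def v_def)
      then have u: "1 / r < u" using r by simp
      then have u0: "0 < u" using r by (meson less_trans divide_pos_pos zero_less_one less_le_trans)
      have "1 / u < r" using u u0 r by (simp add: field_simps)
      then have "0 < (1 / u + r) / 2" "(1 / u + r) / 2 < r" "1 < (1 / u + r) / 2 * u"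
        using u0 r u by (auto simp: field_simps)
      then show ?thesis using that[of "(1 / u + r) / 2"] r by (auto simp: u_def ennreal_less_iff)
    qed
    from position_le[OF c] pos show "\<forall>\<^sub>F n in sequentially. real_of_int (fst (X n)) / real n < a"
    proof eventually_elim
      case (elim n)
      then have "real_of_int (fst (X n)) / real n \<le> (v + a) / 2" by (simp add: divide_le_eq)
      also have "\<dots> < a" using a by (simp add: v_def)
      finally show ?case .
    qed
  }
  fix a assume a: "a < enn2real (1 / m)"
  show "\<forall>\<^sub>F n in sequentially. a < real_of_int (fst (X n)) / real n"
  \<comment> \<open>Eventual nonnegativity settles negative \<open>a\<close>, in particular
    everything below the speed 0 when \<open>m\<close> is infinite. A nonnegative \<open>a\<close>
    below the speed forces \<open>m\<close> to be finite.\<close>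
  proof (cases "a < 0")
    case True
    from nonneg pos show ?thesis
    proof eventually_elim
      case (elim n)
      then have "0 \<le> real_of_int (fst (X n)) / real n" by simp
      with True show ?case by simp
    qed
  next
    case False
    with a v obtain r where r: "1 \<le> r" "m = ennreal r" "v = 1 / r" by (auto simp: v_def)
    define l where "l = (a + v) / 2"
    have "a < v" using a by (simp add: v_def)
    then have l: "0 \<le> l" "a < l" "l < v" using False by (auto simp: l_def)
    then have l: "0 \<le> l" "a < l" "l * r < 1" using r by (auto simp: field_simps)
    \<comment> \<open>The target inequality \<open>(l + 1) * (r + e) < 1 + (r - e)\<close> is
      equivalent to \<open>(2 + l) * e < 1 - l * r\<close>; this \<open>e\<close> uses half of the
      room.\<close>
    define e where "e = (1 - l * r) / (2 + l) / 2"
    have e: "0 < e" "e < 1" using l r by (auto simp: e_def field_simps intro: le_less_trans[of _ 1]) (smt (verit) mult_nonneg_nonneg)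
    have "D * ((1 - l * r) / D / 2) = (1 - l * r) / 2" if "D \<noteq> 0" for D using that by simp
    from this[of "2 + l"] have "(2 + l) * e = (1 - l * r) / 2" unfolding e_def using l(1) by linarith
    then have le: "(2 + l) * e < 1 - l * r" using l by simp
    have "l < (1 + (r - e)) / (r + e) - 1"
    proof -
      have "(l + 1) * (r + e) < 1 + (r - e)" using le by (simp add: algebra_simps)
      then have "l + 1 < (1 + (r - e)) / (r + e)" using r e by (simp add: pos_less_divide_eq)
      then show ?thesis by simp
    qed
    then have "\<forall>\<^sub>F n in sequentially. l * real n \<le> real_of_int (fst (X n))"
      using r e by (intro position_ge[of "r + e" "r - e"]) (auto simp: ennreal_less_iff)
    with pos show ?thesis
    proof eventually_elim
      case (elim n)
      then have "l \<le> real_of_int (fst (X n)) / real n" by (simp add: le_divide_eq)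
      with l show ?case by simp
    qed
  qed
qed

lemma speed_of_hitting_time:
  "(\<lambda>n. ereal (real n) / ereal_of_enat (hitting_time X (int n))) \<longlonglongrightarrow> ereal (enn2real (1 / m))"
proof -
  define R where "R n = real (first_time X n) / real n" for n
  have pos: "\<forall>\<^sub>F n in sequentially. 0 < n" by (rule eventually_gt_at_top)
  have R_low: "\<forall>\<^sub>F n in sequentially. c \<le> R n" if "0 < c" "ennreal c < m" for c
    using low[OF that] pos by eventually_elim (simp add: R_def le_divide_eq)
  have R_up: "\<forall>\<^sub>F n in sequentially. R n \<le> c" if "0 < c" "m < ennreal c" for c
    using up[OF that] pos by eventually_elim (simp add: R_def divide_le_eq)
  have "(\<lambda>n. inverse (R n)) \<longlonglongrightarrow> enn2real (1 / m)"
  proof (cases m)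
    case (real r)
    then have r: "1 \<le> r" using m by simp
    have "R \<longlonglongrightarrow> r"
    proof (rule order_tendstoI)
      fix a assume a: "a < r"
      define c where "c = (max a 0 + r) / 2"
      have "0 < c" "c < r" "a < c" using a r by (auto simp: c_def max_def)
      with R_low[of c] real show "\<forall>\<^sub>F n in sequentially. a < R n"
        by (auto simp: ennreal_less_iff elim: eventually_mono)
    next
      fix a assume a: "r < a"
      define c where "c = (a + r) / 2"
      have "0 < c" "r < c" "c < a" using a r by (auto simp: c_def)
      with R_up[of c] real show "\<forall>\<^sub>F n in sequentially. R n < a"
        by (auto simp: ennreal_less_iff elim: eventually_mono)
    qed
    then have "(\<lambda>n. inverse (R n)) \<longlonglongrightarrow> inverse r" using r by (intro tendsto_inverse) auto
    also have "inverse r = enn2real (1 / m)"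
      using r by (simp add: real divide_ennreal inverse_eq_divide flip: ennreal_1)
    finally show ?thesis .
  next
    case top
    have "filterlim R at_top sequentially"
      unfolding filterlim_at_top_gt[where c = 0] using R_low top by auto
    then have "(\<lambda>n. inverse (R n)) \<longlonglongrightarrow> 0" by (rule tendsto_inverse_0_at_top)
    then show ?thesis by (simp add: top)
  qed
  then have "(\<lambda>n. ereal (inverse (R n))) \<longlonglongrightarrow> ereal (enn2real (1 / m))" by simp
  moreover have "\<forall>\<^sub>F n in sequentially. ereal (inverse (R n)) = ereal (real n) / ereal_of_enat (hitting_time X (int n))"
    using pos
  proof eventually_elim
    case (elim n)
    have "fst (X (first_time X n)) = int n" using first_at_first_time[OF hits[of "int n"]] by (simp add: first_at_def)
    \<comment> \<open>For positive \<open>n\<close> the hitting time is nonzero, so real inverse and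
      extended quotient agree.\<close>
    with start elim have "first_time X n \<noteq> 0" by (cases "first_time X n = 0") auto
    then show ?case by (simp add: hitting_time_eq[OF hits] R_def)
  qed
  ultimately show ?thesis by (rule Lim_transform_eventually)
qed

end

section \<open>Stationary ergodic environments\<close>

lemma env_shift_env_shift: "env_shift m (env_shift n \<omega>) = env_shift (m + n) \<omega>"
  by (simp add: env_shift_def ac_simps)

lemma env_shift_0 [simp]: "env_shift 0 \<omega> = \<omega>"
  by (simp add: env_shift_def)

lemma env_shift_apply: "env_shift n \<omega> m = \<omega> (m + n)"
  by (simp add: env_shift_def)

lemma env_shift_funpow: "env_shift 1 ^^ k = env_shift (int k)" "env_shift (- 1) ^^ k = env_shift (- int k)"
proof -
  show "env_shift 1 ^^ k = env_shift (int k)"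
    by (induction k) (auto simp: comp_def env_shift_env_shift id_def)
  show "env_shift (- 1) ^^ k = env_shift (- int k)"
    by (induction k) (auto simp: comp_def env_shift_env_shift id_def)
qed

lemma env_shift_measurable: "env_shift n \<in> measurable (env_space S) (env_space S)"
  unfolding env_shift_def by (rule measurable_PiM_single') (auto simp: space_PiM)

lemma quenched_return: "quenched p q r \<omega> (return_pmf i) = chain (jump p q r \<omega>) (0, i)"
  by (simp add: quenched_def chain_def)

lemma hitting_time_iff_hits_in:
  "hitting_time X L < \<infinity> \<and> snd (X (the_enat (hitting_time X L))) = j \<longleftrightarrow> hits_in L j X"
proof (cases "hits L X")
  case True
  then obtain t where t: "first_at (level L) t X" by (auto simp: hits_iff_first_at)
  have "hitting_time X L = enat t" by (rule hitting_time_first_at[OF t])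
  moreover have "hits_in L j X \<longleftrightarrow> snd (X t) = j"
    using t first_at_unique[OF t] unfolding hits_in_def by metis
  ultimately show ?thesis by simp
next
  case False
  then have "{enat t |t. fst (X t) = L} = {}" by (auto simp: hits_def)
  then have "hitting_time X L = \<infinity>" by (simp add: hitting_time_def Inf_enat_def)
  with False show ?thesis by (simp add: hits_eq_ex_hits_in)
qed

definition translate :: "int \<Rightarrow> (nat \<Rightarrow> int \<times> 'd) \<Rightarrow> nat \<Rightarrow> int \<times> 'd" where
  "translate k X = (\<lambda>t. (fst (X t) - k, snd (X t)))"

lemma translate_measurable [measurable]: "translate k \<in> measurable path_space path_space"
  unfolding translate_def by (rule measurable_path_map)

lemma translate_apply [simp]: "fst (translate k X t) = fst (X t) - k" "snd (translate k X t) = snd (X t)"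
  by (auto simp: translate_def)

lemma hits_in_translate: "hits_in L j (translate k X) \<longleftrightarrow> hits_in (L + k) j X"
proof -
  have "first_at (level L) t (translate k X) \<longleftrightarrow> first_at (level (L + k)) t X" for t
    by (auto simp: first_at_def)
  then show ?thesis by (simp add: hits_in_def)
qed

lemma vec_component_measurable:
  fixes f :: "'a \<Rightarrow> real ^ 'n ^ 'm"
  assumes "f \<in> borel_measurable M"
  shows "(\<lambda>x. f x $ i $ j) \<in> borel_measurable M"
proof -
  have "(\<lambda>A :: real ^ 'n ^ 'm. A $ i $ j) \<in> borel_measurable borel"
    by (intro borel_measurable_continuous_onI continuous_intros)
  from measurable_compose[OF assms this] show ?thesis .
qed

lemma max_onorm_eq_Max:
  assumes "nonneg_matrix A"
  shows "max_onorm A = Max ((\<lambda>i. row_sum A i) ` UNIV)"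
proof (rule antisym)
  show "max_onorm A \<le> Max ((\<lambda>i. row_sum A i) ` UNIV)"
    by (rule max_onorm_le_row_sum[OF assms]) simp
  show "Max ((\<lambda>i. row_sum A i) ` UNIV) \<le> max_onorm A"
    by (auto simp: row_sum_le_max_onorm)
qed

section \<open>Quenched walks over a stationary ergodic environment\<close>

locale random_environment = prob_space P
  for P :: "'s env measure" +
  fixes S :: "'s measure" and p q r :: "'s \<Rightarrow> 'd::finite matr"
  assumes sets_P: "sets P = sets (env_space S)"
    and tm: "transition_matrices S p q r"
    and C: "condition_C S P p q r"
begin

lemma space_P: "space P = space (env_space S)"
  using sets_P by (rule sets_eq_imp_space_eq)

lemma measurable_P: "measurable P = measurable (env_space S)"
  by (intro ext measurable_cong_sets sets_P refl)

lemma env_shift_measurable_P [measurable]: "env_shift n \<in> measurable P P"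
  using env_shift_measurable[of n S] measurable_cong_sets[OF sets_P sets_P] by blast

lemma env_shift_space: "\<omega> \<in> space P \<Longrightarrow> env_shift n \<omega> \<in> space P"
  using measurable_space[OF env_shift_measurable_P] by blast

lemma distr_env_shift_1: "distr P P (env_shift 1) = P"
proof -
  have "distr P P (env_shift 1) = distr P (env_space S) (env_shift 1)"
    by (rule distr_cong) (auto simp: sets_P)
  then show ?thesis using C by (simp add: condition_C_def stationary_ergodic_def)
qed

lemma distr_env_shift_minus_1: "distr P P (env_shift (- 1)) = P"
proof -
  have "distr (distr P P (env_shift 1)) P (env_shift (- 1)) = distr P P (env_shift (- 1) \<circ> env_shift 1)"
    by (rule distr_distr) auto
  also have "env_shift (- 1) \<circ> env_shift 1 = (\<lambda>\<omega> :: 's env. \<omega>)"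
    by (simp add: fun_eq_iff env_shift_env_shift)
  finally show ?thesis by (simp add: distr_env_shift_1 distr_id)
qed

sublocale fwd: ergodic_system P "env_shift 1"
proof unfold_locales
  show "env_shift 1 \<in> measurable P P" by measurable
  show "distr P P (env_shift 1) = P" by (rule distr_env_shift_1)
  show "prob A = 0 \<or> prob A = 1" if "A \<in> events" "env_shift 1 -` A \<inter> space P = A" for A
    using C that by (auto simp: condition_C_def stationary_ergodic_def)
qed

text \<open>The inverse shift governs statements about the past of the environment, such as the
  products that converge to \<pi>. Its invariant sets are those of the shift itself.\<close>

sublocale bwd: ergodic_system P "env_shift (- 1)"
proof unfold_locales
  show "env_shift (- 1) \<in> measurable P P" by measurable
  show "distr P P (env_shift (- 1)) = P" by (rule distr_env_shift_minus_1)
  fix A assume A: "A \<in> events" "env_shift (- 1) -` A \<inter> space P = A"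
  have "env_shift 1 -` A \<inter> space P = A"
  proof (intro equalityI subsetI)
    fix \<omega> assume "\<omega> \<in> env_shift 1 -` A \<inter> space P"
    then have "env_shift 1 \<omega> \<in> env_shift (- 1) -` A \<inter> space P" using A by auto
    then show "\<omega> \<in> A" by (simp add: env_shift_env_shift)
  next
    fix \<omega> assume \<omega>: "\<omega> \<in> A"
    then have sp: "\<omega> \<in> space P" using sets.sets_into_space[OF A(1)] by auto
    then have "env_shift 1 \<omega> \<in> env_shift (- 1) -` A \<inter> space P"
      using \<omega> by (auto simp: env_shift_env_shift env_shift_space)
    then show "\<omega> \<in> env_shift 1 -` A \<inter> space P" using A(2) sp by auto
  qed
  with A show "prob A = 0 \<or> prob A = 1" by (intro fwd.ergodic)
qed

lemma AE_env_shift: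
  assumes "AE \<omega> in P. Q \<omega>"
  shows "AE \<omega> in P. \<forall>k. Q (env_shift k \<omega>)"
proof -
  have "AE \<omega> in P. Q (env_shift k \<omega>)" for k
  proof (cases "0 \<le> k")
    case True
    then show ?thesis using fwd.AE_funpow_T[OF assms, of "nat k"] by (simp add: env_shift_funpow)
  next
    case False
    then show ?thesis using bwd.AE_funpow_T[OF assms, of "nat (- k)"] by (simp add: env_shift_funpow)
  qed
  then show ?thesis by (simp add: AE_all_countable)
qed

lemma site_in_space: "\<omega> \<in> space P \<Longrightarrow> \<omega> n \<in> space S"
  by (auto simp: space_P space_PiM)

lemma transition_nonneg:
  assumes "s \<in> space S"
  shows "nonneg_matrix (p s)" "nonneg_matrix (q s)" "nonneg_matrix (r s)"
    "row_sum (p s) i + row_sum (q s) i + row_sum (r s) i = 1"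
  using tm assms
  by (auto simp: transition_matrices_def nonneg_matrix_def stochastic_def row_sum_def sum.distrib)

abbreviation "walk \<omega> \<equiv> jump p q r \<omega>"

lemma strip_walk:
  assumes "\<omega> \<in> space P"
  shows "strip_walk (\<lambda>n. p (\<omega> n)) (\<lambda>n. q (\<omega> n)) (\<lambda>n. r (\<omega> n)) (walk \<omega>)"
proof
  fix n i m j
  show "nonneg_matrix (p (\<omega> n))" "nonneg_matrix (q (\<omega> n))" "nonneg_matrix (r (\<omega> n))"
    "row_sum (p (\<omega> n)) i + row_sum (q (\<omega> n)) i + row_sum (r (\<omega> n)) i = 1"
    using transition_nonneg site_in_space[OF assms] by auto
  show "pmf (walk \<omega> (n, i)) (m, j) =
      (if m = n + 1 then p (\<omega> n) $ i $ j else if m = n then r (\<omega> n) $ i $ j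
       else if m = n - 1 then q (\<omega> n) $ i $ j else 0)"
    using assms by (subst pmf_jump[OF tm]) (auto simp: space_P)
qed

text \<open>Moving the origin is a bijection of the states that carries one kernel into the other. A
  shift of the environment can thus be traded for a shift of the starting level.\<close>

lemma distr_chain_translate:
  assumes "\<omega> \<in> space P"
  shows "distr (chain (walk \<omega>) (n + k, i)) path_space (translate k) = chain (walk (env_shift k \<omega>)) (n, i)"
proof -
  have pmf: "pmf (walk (env_shift k \<omega>) (fst x - k, snd x)) (fst y - k, snd y) = pmf (walk \<omega> x) y" for x y
  proof -
    have "env_shift k \<omega> \<in> space (env_space S)" "\<omega> \<in> space (env_space S)"
      using assms env_shift_space[OF assms] by (auto simp: space_P)
    then show ?thesis
      by (cases x; cases y) (auto simp: pmf_jump[OF tm] env_shift_apply)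
  qed
  have "bij (\<lambda>x :: int \<times> 'd. (fst x - k, snd x))"
    by (rule bij_betw_byWitness[where f' = "\<lambda>x. (fst x + k, snd x)"]) auto
  from distr_chain_map[where x = "(n + k, i)" and K = "walk \<omega>" and K' = "walk (env_shift k \<omega>)", OF this pmf]
  show ?thesis by (simp add: translate_def[abs_def])
qed

lemma emeasure_chain_translate:
  assumes "\<omega> \<in> space P" "A \<in> sets path_space"
  shows "emeasure (chain (walk (env_shift k \<omega>)) (n, i)) A = emeasure (chain (walk \<omega>) (n + k, i)) (translate k -` A)"
  unfolding distr_chain_translate[OF assms(1), symmetric] using assms(2) by (subst emeasure_distr) auto

abbreviation h :: "'s env \<Rightarrow> int \<Rightarrow> 'd matr" where
  "h \<omega> \<equiv> strip_walk.h (walk \<omega>)"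

lemma h_component: 
  assumes "\<omega> \<in> space P"
  shows "h \<omega> n $ i $ j = measure (chain (walk \<omega>) (n, i)) {X. hits_in (n + 1) j X}"
  using strip_walk[OF assms] by (simp add: strip_walk.h_def strip_walk.hit_def)

lemma h_env_shift:
  assumes "\<omega> \<in> space P"
  shows "h (env_shift k \<omega>) n = h \<omega> (n + k)"
proof -
  have "translate k -` {X. hits_in (n + 1) j X} = {X. hits_in (n + k + 1) j X}" for j :: 'd
    by (auto simp: hits_in_translate ac_simps)
  then have "h (env_shift k \<omega>) n $ i $ j = h \<omega> (n + k) $ i $ j" for i j
    using assms env_shift_space[OF assms] emeasure_chain_translate[OF assms, of "{X. hits_in (n + 1) j X}" k n i]
    by (simp add: h_component measure_def)
  then show ?thesis by (simp add: vec_eq_iff)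
qed

lemma eta_eq_h:
  assumes "\<omega> \<in> space P"
  shows "eta p q r n \<omega> = h \<omega> n"
proof -
  have "eta p q r n \<omega> = h (env_shift n \<omega>) 0"
    using env_shift_space[OF assms]
    by (simp only: vec_eq_iff eta_def quenched_return hitting_time_iff_hits_in h_component) simp
  then show ?thesis by (simp add: h_env_shift[OF assms])
qed

lemma quenched_return_measurable:
  "(\<lambda>\<omega>. chain (walk \<omega>) (0, i)) \<in> measurable P (prob_algebra path_space)"
  using quenched_measurable[OF tm, of "\<lambda>_. return_pmf i"] by (simp add: quenched_return measurable_P)

lemma emeasure_chain_measurable [measurable]:
  assumes "A \<in> sets path_space"
  shows "(\<lambda>\<omega>. emeasure (chain (walk \<omega>) (0, i)) A) \<in> borel_measurable P"
  by (rule measurable_emeasure_kernel[OF measurable_prob_algebraD[OF quenched_return_measurable] assms])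

lemma h_measurable [measurable]: "(\<lambda>\<omega>. h \<omega> n $ i $ j) \<in> borel_measurable P"
proof -
  have "(\<lambda>\<omega>. enn2real (emeasure (chain (walk \<omega>) (0, i)) {X. hits_in 1 j X})) \<in> borel_measurable P"
    by measurable
  from measurable_compose[OF env_shift_measurable_P[of n] this]
  have "(\<lambda>\<omega>. enn2real (emeasure (chain (walk (env_shift n \<omega>)) (0, i)) {X. hits_in 1 j X})) \<in> borel_measurable P" .
  moreover have "enn2real (emeasure (chain (walk (env_shift n \<omega>)) (0, i)) {X. hits_in 1 j X}) = h \<omega> n $ i $ j"
    if "\<omega> \<in> space P" for \<omega>
    using h_component[OF env_shift_space[OF that, of n], of 0 i j] h_env_shift[OF that, of n 0]
    by (simp add: measure_def)
  ultimately show ?thesis by (subst (asm) measurable_cong) auto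
qed

lemma site_component_measurable [measurable]:
  "(\<lambda>\<omega>. p (\<omega> n) $ i $ j) \<in> borel_measurable P"
  "(\<lambda>\<omega>. q (\<omega> n) $ i $ j) \<in> borel_measurable P"
  "(\<lambda>\<omega>. r (\<omega> n) $ i $ j) \<in> borel_measurable P"
proof -
  have *: "(\<lambda>\<omega>. f (\<omega> n) $ i $ j) \<in> borel_measurable P" if "f \<in> borel_measurable S" for f :: "'s \<Rightarrow> 'd matr"
    unfolding measurable_P
    by (rule measurable_compose[OF measurable_component_singleton[where i = n and M = "\<lambda>_. S"] vec_component_measurable[OF that]]) simp
  show "(\<lambda>\<omega>. p (\<omega> n) $ i $ j) \<in> borel_measurable P"
    "(\<lambda>\<omega>. q (\<omega> n) $ i $ j) \<in> borel_measurable P"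
    "(\<lambda>\<omega>. r (\<omega> n) $ i $ j) \<in> borel_measurable P"
    using tm by (auto intro!: * simp: transition_matrices_def)
qed

text \<open>Almost sure positivity of finitely many entries yields some threshold that all of them
  reach with positive probability; recurrence in both directions then provides infinitely many such
  sites. This is the source of strict contraction.\<close>

lemma AE_uniformly_positive:
  obtains e where "0 < e"
    "AE \<omega> in P. \<forall>N. \<exists>m\<ge>N. \<forall>i j. e \<le> h \<omega> (int m) $ i $ j"
    "AE \<omega> in P. \<forall>N. \<exists>m\<ge>N. \<forall>i j. e \<le> h \<omega> (- int m) $ i $ j"
proof -
  have "AE \<omega> in P. \<forall>i j. 0 < eta p q r 0 \<omega> $ i $ j"
    using C by (simp add: condition_C_def AE_all_countable)
  then have pos: "AE \<omega> in P. \<forall>i j. 0 < h \<omega> 0 $ i $ j"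
    using AE_space by eventually_elim (simp add: eta_eq_h)
  have "\<exists>k::nat. \<not> (AE \<omega> in P. \<not> (\<forall>i j. 1 / Suc k \<le> h \<omega> 0 $ i $ j))"
  proof (rule ccontr)
    assume "\<nexists>k::nat. \<not> (AE \<omega> in P. \<not> (\<forall>i j. 1 / Suc k \<le> h \<omega> 0 $ i $ j))"
    then have "AE \<omega> in P. \<forall>k::nat. \<not> (\<forall>i j. 1 / Suc k \<le> h \<omega> 0 $ i $ j)"
      unfolding AE_all_countable by blast
    with pos have "AE \<omega> in P. False"
    proof eventually_elim
      case (elim \<omega>)
      define d where "d = Min ((\<lambda>(i, j). h \<omega> 0 $ i $ j) ` UNIV)"
      have "0 < d" unfolding d_def using elim(1) by (subst Min_gr_iff) auto
      then obtain k where "1 / Suc k < d" using nat_approx_posE by blast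
      moreover have "d \<le> h \<omega> 0 $ i $ j" for i j unfolding d_def by (intro Min_le) auto
      ultimately show ?case using elim(2) by (meson less_imp_le order_trans)
    qed
    then show False by simp
  qed
  then obtain k :: nat where k: "\<not> (AE \<omega> in P. \<not> (\<forall>i j. 1 / Suc k \<le> h \<omega> 0 $ i $ j))" by blast
  have pred: "Measurable.pred P (\<lambda>\<omega>. \<forall>i j. 1 / Suc k \<le> h \<omega> 0 $ i $ j)"
    by measurable
  show ?thesis
  proof (rule that[of "1 / Suc k"])
    from fwd.AE_infinitely_often[OF pred k] AE_space
    show "AE \<omega> in P. \<forall>N. \<exists>m\<ge>N. \<forall>i j. 1 / Suc k \<le> h \<omega> (int m) $ i $ j"
      by eventually_elim (simp add: env_shift_funpow h_env_shift)
    from bwd.AE_infinitely_often[OF pred k] AE_space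
    show "AE \<omega> in P. \<forall>N. \<exists>m\<ge>N. \<forall>i j. 1 / Suc k \<le> h \<omega> (- int m) $ i $ j"
      by eventually_elim (simp add: env_shift_funpow h_env_shift)
  qed simp
qed

text \<open>The largest probability, over the positions of site \<open>n\<close>, of not stepping to
  the right; it plays the role of the bound \<open>k\<close> in
  \<open>strip_walk_exit\<close>.\<close>

definition exit_rate :: "'s env \<Rightarrow> int \<Rightarrow> real" where
  "exit_rate \<omega> n = max_onorm (r (\<omega> n) + q (\<omega> n))"

lemma log_gap_max_onorm_measurable:
  assumes f: "f = p \<or> f = q"
  shows "(\<lambda>\<omega>. max_onorm (r (\<omega> n) + f (\<omega> n))) \<in> borel_measurable P"
    and "(\<lambda>\<omega>. log_gap (max_onorm (r (\<omega> n) + f (\<omega> n)))) \<in> borel_measurable P"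
proof -
  have "(\<lambda>\<omega>. Max ((\<lambda>i. row_sum (r (\<omega> n) + f (\<omega> n)) i) ` UNIV)) \<in> borel_measurable P"
    unfolding row_sum_def using f by (intro borel_measurable_Max) auto
  moreover have "max_onorm (r (\<omega> n) + f (\<omega> n)) = Max ((\<lambda>i. row_sum (r (\<omega> n) + f (\<omega> n)) i) ` UNIV)"
    if "\<omega> \<in> space P" for \<omega>
    using transition_nonneg[OF site_in_space[OF that, of n]] f
    by (intro max_onorm_eq_Max nonneg_matrix_add) auto
  ultimately show *: "(\<lambda>\<omega>. max_onorm (r (\<omega> n) + f (\<omega> n))) \<in> borel_measurable P"
    by (subst measurable_cong) auto
  then show "(\<lambda>\<omega>. log_gap (max_onorm (r (\<omega> n) + f (\<omega> n)))) \<in> borel_measurable P"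
    unfolding log_gap_def by measurable
qed

lemma AE_rates_less_1:
  "AE \<omega> in P. \<forall>n. max_onorm (r (\<omega> n) + p (\<omega> n)) < 1 \<and> exit_rate \<omega> n < 1"
proof -
  have "AE \<omega> in P. max_onorm (r (\<omega> 0) + f (\<omega> 0)) < 1"
    if f: "f = p \<or> f = q" and fin: "(\<integral>\<^sup>+\<omega>. log_gap (max_onorm (r (\<omega> 0) + f (\<omega> 0))) \<partial>P) < \<infinity>" for f
  proof -
    have "AE \<omega> in P. log_gap (max_onorm (r (\<omega> 0) + f (\<omega> 0))) \<noteq> \<infinity>"
      using fin by (intro nn_integral_noteq_infinite log_gap_max_onorm_measurable f) auto
    then show ?thesis by eventually_elim (auto simp: log_gap_def split: if_splits)
  qed
  from this[of p] this[of q]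
  have "AE \<omega> in P. max_onorm (r (\<omega> 0) + p (\<omega> 0)) < 1 \<and> max_onorm (r (\<omega> 0) + q (\<omega> 0)) < 1"
    using C by (auto simp: condition_C_def)
  from AE_env_shift[OF this] show ?thesis
    by eventually_elim (auto simp: env_shift_apply exit_rate_def)
qed

lemma strip_walk_exit:
  assumes "\<omega> \<in> space P" "\<forall>n. exit_rate \<omega> n < 1"
  shows "strip_walk_exit (\<lambda>n. p (\<omega> n)) (\<lambda>n. q (\<omega> n)) (\<lambda>n. r (\<omega> n)) (walk \<omega>) (exit_rate \<omega>)"
proof (intro strip_walk_exit.intro strip_walk_exit_axioms.intro strip_walk assms(1))
  show "row_sum (q (\<omega> n)) i + row_sum (r (\<omega> n)) i \<le> exit_rate \<omega> n" for n i
    using row_sum_le_max_onorm[of "r (\<omega> n) + q (\<omega> n)" i] by (simp add: exit_rate_def row_sum_add)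
qed (use assms in blast)

end

section \<open>Decay of products of random matrices\<close>

lemma left_prod_add: "left_prod A (m + n) = left_prod (\<lambda>k. A (m + k)) n ** left_prod A m"
  by (induction n) (simp_all add: matrix_mul_assoc)

lemma right_prod_Suc_shift: "right_prod A (Suc n) = A 0 ** right_prod (\<lambda>l. A (Suc l)) n"
proof (induction n)
  case (Suc n)
  have "right_prod A (Suc (Suc n)) = right_prod A (Suc n) ** A (Suc n)" by simp
  also have "\<dots> = A 0 ** right_prod (\<lambda>l. A (Suc l)) (Suc n)"
    unfolding Suc.IH by (simp add: matrix_mul_assoc)
  finally show ?case .
qed simp

lemma abs_component_le_max_onorm: "\<bar>A $ i $ j\<bar> \<le> max_onorm (A :: 'n::finite matr)"
proof -
  have "\<bar>A $ i $ j\<bar> \<le> infnorm (A *v axis j 1)"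
    using component_le_infnorm_cart[of "A *v axis j 1" i] by (simp add: matrix_vector_mult_basis column_def)
  also have "\<dots> \<le> max_onorm A * infnorm (axis j 1 :: real ^ 'n)" by (rule infnorm_mult_le_max_onorm)
  also have "\<dots> \<le> max_onorm A * 1"
    by (intro mult_left_mono infnorm_cart_leI max_onorm_nonneg) (simp add: axis_def)
  finally show ?thesis by simp
qed

text \<open>Subadditivity of the logarithm of the norm: cutting the product into blocks of length \<open>N\<close>
  starting at each of the \<open>N\<close> possible offsets and averaging over the offsets bounds the logarithm of
  the norm by \<open>1/N\<close> times a Birkhoff sum of the block norms, up to boundary terms.\<close>

lemma max_onorm_left_prod_decay:
  fixes A :: "nat \<Rightarrow> 'n::finite matr" and u F :: "nat \<Rightarrow> real"
  assumes N: "0 < N" and d: "0 < d" and u0: "\<And>k. 0 \<le> u k" and cutoff: "0 \<le> cutoff"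
    and Au: "\<And>k. max_onorm (A k) \<le> exp (u k)"
    and AF: "\<And>k. max_onorm (left_prod (\<lambda>i. A (k + i)) N) \<le> exp (F k)"
    and F: "\<forall>\<^sub>F n in sequentially. (\<Sum>k<n. F k) \<le> - 4 * d * real n"
    and u: "\<forall>\<^sub>F n in sequentially. (\<Sum>k<n. max (u k - cutoff) 0) \<le> d / real N * real n"
  shows "\<exists>c. \<forall>\<^sub>F n in sequentially. max_onorm (left_prod A n) \<le> exp (c - d / real N * real n)"
proof -
  define Q where "Q k m = max_onorm (left_prod (\<lambda>i. A (k + i)) m)" for k m
  have Q0: "0 \<le> Q k m" for k m by (simp add: Q_def max_onorm_nonneg)
  have Qadd: "Q k (m + m') \<le> Q k m * Q (k + m) m'" for k m m'
  proof -
    have "Q k (m + m') \<le> Q (k + m) m' * Q k m"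
      unfolding Q_def left_prod_add by (rule order_trans[OF max_onorm_mult]) (simp add: add.assoc)
    then show ?thesis by (simp add: mult.commute)
  qed
  have Qu: "Q k m \<le> exp (\<Sum>i=k..<k + m. u i)" for k m
  proof (induction m)
    case 0
    then show ?case by (simp add: Q_def max_onorm_mat_1_le)
  next
    case (Suc m)
    have "Q k (Suc m) \<le> max_onorm (A (k + m)) * Q k m"
      unfolding Q_def left_prod.simps by (rule max_onorm_mult)
    also have "\<dots> \<le> exp (u (k + m)) * exp (\<Sum>i=k..<k + m. u i)"
      by (intro mult_mono Au Suc Q0) auto
    finally show ?case by (simp add: exp_add mult.commute)
  qed
  have QF: "Q i (M * N) \<le> exp (\<Sum>m<M. F (i + m * N))" for i M
  proof (induction M)
    case 0
    then show ?case by (simp add: Q_def max_onorm_mat_1_le)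
  next
    case (Suc M)
    have "Q i (Suc M * N) = Q i (M * N + N)" by (simp add: add.commute)
    also have "\<dots> \<le> Q i (M * N) * Q (i + M * N) N" by (rule Qadd)
    also have "\<dots> \<le> exp (\<Sum>m<M. F (i + m * N)) * exp (F (i + M * N))"
      using AF by (intro mult_mono Suc Q0) (auto simp: Q_def)
    finally show ?case by (simp add: exp_add)
  qed
  define c0 where "c0 = (\<Sum>k<N. u k)"
  define R where "R M n = (\<Sum>k=M * N..<n. u k)" for M n
  have average: "Q 0 n \<le> exp (c0 + (\<Sum>k<M * N. F k) / real N + R M n)" if n: "(M + 1) * N \<le> n" for M n
  proof -
    have "Q 0 n \<le> exp (c0 + (\<Sum>m<M. F (i + m * N)) + R M n)" if i: "i < N" for i
    proof -
      have le: "i + M * N \<le> n" using n i by simp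
      have "Q 0 n = Q 0 (i + (M * N + (n - (i + M * N))))" using le by simp
      also have "\<dots> \<le> Q 0 i * (Q i (M * N) * Q (i + M * N) (n - (i + M * N)))"
        by (rule order_trans[OF Qadd]) (intro mult_left_mono Q0 order_trans[OF Qadd], simp add: Q0)
      also have "\<dots> \<le> exp (\<Sum>k=0..<0 + i. u k) * (exp (\<Sum>m<M. F (i + m * N)) * exp (\<Sum>k=i + M * N..<i + M * N + (n - (i + M * N)). u k))"
        by (intro mult_mono Qu QF Q0 mult_nonneg_nonneg) auto
      also have "\<dots> = exp ((\<Sum>k<i. u k) + (\<Sum>m<M. F (i + m * N)) + (\<Sum>k=i + M * N..<n. u k))"
        using le by (simp add: exp_add lessThan_atLeast0)
      also have "\<dots> \<le> exp (c0 + (\<Sum>m<M. F (i + m * N)) + R M n)"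
        unfolding c0_def R_def using i u0
        by (subst exp_le_cancel_iff) (intro add_mono sum_mono2 order_refl, auto)
      finally show ?thesis .
    qed
    \<comment> \<open>Multiplying the bounds for the \<open>N\<close> offsets and taking the
      \<open>N\<close>-th root is the averaging. Together the blocks of all offsets start at every
      site below \<open>M * N\<close> once.\<close>
    then have "(\<Prod>i<N. Q 0 n) \<le> (\<Prod>i<N. exp (c0 + (\<Sum>m<M. F (i + m * N)) + R M n))"
      by (intro prod_mono) (auto simp: Q0)
    also have "\<dots> = exp (\<Sum>i<N. c0 + (\<Sum>m<M. F (i + m * N)) + R M n)" by (simp add: exp_sum)
    also have "(\<Sum>i<N. c0 + (\<Sum>m<M. F (i + m * N)) + R M n) = real N * c0 + (\<Sum>m<M. \<Sum>i<N. F (i + m * N)) + real N * R M n"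
      by (simp add: sum.distrib sum.swap[of _ "{..<M}"])
    also have "(\<Sum>m<M. \<Sum>i<N. F (i + m * N)) = (\<Sum>k<M * N. F k)"
    proof -
      have "(\<Sum>i<N. F (i + m * N)) = sum F {m * N..<m * N + N}" for m
        using sum.shift_bounds_nat_ivl[of F 0 "m * N" N] by (simp add: lessThan_atLeast0 add.commute)
      then show ?thesis using sum.nat_group[of F N M] by simp
    qed
    also have "real N * c0 + (\<Sum>k<M * N. F k) + real N * R M n
        = real N * (c0 + (\<Sum>k<M * N. F k) / real N + R M n)"
      using N by (simp add: field_simps)
    also have "exp \<dots> = exp (c0 + (\<Sum>k<M * N. F k) / real N + R M n) ^ N"
      by (rule exp_of_nat_mult)
    finally have "Q 0 n ^ N \<le> exp (c0 + (\<Sum>k<M * N. F k) / real N + R M n) ^ N" by simp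
    then show ?thesis using N Q0 by (subst (asm) power_mono_iff) auto
  qed
  obtain n1 where n1: "\<And>n. n \<ge> n1 \<Longrightarrow> (\<Sum>k<n. F k) \<le> - 4 * d * real n"
    using F unfolding eventually_sequentially by blast
  obtain n2 where n2: "\<And>n. n \<ge> n2 \<Longrightarrow> (\<Sum>k<n. max (u k - cutoff) 0) \<le> d / real N * real n"
    using u unfolding eventually_sequentially by blast
  \<comment> \<open>\<open>c0\<close> bounds the initial piece, \<open>8 * d\<close> pays for
    replacing \<open>M * N\<close> by \<open>n - 2 * N\<close> in the Birkhoff bound, and the last
    term bounds the capped part of the final piece, which has at most \<open>2 * N\<close>
    factors.\<close>
  define c where "c = c0 + 8 * d + 2 * real N * cutoff"
  have "max_onorm (left_prod A n) \<le> exp (c - d / real N * real n)" if n: "max (n1 + 2 * N) n2 \<le> n" for n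
  proof -
    \<comment> \<open>One block fewer than fits into \<open>n\<close>, so that all \<open>M\<close>
      blocks still fit when they begin at an offset below \<open>N\<close>.\<close>
    define M where "M = n div N - 1"
    have "1 \<le> n div N" using n N by (simp add: Suc_le_eq div_greater_zero_iff)
    then have MN: "(M + 1) * N = n - n mod N" by (simp add: M_def minus_mod_eq_div_mult)
    have modN: "n mod N < N" using N by simp
    have le: "(M + 1) * N \<le> n" using MN by simp
    have "n mod N \<le> n" by simp
    then have gt: "n < M * N + 2 * N" using MN modN by auto
    then have Mn1: "n1 \<le> M * N" using n by auto
    have "R M n \<le> (\<Sum>k=M * N..<n. cutoff + max (u k - cutoff) 0)"
      unfolding R_def by (intro sum_mono) auto
    also have "\<dots> = real (n - M * N) * cutoff + (\<Sum>k=M * N..<n. max (u k - cutoff) 0)"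
      by (simp add: sum.distrib)
    also have "\<dots> \<le> real (2 * N) * cutoff + (\<Sum>k<n. max (u k - cutoff) 0)"
      using gt cutoff by (intro add_mono mult_right_mono sum_mono2) auto
    also have "\<dots> \<le> 2 * real N * cutoff + d / real N * real n"
      using n2[of n] n by simp
    finally have R: "R M n \<le> 2 * real N * cutoff + d / real N * real n" .
    have "(\<Sum>k<M * N. F k) / real N \<le> - 4 * d * real (M * N) / real N"
      using n1[OF Mn1] N by (intro divide_right_mono) auto
    also have "\<dots> \<le> - 4 * d * (real n - 2 * real N) / real N"
    proof (intro divide_right_mono mult_left_mono_neg)
      have "real n \<le> real (M * N + 2 * N)" using gt by (intro of_nat_mono) simp
      then show "real n - 2 * real N \<le> real (M * N)" by simp
    qed (use d N in auto)
    also have "\<dots> = 8 * d - 4 * (d / real N * real n)" using N by (simp add: field_simps)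
    finally have "c0 + (\<Sum>k<M * N. F k) / real N + R M n \<le> c - 3 * (d / real N * real n)"
      using R by (simp add: c_def)
    also have "\<dots> \<le> c - d / real N * real n"
    proof -
      have "0 \<le> d / real N * real n" using d by simp
      then show ?thesis by linarith
    qed
    finally have "exp (c0 + (\<Sum>k<M * N. F k) / real N + R M n) \<le> exp (c - d / real N * real n)" by simp
    with average[OF le] have "Q 0 n \<le> exp (c - d / real N * real n)" by (meson order_trans)
    then show ?thesis by (simp add: Q_def)
  qed
  then show ?thesis unfolding eventually_sequentially by blast
qed

section \<open>Exponential decay of the products of \<open>a_mat\<close> under Condition D\<close>

locale strip_rwre = random_environment P S p q r
  for P :: "'s env measure" and S :: "'s measure" and p q r :: "'s \<Rightarrow> 'd::finite matr" +
  fixes \<zeta> :: "int \<Rightarrow> 's env \<Rightarrow> 'd matr"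
  assumes sol: "stationary_solution P p q r \<zeta>" and D: "condition_D P q r \<zeta>"
begin

abbreviation "A n \<omega> \<equiv> a_mat q r \<zeta> n \<omega>"

text \<open>Collects the almost sure properties at all sites and for all shifts, so that the matrix
  arguments can be made for one environment at a time.\<close>

definition solves :: "'s env \<Rightarrow> bool" where
  "solves \<omega> \<longleftrightarrow> \<omega> \<in> space P \<and> (\<forall>n. stochastic (\<zeta> n \<omega>)) \<and> (\<forall>n k. \<zeta> n (env_shift k \<omega>) = \<zeta> (n + k) \<omega>)
     \<and> (\<forall>n. \<zeta> n \<omega> = gamma q r \<zeta> n \<omega> ** p (\<omega> n))
     \<and> (\<forall>n. max_onorm (r (\<omega> n) + p (\<omega> n)) < 1 \<and> exit_rate \<omega> n < 1)"

lemma AE_solves: "AE \<omega> in P. solves \<omega>"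
proof -
  have "AE \<omega> in P. \<forall>n. \<zeta> n (env_shift 1 \<omega>) = \<zeta> (n + 1) \<omega>"
    using sol by (simp add: stationary_solution_def AE_all_countable)
  from AE_env_shift[OF this]
  have "AE \<omega> in P. \<forall>n k. \<zeta> n (env_shift k \<omega>) = \<zeta> (n + k) \<omega>"
  proof eventually_elim
    case (elim \<omega>)
    then have step: "\<zeta> n (env_shift (1 + k) \<omega>) = \<zeta> (n + 1) (env_shift k \<omega>)" for n k
      by (simp add: env_shift_env_shift)
    show ?case
    proof (intro allI)
      fix n k
      show "\<zeta> n (env_shift k \<omega>) = \<zeta> (n + k) \<omega>"
      proof (induction k arbitrary: n rule: int_induct[where k = 0])
        case (step1 k)
        then show ?case using step[of n k] by (simp add: ac_simps)
      next
        case (step2 k)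
        then show ?case using step[of "n - 1" "k - 1"] by (simp add: algebra_simps)
      qed simp
    qed
  qed
  moreover have "AE \<omega> in P. \<forall>n. stochastic (\<zeta> n \<omega>)" "AE \<omega> in P. \<forall>n. \<zeta> n \<omega> = gamma q r \<zeta> n \<omega> ** p (\<omega> n)"
    using sol by (auto simp: stationary_solution_def AE_all_countable)
  ultimately show ?thesis
    using AE_rates_less_1 AE_space unfolding solves_def by eventually_elim auto
qed

lemma A_env_shift:
  assumes "solves \<omega>"
  shows "A n (env_shift k \<omega>) = A (n + k) \<omega>"
proof -
  have "\<zeta> (n - 1) (env_shift k \<omega>) = \<zeta> (n + k - 1) \<omega>"
    using assms by (simp add: solves_def algebra_simps)
  then show ?thesis by (simp add: a_mat_def gamma_def env_shift_apply)
qed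

lemma loop_zeta:
  assumes "solves \<omega>"
  shows "strictly_substochastic (q (\<omega> n) ** \<zeta> (n - 1) \<omega> + r (\<omega> n)) (exit_rate \<omega> n)"
    and "gamma q r \<zeta> n \<omega> = matrix_inv (mat 1 - (q (\<omega> n) ** \<zeta> (n - 1) \<omega> + r (\<omega> n)))"
proof -
  have "\<omega> n \<in> space S" "stochastic (\<zeta> (n - 1) \<omega>)" "exit_rate \<omega> n < 1"
    using assms site_in_space by (auto simp: solves_def)
  note \<omega> = this
  show "strictly_substochastic (q (\<omega> n) ** \<zeta> (n - 1) \<omega> + r (\<omega> n)) (exit_rate \<omega> n)"
  proof
    show "nonneg_matrix (q (\<omega> n) ** \<zeta> (n - 1) \<omega> + r (\<omega> n))"
      using \<omega> transition_nonneg[OF \<omega>(1)] by (intro nonneg_matrix_add nonneg_matrix_mult) (auto simp: stochastic_iff)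
    show "row_sum (q (\<omega> n) ** \<zeta> (n - 1) \<omega> + r (\<omega> n)) i \<le> exit_rate \<omega> n" for i
      using row_sum_le_max_onorm[of "r (\<omega> n) + q (\<omega> n)" i]
      by (simp add: exit_rate_def row_sum_add row_sum_mult_stochastic[OF \<omega>(2)])
  qed (rule \<omega>)
  show "gamma q r \<zeta> n \<omega> = matrix_inv (mat 1 - (q (\<omega> n) ** \<zeta> (n - 1) \<omega> + r (\<omega> n)))"
    by (simp add: gamma_def diff_diff_eq)
qed

definition log_exit_bound :: "'s env \<Rightarrow> real" where
  "log_exit_bound \<omega> = max 0 (ln (1 / (1 - exit_rate \<omega> 0)))"

lemma integrable_log_exit_bound: "integrable P log_exit_bound"
proof -
  have [measurable]: "(\<lambda>\<omega>. exit_rate \<omega> 0) \<in> borel_measurable P"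
    using log_gap_max_onorm_measurable(1)[of q 0] by (simp add: exit_rate_def)
  have [measurable]: "log_exit_bound \<in> borel_measurable P" unfolding log_exit_bound_def by measurable
  have "(\<integral>\<^sup>+\<omega>. ennreal (log_exit_bound \<omega>) \<partial>P) = (\<integral>\<^sup>+\<omega>. log_gap (exit_rate \<omega> 0) \<partial>P)"
    by (rule nn_integral_cong_AE, rule AE_mp[OF AE_rates_less_1])
      (auto intro!: AE_I2 simp: log_exit_bound_def log_gap_def max_def ennreal_neg)
  also have "\<dots> < \<infinity>" using C by (simp add: condition_C_def exit_rate_def)
  finally show ?thesis by (intro integrableI_bounded) (auto simp: log_exit_bound_def)
qed

text \<open>The upper bound is the row sum bound for the inverse, times a substochastic matrix.
  Positivity of the row sums holds because stepping to the left has positive probability from each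
  position and the inverse dominates the identity on nonnegative vectors.\<close>

lemma A_bounds:
  assumes "solves \<omega>"
  shows "nonneg_matrix (A n \<omega>)" and "max_onorm (A n \<omega>) \<le> exp (log_exit_bound (env_shift n \<omega>))" and "0 < row_sum (A n \<omega>) i"
proof -
  interpret loop: strictly_substochastic "q (\<omega> n) ** \<zeta> (n - 1) \<omega> + r (\<omega> n)" "exit_rate \<omega> n"
    by (rule loop_zeta[OF assms])
  have s: "\<omega> n \<in> space S" using assms site_in_space by (auto simp: solves_def)
  note tr = transition_nonneg[OF s]
  show nn: "nonneg_matrix (A n \<omega>)"
    unfolding a_mat_def loop_zeta(2)[OF assms] by (intro nonneg_matrix_mult loop.nonneg_inverse tr)
  have "row_sum (q (\<omega> n)) i \<le> 1" for i
    using tr(4)[of i] row_sum_nonneg[OF tr(1), of i] row_sum_nonneg[OF tr(3), of i] by simp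
  then have G: "row_sum (A n \<omega>) i \<le> row_sum loop.G i * 1" for i
    unfolding a_mat_def loop_zeta(2)[OF assms] by (intro row_sum_mult_le loop.nonneg_inverse)
  have "row_sum (A n \<omega>) i \<le> 1 / (1 - exit_rate \<omega> n)" for i
    using G[of i] loop.row_sum_inverse_le[of i] by simp
  then have "max_onorm (A n \<omega>) \<le> 1 / (1 - exit_rate \<omega> n)"
    by (rule max_onorm_le_row_sum[OF nn])
  also have "\<dots> = exp (ln (1 / (1 - exit_rate \<omega> n)))" using loop.less_1 by simp
  also have "\<dots> \<le> exp (log_exit_bound (env_shift n \<omega>))"
    by (simp add: log_exit_bound_def exit_rate_def env_shift_apply)
  finally show "max_onorm (A n \<omega>) \<le> exp (log_exit_bound (env_shift n \<omega>))" .
  have "row_sum (r (\<omega> n) + p (\<omega> n)) i < 1"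
    using row_sum_le_max_onorm[of "r (\<omega> n) + p (\<omega> n)" i] assms by (auto simp: solves_def intro: le_less_trans)
  then have "0 < row_sum (q (\<omega> n)) i" using tr(4)[of i] by (simp add: row_sum_add)
  also have "\<dots> \<le> row_sum (A n \<omega>) i"
    using loop.inverse_vec_ge[of "q (\<omega> n) *v (\<chi> i. 1)" i] row_sum_nonneg[OF tr(2)]
    by (simp add: row_sum_eq_mult_one a_mat_def loop_zeta(2)[OF assms] flip: matrix_vector_mul_assoc)
  finally show "0 < row_sum (A n \<omega>) i" .
qed

text \<open>Keeps the norms of the products positive, so that the exponential of their logarithm
  gives the norm back.\<close>

lemma row_sum_left_prod_pos:
  assumes "solves \<omega>"
  shows "0 < row_sum (left_prod (\<lambda>k. A (f k) \<omega>) m) i"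
proof (induction m arbitrary: i)
  case 0
  show ?case by (simp add: stochastic_mat_1[unfolded stochastic_iff])
next
  case (Suc m)
  define x where "x = left_prod (\<lambda>k. A (f k) \<omega>) m *v (\<chi> i. 1)"
  have x: "0 < x $ i" for i using Suc[of i] by (simp add: x_def row_sum_eq_mult_one)
  define e where "e = Min (range (\<lambda>i. x $ i))"
  have e: "0 < e" "e \<le> x $ i" for i using x by (auto simp: e_def)
  have "0 < row_sum (A (f m) \<omega>) i * e" using A_bounds(3)[OF assms] e by simp
  also have "\<dots> = (A (f m) \<omega> *v (\<chi> i. e)) $ i" by (simp add: mult_vec_const)
  also have "\<dots> \<le> (A (f m) \<omega> *v x) $ i"
    by (rule mult_vec_mono[OF A_bounds(1)[OF assms]]) (simp add: e)
  also have "\<dots> = row_sum (left_prod (\<lambda>k. A (f k) \<omega>) (Suc m)) i"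
    by (simp add: row_sum_eq_mult_one x_def matrix_vector_mul_assoc)
  finally show ?case .
qed

text \<open>One block length \<open>N\<close> with negative mean logarithm suffices. The upper
  Birkhoff bounds, for the block logarithms and for the large values of single factors, are the
  hypotheses of \<open>max_onorm_left_prod_decay\<close>.\<close>

lemma AE_products_decay:
  obtains c where "0 < c"
    "AE \<omega> in P. \<exists>C. \<forall>\<^sub>F n in sequentially. max_onorm (left_prod (\<lambda>k. A (int k + 1) \<omega>) n) \<le> exp (C - c * real n)"
proof -
  define G where "G n \<omega> = ln (max_onorm (left_prod (\<lambda>k. A (int k + 1) \<omega>) n))" for n \<omega>
  obtain l where l: "l < 0" "(\<lambda>n. (1 / real n) * (\<integral>\<omega>. G n \<omega> \<partial>P)) \<longlonglongrightarrow> l"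
    using D unfolding condition_D_def G_def by blast
  from order_tendstoD(2)[OF l(2,1)] have "\<forall>\<^sub>F n in sequentially. (1 / real n) * (\<integral>\<omega>. G n \<omega> \<partial>P) < 0" .
  then obtain N where N: "1 / real N * (\<integral>\<omega>. G N \<omega> \<partial>P) < 0"
    by (auto simp: eventually_sequentially)
  then have N0: "0 < N" by (cases N) auto
  with N have neg: "(\<integral>\<omega>. G N \<omega> \<partial>P) < 0" by (simp add: divide_less_0_iff)
  \<comment> \<open>The Bochner integral of a non-integrable function is 0 by convention, so a
    negative integral certifies integrability.\<close>
  then have int: "integrable P (G N)" using not_integrable_integral_eq[of P "G N"] by fastforce
  \<comment> \<open>The mean is \<open>- 8 * d\<close>, strictly below the \<open>- 4 * d\<close>
    required of the Birkhoff sums.\<close>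
  define d where "d = - (\<integral>\<omega>. G N \<omega> \<partial>P) / 8"
  have d: "0 < d" "(\<integral>\<omega>. G N \<omega> \<partial>P) < - 4 * d" using neg by (auto simp: d_def)
  have dN: "0 < d / real N" using d N0 by simp
  \<comment> \<open>Provides a cutoff above which the single-factor bounds have mean less than
    \<open>d / N\<close>: the unfinished block at the end of a product may contain exceptionally
    large factors.\<close>
  have "(\<lambda>m. \<integral>\<omega>. max (log_exit_bound \<omega> - real m) 0 \<partial>P) \<longlonglongrightarrow> (\<integral>\<omega>. 0 \<partial>P)"
  proof (rule integral_dominated_convergence[where w = log_exit_bound])
    show "AE \<omega> in P. (\<lambda>m. max (log_exit_bound \<omega> - real m) 0) \<longlonglongrightarrow> 0"
    proof (rule AE_I2, rule tendsto_eventually)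
      fix \<omega>
      obtain m :: nat where "log_exit_bound \<omega> \<le> real m" using real_arch_simple by blast
      then show "\<forall>\<^sub>F m in sequentially. max (log_exit_bound \<omega> - real m) 0 = 0"
        unfolding eventually_sequentially by (intro exI[of _ m]) auto
    qed
    show "AE \<omega> in P. norm (max (log_exit_bound \<omega> - real m) 0) \<le> log_exit_bound \<omega>" for m by (auto simp: log_exit_bound_def)
  qed (use integrable_log_exit_bound in auto)
  then have "\<forall>\<^sub>F m in sequentially. (\<integral>\<omega>. max (log_exit_bound \<omega> - real m) 0 \<partial>P) < d / real N"
    using dN by (intro order_tendstoD(2)) auto
  then obtain m :: nat where m: "(\<integral>\<omega>. max (log_exit_bound \<omega> - real m) 0 \<partial>P) < d / real N"
    by (auto simp: eventually_sequentially)
  have int': "integrable P (\<lambda>\<omega>. max (log_exit_bound \<omega> - real m) 0)" using integrable_log_exit_bound by auto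
  \<comment> \<open>Shifted by one because the products begin at site 1.\<close>
  define w where "w \<omega> = max (log_exit_bound (env_shift 1 \<omega>) - real m) 0" for \<omega>
  have intw: "integrable P w" "(\<integral>\<omega>. w \<omega> \<partial>P) < d / real N"
  proof -
    have mu: "(\<lambda>\<omega>. max (log_exit_bound \<omega> - real m) 0) \<in> borel_measurable P" using int' by auto
    show "integrable P w" unfolding w_def
      using int' mu by (subst (asm) (1) distr_env_shift_1[symmetric]) (simp add: integrable_distr_eq)
    have "(\<integral>\<omega>. w \<omega> \<partial>P) = (\<integral>\<omega>. max (log_exit_bound \<omega> - real m) 0 \<partial>P)"
      unfolding w_def using mu by (subst (2) distr_env_shift_1[symmetric]) (simp add: integral_distr)
    with m show "(\<integral>\<omega>. w \<omega> \<partial>P) < d / real N" by simp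
  qed
  from fwd.AE_birkhoff_sum_le[OF int d(2)] fwd.AE_birkhoff_sum_le[OF intw] AE_solves
  have "AE \<omega> in P. \<exists>C. \<forall>\<^sub>F n in sequentially. max_onorm (left_prod (\<lambda>k. A (int k + 1) \<omega>) n) \<le> exp (C - d / real N * real n)"
  proof eventually_elim
    case (elim \<omega>)
    note solves = \<open>solves \<omega>\<close>
    show ?case
    proof (rule max_onorm_left_prod_decay[where u = "\<lambda>k. log_exit_bound (env_shift (int k + 1) \<omega>)" and F = "\<lambda>k. G N (env_shift (int k) \<omega>)" and cutoff = "real m"])
      show "max_onorm (A (int k + 1) \<omega>) \<le> exp (log_exit_bound (env_shift (int k + 1) \<omega>))" for k
        by (rule A_bounds(2)[OF solves])
      show "max_onorm (left_prod (\<lambda>i. A (int (k + i) + 1) \<omega>) N) \<le> exp (G N (env_shift (int k) \<omega>))" for k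
      proof -
        have eq: "left_prod (\<lambda>i. A (int i + 1) (env_shift (int k) \<omega>)) N = left_prod (\<lambda>i. A (int (k + i) + 1) \<omega>) N"
          by (simp add: A_env_shift[OF solves] ac_simps)
        have "0 < row_sum (left_prod (\<lambda>i. A (int (k + i) + 1) \<omega>) N) undefined"
          by (rule row_sum_left_prod_pos[OF solves])
        also have "\<dots> \<le> max_onorm (left_prod (\<lambda>i. A (int (k + i) + 1) \<omega>) N)" by (rule row_sum_le_max_onorm)
        finally show ?thesis by (simp add: G_def eq)
      qed
      show "\<forall>\<^sub>F n in sequentially. (\<Sum>k<n. G N (env_shift (int k) \<omega>)) \<le> - 4 * d * real n"
        using elim(1) by (simp add: env_shift_funpow)
      show "\<forall>\<^sub>F n in sequentially. (\<Sum>k<n. max (log_exit_bound (env_shift (int k + 1) \<omega>) - real m) 0) \<le> d / real N * real n"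
        using elim(2) by (simp add: env_shift_funpow w_def env_shift_env_shift add.commute)
    qed (use N0 d in \<open>auto simp: log_exit_bound_def\<close>)
  qed
  with dN show ?thesis by (rule that)
qed

end

section \<open>Hitting matrices solve the stationary equation\<close>

lemma exp_linear_eq_power: "exp (C - c * real n) = exp C * exp (- c) ^ n"
proof -
  have "exp (C - c * real n) = exp (C + real n * (- c))" by (simp add: mult.commute)
  then show ?thesis by (simp only: exp_add exp_of_nat_mult)
qed

lemma exp_linear_summable: "0 < c \<Longrightarrow> summable (\<lambda>n. exp (C - c * real n))"
  unfolding exp_linear_eq_power by (intro summable_mult summable_geometric) simp

context strip_rwre
begin

text \<open>Subtracting the two fixed point equations, the difference solves an equation with the
  loop matrix of \<zeta>, whose inverse is \<open>gamma\<close>, and with right-hand side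
  \<open>q\<close> times the previous difference times \<open>h\<close>.\<close>

lemma zeta_minus_h_step:
  assumes "solves \<omega>"
  shows "\<zeta> n \<omega> - h \<omega> n = A n \<omega> ** ((\<zeta> (n - 1) \<omega> - h \<omega> (n - 1)) ** h \<omega> n)"
proof -
  have sp: "\<omega> \<in> space P" using assms by (simp add: solves_def)
  interpret loop: strictly_substochastic "q (\<omega> n) ** \<zeta> (n - 1) \<omega> + r (\<omega> n)" "exit_rate \<omega> n"
    by (rule loop_zeta[OF assms])
  define Kz where "Kz = q (\<omega> n) ** \<zeta> (n - 1) \<omega> + r (\<omega> n)"
  define Kh where "Kh = q (\<omega> n) ** h \<omega> (n - 1) + r (\<omega> n)"
  have "\<zeta> n \<omega> = matrix_inv (mat 1 - Kz) ** p (\<omega> n)"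
    using assms unfolding Kz_def loop_zeta(2)[OF assms, symmetric] by (simp add: solves_def)
  then have "(mat 1 - Kz) ** \<zeta> n \<omega> = p (\<omega> n)"
    using loop.inverse_right by (simp add: Kz_def matrix_mul_assoc)
  then have z: "\<zeta> n \<omega> = Kz ** \<zeta> n \<omega> + p (\<omega> n)"
    by (simp add: matrix_diff_rdistrib algebra_simps)
  have h: "h \<omega> n = Kh ** h \<omega> n + p (\<omega> n)"
    unfolding Kh_def by (rule strip_walk.h_first_step[OF strip_walk[OF sp]])
  have "Kz - Kh = q (\<omega> n) ** (\<zeta> (n - 1) \<omega> - h \<omega> (n - 1))"
    by (simp add: Kz_def Kh_def matrix_diff_ldistrib)
  moreover have "\<zeta> n \<omega> - h \<omega> n = Kz ** (\<zeta> n \<omega> - h \<omega> n) + (Kz - Kh) ** h \<omega> n"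
    by (subst z, subst h) (simp add: matrix_diff_ldistrib matrix_diff_rdistrib)
  ultimately have "\<zeta> n \<omega> - h \<omega> n = Kz ** (\<zeta> n \<omega> - h \<omega> n) + q (\<omega> n) ** (\<zeta> (n - 1) \<omega> - h \<omega> (n - 1)) ** h \<omega> n"
    by simp
  then have "\<zeta> n \<omega> - h \<omega> n = matrix_inv (mat 1 - Kz) ** (q (\<omega> n) ** (\<zeta> (n - 1) \<omega> - h \<omega> (n - 1)) ** h \<omega> n)"
    unfolding Kz_def by (rule loop.solution_unique)
  then show ?thesis
    by (simp add: a_mat_def loop_zeta(2)[OF assms] Kz_def matrix_mul_assoc)
qed

text \<open>Iterating the step puts the \<open>a_mat\<close> factors on the left and the factors
  \<open>h\<close> on the right; the latter are substochastic and do not increase the norm.\<close>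

lemma zeta_minus_h_norm:
  assumes "solves \<omega>"
  shows "max_onorm (\<zeta> (int n) \<omega> - h \<omega> (int n))
    \<le> max_onorm (left_prod (\<lambda>k. A (int k + 1) \<omega>) n) * max_onorm (\<zeta> 0 \<omega> - h \<omega> 0)"
proof -
  have sp: "\<omega> \<in> space P" using assms by (simp add: solves_def)
  note W = strip_walk[OF sp]
  have "\<exists>H. max_onorm H \<le> 1 \<and>
    \<zeta> (int n) \<omega> - h \<omega> (int n) = left_prod (\<lambda>k. A (int k + 1) \<omega>) n ** ((\<zeta> 0 \<omega> - h \<omega> 0) ** H)"
  proof (induction n)
    case 0
    show ?case by (intro exI[of _ "mat 1"]) (simp add: max_onorm_mat_1_le)
  next
    case (Suc n)
    then obtain H where H: "max_onorm H \<le> 1"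
      "\<zeta> (int n) \<omega> - h \<omega> (int n) = left_prod (\<lambda>k. A (int k + 1) \<omega>) n ** ((\<zeta> 0 \<omega> - h \<omega> 0) ** H)" by blast
    have "max_onorm (h \<omega> (int n + 1)) \<le> 1"
      by (intro max_onorm_le_row_sum strip_walk.nonneg_h[OF W] strip_walk.row_sum_h_le_1[OF W])
    then have "max_onorm (H ** h \<omega> (int n + 1)) \<le> 1"
      using H(1) max_onorm_nonneg[of H] max_onorm_nonneg[of "h \<omega> (int n + 1)"]
      by (intro order_trans[OF max_onorm_mult] mult_le_one) auto
    moreover have "\<zeta> (int (Suc n)) \<omega> - h \<omega> (int (Suc n))
      = A (int n + 1) \<omega> ** ((\<zeta> (int n) \<omega> - h \<omega> (int n)) ** h \<omega> (int n + 1))"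
      using zeta_minus_h_step[OF assms, of "int n + 1"] by (simp add: add.commute)
    ultimately show ?case
      by (intro exI[of _ "H ** h \<omega> (int n + 1)"]) (simp add: H(2) matrix_mul_assoc)
  qed
  then obtain H where H: "max_onorm H \<le> 1"
    "\<zeta> (int n) \<omega> - h \<omega> (int n) = left_prod (\<lambda>k. A (int k + 1) \<omega>) n ** ((\<zeta> 0 \<omega> - h \<omega> 0) ** H)" by blast
  have "max_onorm ((\<zeta> 0 \<omega> - h \<omega> 0) ** H) \<le> max_onorm (\<zeta> 0 \<omega> - h \<omega> 0) * 1"
    by (intro order_trans[OF max_onorm_mult] mult_left_mono H max_onorm_nonneg)
  then have "max_onorm ((\<zeta> 0 \<omega> - h \<omega> 0) ** H) \<le> max_onorm (\<zeta> 0 \<omega> - h \<omega> 0)" by simp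
  from mult_left_mono[OF this max_onorm_nonneg] show ?thesis
    unfolding H(2) by (rule order_trans[OF max_onorm_mult])
qed

text \<open>Along the orbit of the shift the difference at site 0 tends to 0. If it were at least
  \<open>1 / Suc k\<close> with positive probability, it would be so at infinitely many times, by
  recurrence.\<close>

lemma AE_zeta_eq_h: "AE \<omega> in P. \<forall>n. \<zeta> n \<omega> = h \<omega> n"
proof -
  obtain c where c: "0 < c"
    "AE \<omega> in P. \<exists>C. \<forall>\<^sub>F n in sequentially. max_onorm (left_prod (\<lambda>k. A (int k + 1) \<omega>) n) \<le> exp (C - c * real n)"
    by (rule AE_products_decay)
  have "AE \<omega> in P. \<zeta> 0 \<omega> $ i $ j = h \<omega> 0 $ i $ j" for i j
  proof -
    have [measurable]: "(\<lambda>\<omega>. \<zeta> 0 \<omega> $ i $ j) \<in> borel_measurable P"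
      using sol by (intro vec_component_measurable) (auto simp: stationary_solution_def)
    define f where "f \<omega> = \<bar>\<zeta> 0 \<omega> $ i $ j - h \<omega> 0 $ i $ j\<bar>" for \<omega>
    have [measurable]: "f \<in> borel_measurable P" unfolding f_def by measurable
    have lim: "AE \<omega> in P. (\<lambda>n. f (env_shift (int n) \<omega>)) \<longlonglongrightarrow> 0"
      using c(2) AE_solves
    proof eventually_elim
      case (elim \<omega>)
      then obtain C where C: "\<forall>\<^sub>F n in sequentially. max_onorm (left_prod (\<lambda>k. A (int k + 1) \<omega>) n) \<le> exp (C - c * real n)" by blast
      let ?D = "max_onorm (\<zeta> 0 \<omega> - h \<omega> 0)"
      have sp: "\<omega> \<in> space P" using elim by (simp add: solves_def)
      have le: "f (env_shift (int n) \<omega>) \<le> max_onorm (left_prod (\<lambda>k. A (int k + 1) \<omega>) n) * ?D" for n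
      proof -
        have "f (env_shift (int n) \<omega>) = \<bar>(\<zeta> (int n) \<omega> - h \<omega> (int n)) $ i $ j\<bar>"
          using elim(2) by (simp add: f_def solves_def h_env_shift)
        also have "\<dots> \<le> max_onorm (\<zeta> (int n) \<omega> - h \<omega> (int n))" by (rule abs_component_le_max_onorm)
        finally show ?thesis using zeta_minus_h_norm[OF elim(2)] by (meson order_trans)
      qed
      show ?case
      proof (rule tendsto_sandwich[OF _ _ tendsto_const])
        show "\<forall>\<^sub>F n in sequentially. 0 \<le> f (env_shift (int n) \<omega>)" by (simp add: f_def)
        show "\<forall>\<^sub>F n in sequentially. f (env_shift (int n) \<omega>) \<le> exp (C - c * real n) * ?D"
          using C by eventually_elim (rule order_trans[OF le], intro mult_right_mono max_onorm_nonneg)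
        show "(\<lambda>n. exp (C - c * real n) * ?D) \<longlonglongrightarrow> 0"
          using summable_LIMSEQ_zero[OF exp_linear_summable[OF c(1)]] by (rule tendsto_mult_left_zero)
      qed
    qed
    have "AE \<omega> in P. \<not> 1 / real (Suc k) \<le> f \<omega>" for k
    proof (rule ccontr)
      assume "\<not> (AE \<omega> in P. \<not> 1 / real (Suc k) \<le> f \<omega>)"
      from fwd.AE_infinitely_often[OF _ this]
      have "AE \<omega> in P. \<forall>N. \<exists>n\<ge>N. 1 / real (Suc k) \<le> f (env_shift (int n) \<omega>)"
        by (simp add: env_shift_funpow)
      with lim have "AE \<omega> in P. False"
      proof eventually_elim
        case (elim \<omega>)
        have "\<forall>\<^sub>F n in sequentially. f (env_shift (int n) \<omega>) < 1 / real (Suc k)"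
          by (rule order_tendstoD(2)[OF elim(1)]) simp
        then show ?case using elim(2) unfolding eventually_sequentially by (meson not_le)
      qed
      then show False by simp
    qed
    then have "AE \<omega> in P. \<forall>k. f \<omega> < 1 / real (Suc k)"
      by (simp add: AE_all_countable not_le)
    then show ?thesis
    proof eventually_elim
      case (elim \<omega>)
      have "\<not> 0 < f \<omega>" using elim nat_approx_posE[of "f \<omega>"] by (metis less_asym)
      then show ?case by (simp add: f_def)
    qed
  qed
  then have "AE \<omega> in P. \<zeta> 0 \<omega> = h \<omega> 0"
    by (simp add: vec_eq_iff AE_all_countable)
  from AE_env_shift[OF this] AE_solves show ?thesis
    by eventually_elim (auto simp: solves_def h_env_shift)
qed

definition good :: "'s env \<Rightarrow> bool" where
  "good \<omega> \<longleftrightarrow> solves \<omega> \<and> (\<forall>n. \<zeta> n \<omega> = h \<omega> n)"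

lemma AE_good: "AE \<omega> in P. good \<omega>"
  using AE_solves AE_zeta_eq_h by eventually_elim (simp add: good_def)

lemma good_in_space: "good \<omega> \<Longrightarrow> \<omega> \<in> space P"
  by (simp add: good_def solves_def)

text \<open>Inherited from \<zeta>; it says that the walk reaches the next level almost surely from
  each position.\<close>

lemma good_stochastic: "good \<omega> \<Longrightarrow> stochastic (h \<omega> n)"
  unfolding good_def solves_def by metis

lemma good_walk:
  assumes "good \<omega>"
  shows "strip_walk_exit (\<lambda>n. p (\<omega> n)) (\<lambda>n. q (\<omega> n)) (\<lambda>n. r (\<omega> n)) (walk \<omega>) (exit_rate \<omega>)"
  using assms by (intro strip_walk_exit) (auto simp: good_def solves_def)

lemma crossing_series_eq:
  assumes "good \<omega>"
  shows "(\<integral>\<^sup>+X. passage_time 1 X \<partial>chain (walk \<omega>) (0, i)) = crossing_series q r \<zeta> \<omega> i"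
proof -
  interpret W: strip_walk_exit "\<lambda>n. p (\<omega> n)" "\<lambda>n. q (\<omega> n)" "\<lambda>n. r (\<omega> n)" "walk \<omega>" "exit_rate \<omega>"
    by (rule good_walk[OF assms])
  have g: "gamma q r \<zeta> n \<omega> = W.g n" for n
    using assms by (simp add: gamma_def W.g_def good_def)
  have a: "A n \<omega> = W.a n" for n by (simp add: a_mat_def W.a_def g)
  have w: "W.w n m = right_prod (\<lambda>l. A (n - int l) \<omega>) m *v b_vec q r \<zeta> (n - int m) \<omega>" for n m
  proof (induction n m rule: W.w.induct)
    case (1 n)
    then show ?case by (simp add: b_vec_def g)
  next
    case (2 n m)
    have "right_prod (\<lambda>l. A (n - int l) \<omega>) (Suc m) = A n \<omega> ** right_prod (\<lambda>l. A (n - 1 - int l) \<omega>) m"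
      by (subst right_prod_Suc_shift) (simp add: algebra_simps)
    with 2 show ?case by (simp add: a matrix_vector_mul_assoc algebra_simps del: right_prod.simps)
  qed
  show ?thesis
    using W.nn_integral_passage_time[of 0 i] by (simp add: w crossing_series_def)
qed

text \<open>The mean number of visits to level 0 from level \<open>n\<close> before
  \<open>n + 1\<close> contains exactly the product \<open>a_n ... a_1\<close> controlled by
  Condition D, applied to the fixed vector \<open>w 0 0\<close>; the decay makes it
  summable.\<close>

lemma AE_finite_visits:
  "AE \<omega> in P. \<forall>i. AE X in chain (walk \<omega>) (0, i). finite {t. fst (X t) = 0}"
proof -
  obtain c where c: "0 < c"
    "AE \<omega> in P. \<exists>C. \<forall>\<^sub>F n in sequentially. max_onorm (left_prod (\<lambda>k. A (int k + 1) \<omega>) n) \<le> exp (C - c * real n)"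
    by (rule AE_products_decay)
  from c(2) AE_good show ?thesis
  proof eventually_elim
    case (elim \<omega>)
    then obtain C where C: "\<forall>\<^sub>F n in sequentially. max_onorm (left_prod (\<lambda>k. A (int k + 1) \<omega>) n) \<le> exp (C - c * real n)" by blast
    interpret W: strip_walk_exit "\<lambda>n. p (\<omega> n)" "\<lambda>n. q (\<omega> n)" "\<lambda>n. r (\<omega> n)" "walk \<omega>" "exit_rate \<omega>"
      by (rule good_walk[OF elim(2)])
    have a: "A n \<omega> = W.a n" for n
      using elim(2) by (simp add: a_mat_def W.a_def gamma_def W.g_def good_def)
    have w: "W.w (int n) n = left_prod (\<lambda>k. A (int k + 1) \<omega>) n *v W.w 0 0" for n
      by (induction n) (simp_all add: a add.commute flip: matrix_vector_mul_assoc)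
    define s where "s n = max_onorm (left_prod (\<lambda>k. A (int k + 1) \<omega>) n) * infnorm (W.w 0 0)" for n
    show ?case
    proof (intro allI W.AE_finite_visits[where s = s])
      fix n i
      have "W.w (int n) n $ i \<le> infnorm (W.w (int n) n)"
        using component_le_infnorm_cart[of "W.w (int n) n" i] by simp
      also have "\<dots> \<le> s n" unfolding w[of n] s_def by (rule infnorm_mult_le_max_onorm)
      finally show "W.w (int n) n $ i \<le> s n" .
    next
      show "summable s"
      proof (rule summable_comparison_test_ev)
        show "\<forall>\<^sub>F n in sequentially. norm (s n) \<le> exp (C - c * real n) * infnorm (W.w 0 0)"
          using C by eventually_elim
            (auto simp: s_def abs_mult infnorm_pos_le max_onorm_nonneg intro!: mult_right_mono)
        show "summable (\<lambda>n. exp (C - c * real n) * infnorm (W.w 0 0))"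
          by (intro summable_mult2 exp_linear_summable c)
      qed
    qed
  qed
qed

end

section \<open>The limiting entrance law\<close>

lemma stochastic_left_prod: "(\<And>k. stochastic (B k)) \<Longrightarrow> stochastic (left_prod B n)"
  by (induction n) (simp_all add: stochastic_mat_1 stochastic_mult)

lemma matrix_mult_column: "(A ** B) $ i $ j = (A *v column j B) $ i"
  by (simp add: matrix_matrix_mult_def matrix_vector_mult_def column_def)

lemma stochastic_mult_vec_bounds:
  assumes B: "stochastic B" and x: "\<And>l. a \<le> x $ l" "\<And>l. x $ l \<le> b"
  shows "a \<le> (B *v x) $ i" "(B *v x) $ i \<le> b"
proof -
  have B': "nonneg_matrix B" "row_sum B i = 1" using B by (auto simp: stochastic_iff)
  have "(B *v (\<chi> i. a)) $ i \<le> (B *v x) $ i" "(B *v x) $ i \<le> (B *v (\<chi> i. b)) $ i"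
    using x by (intro mult_vec_mono B'; simp)+
  then show "a \<le> (B *v x) $ i" "(B *v x) $ i \<le> b" by (auto simp: mult_vec_const B')
qed

text \<open>A new factor on the left replaces the rows by averages of the previous rows. So the
  range of each column is nested, and it shrinks by \<open>1 - e\<close> at every uniformly positive
  factor; the limit cannot depend on the row.\<close>

lemma stochastic_left_prod_limit:
  fixes B :: "nat \<Rightarrow> 'n::finite matr"
  assumes st: "\<And>k. stochastic (B k)"
    and e: "0 < e" "\<And>N. \<exists>m\<ge>N. \<forall>i j. e \<le> B m $ i $ j"
  obtains v where "\<And>i j. (\<lambda>n. left_prod B n $ i $ j) \<longlonglongrightarrow> v $ j"
    "\<And>j. 0 \<le> v $ j" "(\<Sum>j\<in>UNIV. v $ j) = 1"
proof -
  define M where "M n = left_prod B n" for n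
  have stM: "stochastic (M n)" for n unfolding M_def by (rule stochastic_left_prod[OF st])
  have M01: "0 \<le> M n $ i $ j" "M n $ i $ j \<le> 1" for n i j
  proof -
    show "0 \<le> M n $ i $ j" using stM by (simp add: stochastic_def)
    have "M n $ i $ j \<le> (\<Sum>l\<in>UNIV. M n $ i $ l)" using stM[of n] by (intro member_le_sum) (auto simp: stochastic_def)
    then show "M n $ i $ j \<le> 1" using stM[of n] by (simp add: stochastic_def)
  qed
  have e1: "e \<le> 1"
  proof -
    obtain m where "\<forall>i j. e \<le> B m $ i $ j" using e(2) by blast
    then have "e \<le> B m $ undefined $ undefined" by blast
    also have "\<dots> \<le> (\<Sum>l\<in>UNIV. B m $ undefined $ l)" using st[of m] by (intro member_le_sum) (auto simp: stochastic_def)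
    finally show ?thesis using st[of m] by (simp add: stochastic_def)
  qed
  have later: "\<exists>B'. stochastic B' \<and> M m = B' ** M n" if nm: "n \<le> m" for n m
    using left_prod_add[of B n "m - n"] nm stochastic_left_prod[of "\<lambda>k. B (n + k)"] st
    unfolding M_def by (metis le_add_diff_inverse)
  have near: "\<bar>M m $ i $ j - M n $ i' $ j\<bar> \<le> D"
    if nm: "n \<le> m" and D: "\<And>i i'. M n $ i $ j - M n $ i' $ j \<le> D" for n m i i' j D
  proof -
    obtain B' where B': "stochastic B'" "M m = B' ** M n" using later[OF nm] by blast
    have "M n $ i' $ j - D \<le> column j (M n) $ l" "column j (M n) $ l \<le> M n $ i' $ j + D" for l
      using D[of l i'] D[of i' l] by (auto simp: column_def)
    from stochastic_mult_vec_bounds[OF B'(1), of "M n $ i' $ j - D" "column j (M n)" "M n $ i' $ j + D" i, OF this]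
    show ?thesis by (simp add: B'(2) matrix_mult_column abs_le_iff)
  qed
  have osc: "\<exists>n0. \<forall>n\<ge>n0. \<forall>i i'. M n $ i $ j - M n $ i' $ j \<le> (1 - e) ^ k" for j k
  proof (induction k)
    case 0
    have "M n $ i $ j - M n $ i' $ j \<le> 1" for n i i' using M01[of n i j] M01[of n i' j] by simp
    then show ?case by simp
  next
    case (Suc k)
    then obtain n0 where n0: "\<And>n i i'. n \<ge> n0 \<Longrightarrow> M n $ i $ j - M n $ i' $ j \<le> (1 - e) ^ k" by blast
    obtain m where m: "n0 \<le> m" "\<forall>i j. e \<le> B m $ i $ j" using e(2) by blast
    have "(B m *v column j (M m)) $ i - (B m *v column j (M m)) $ i' \<le> (1 - e) * (1 - e) ^ k" for i i'
      by (rule stochastic_contraction[OF st[of m]]) (use m e n0[OF m(1)] in \<open>auto simp: column_def\<close>)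
    then have m': "M (Suc m) $ i $ j - M (Suc m) $ i' $ j \<le> (1 - e) ^ Suc k" for i i'
      by (simp add: M_def matrix_mult_column)
    have "M n $ i $ j - M n $ i' $ j \<le> (1 - e) ^ Suc k" if mn: "Suc m \<le> n" for n i i'
    proof -
      obtain B' where B': "stochastic B'" "M n = B' ** M (Suc m)" using later[OF mn] by blast
      have "(B' *v column j (M (Suc m))) $ i - (B' *v column j (M (Suc m))) $ i' \<le> (1 - 0) * (1 - e) ^ Suc k"
        by (rule stochastic_contraction[OF B'(1)]) (use B'(1) m' in \<open>auto simp: column_def stochastic_def\<close>)
      then show ?thesis by (simp add: B'(2) matrix_mult_column)
    qed
    then show ?case by blast
  qed
  have small: "\<exists>n0. \<forall>n\<ge>n0. \<forall>i i'. M n $ i $ j - M n $ i' $ j \<le> d" if d: "0 < d" for d j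
  proof -
    have "(\<lambda>k. (1 - e) ^ k) \<longlonglongrightarrow> 0" using e(1) e1 by (intro LIMSEQ_power_zero) auto
    from order_tendstoD(2)[OF this d] obtain k where "(1 - e) ^ k < d" by (auto simp: eventually_sequentially)
    with osc[of j k] show ?thesis by (meson less_imp_le order_trans)
  qed
  define v where "v = (\<chi> j. lim (\<lambda>n. M n $ undefined $ j))"
  have conv: "(\<lambda>n. M n $ undefined $ j) \<longlonglongrightarrow> v $ j" for j
  proof -
    have "Cauchy (\<lambda>n. M n $ undefined $ j)"
    proof (rule metric_CauchyI)
      fix d :: real assume "0 < d"
      then obtain n0 where n0: "\<And>i i'. M n0 $ i $ j - M n0 $ i' $ j \<le> d / 3" using small[of "d / 3" j] by auto
      have "dist (M m $ undefined $ j) (M n $ undefined $ j) < d" if "m \<ge> n0" "n \<ge> n0" for m n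
        using near[OF that(1) n0, of undefined undefined] near[OF that(2) n0, of undefined undefined] \<open>0 < d\<close>
        unfolding dist_real_def by linarith
      then show "\<exists>N. \<forall>m\<ge>N. \<forall>n\<ge>N. dist (M m $ undefined $ j) (M n $ undefined $ j) < d" by blast
    qed
    then show ?thesis by (simp add: v_def Cauchy_convergent_iff convergent_LIMSEQ_iff)
  qed
  have all: "(\<lambda>n. M n $ i $ j) \<longlonglongrightarrow> v $ j" for i j
  proof -
    have "(\<lambda>n. M n $ i $ j - M n $ undefined $ j) \<longlonglongrightarrow> 0"
    proof (rule LIMSEQ_I)
      fix d :: real assume "0 < d"
      then obtain n0 where n0: "\<And>n i i'. n \<ge> n0 \<Longrightarrow> M n $ i $ j - M n $ i' $ j \<le> d / 2" using small[of "d / 2" j] by auto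
      show "\<exists>no. \<forall>n\<ge>no. norm (M n $ i $ j - M n $ undefined $ j - 0) < d"
        using n0[of _ i undefined] n0[of _ undefined i] \<open>0 < d\<close> by (intro exI[of _ n0]) (fastforce simp: abs_less_iff)
    qed
    from tendsto_add[OF this conv[of j]] show ?thesis by simp
  qed
  show ?thesis
  proof (rule that[of v])
    show "(\<lambda>n. left_prod B n $ i $ j) \<longlonglongrightarrow> v $ j" for i j using all by (simp add: M_def)
    show "0 \<le> v $ j" for j by (rule LIMSEQ_le_const[OF conv]) (use M01 in auto)
    have "(\<lambda>n. \<Sum>j\<in>UNIV. M n $ undefined $ j) \<longlonglongrightarrow> (\<Sum>j\<in>UNIV. v $ j)" by (intro tendsto_sum conv)
    moreover have "(\<Sum>j\<in>UNIV. M n $ undefined $ j) = 1" for n using stM by (simp add: stochastic_def)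
    ultimately show "(\<Sum>j\<in>UNIV. v $ j) = 1" by (simp add: LIMSEQ_const_iff)
  qed
qed

context strip_rwre
begin

definition past_prod :: "'s env \<Rightarrow> nat \<Rightarrow> 'd matr" where
  "past_prod \<omega> n = left_prod (\<lambda>k. h \<omega> (- int k - 1)) n"

lemma pi_vec_eqI:
  assumes sp: "\<omega> \<in> space P" and lim: "\<And>i j. (\<lambda>n. past_prod \<omega> n $ i $ j) \<longlonglongrightarrow> v $ j"
  shows "pi_vec p q r \<omega> = v"
proof -
  have row: "axis i 1 v* B = (\<chi> j. B $ i $ j)" for i and B :: "'d matr"
    by (simp add: vec_eq_iff vector_matrix_mult_def axis_def if_distrib[of "\<lambda>x. x * y" for y] cong: if_cong)
  have "(\<lambda>n. axis i 1 v* left_prod (\<lambda>k. eta p q r (- int k - 1) \<omega>) n) \<longlonglongrightarrow> v" for i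
    unfolding row eta_eq_h[OF sp] past_prod_def[symmetric]
    by (rule vec_tendstoI) (simp add: lim)
  then show ?thesis
    unfolding pi_vec_def by (intro the_equality) (auto intro: LIMSEQ_unique)
qed

definition stationary_start :: "'s env \<Rightarrow> bool" where
  "stationary_start \<omega> \<longleftrightarrow> (\<forall>i j. (\<lambda>n. past_prod \<omega> n $ i $ j) \<longlonglongrightarrow> pi_vec p q r \<omega> $ j)
     \<and> (\<forall>j. 0 \<le> pi_vec p q r \<omega> $ j) \<and> (\<Sum>j\<in>UNIV. pi_vec p q r \<omega> $ j) = 1"

lemma AE_stationary_start: "AE \<omega> in P. stationary_start \<omega>"
proof -
  obtain e where e: "0 < e"
    "AE \<omega> in P. \<forall>N. \<exists>m\<ge>N. \<forall>i j. e \<le> h \<omega> (- int m) $ i $ j"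
    by (rule AE_uniformly_positive)
  from e(2) AE_good show ?thesis
  proof eventually_elim
    case (elim \<omega>)
    have "\<exists>m\<ge>N. \<forall>i j. e \<le> h \<omega> (- int m - 1) $ i $ j" for N
    proof -
      obtain m where m: "m \<ge> Suc N" "\<forall>i j. e \<le> h \<omega> (- int m) $ i $ j" using elim(1) by blast
      then have "- int (m - 1) - 1 = - int m" by simp
      with m show ?thesis by (intro exI[of _ "m - 1"]) auto
    qed
    from stochastic_left_prod_limit[OF _ e(1) this] good_stochastic[OF elim(2)]
    obtain v where v: "\<And>i j. (\<lambda>n. past_prod \<omega> n $ i $ j) \<longlonglongrightarrow> v $ j"
      "\<And>j. 0 \<le> v $ j" "(\<Sum>j\<in>UNIV. v $ j) = 1"
      unfolding past_prod_def by metis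
    from pi_vec_eqI[OF good_in_space[OF elim(2)] v(1)] v show ?case
      by (simp add: stationary_start_def)
  qed
qed

text \<open>Shifting the environment appends \<open>h \<omega> 0\<close> as the rightmost factor of
  the past product, so \<pi> is carried along by the hitting matrices.\<close>

lemma pi_vec_shift:
  assumes sp: "\<omega> \<in> space P" and st: "stationary_start \<omega>" "stationary_start (env_shift 1 \<omega>)"
  shows "pi_vec p q r (env_shift 1 \<omega>) $ j = (\<Sum>i\<in>UNIV. pi_vec p q r \<omega> $ i * h \<omega> 0 $ i $ j)"
proof -
  have "past_prod (env_shift 1 \<omega>) (Suc n) = past_prod \<omega> n ** h \<omega> 0" for n
  proof -
    have "past_prod (env_shift 1 \<omega>) (1 + n) = left_prod (\<lambda>k. h \<omega> (- int k)) (1 + n)"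
      by (simp only: past_prod_def h_env_shift[OF sp] diff_add_cancel)
    also have "\<dots> = left_prod (\<lambda>k. h \<omega> (- int (1 + k))) n ** left_prod (\<lambda>k. h \<omega> (- int k)) 1"
      by (rule left_prod_add)
    also have "(\<lambda>k. h \<omega> (- int (1 + k))) = (\<lambda>k. h \<omega> (- int k - 1))"
      by (intro ext arg_cong[where f = "h \<omega>"]) simp
    also have "left_prod (\<lambda>k. h \<omega> (- int k)) 1 = h \<omega> 0" by simp
    finally show ?thesis by (simp add: past_prod_def[of \<omega>])
  qed
  then have "past_prod (env_shift 1 \<omega>) (Suc n) $ undefined $ j = (\<Sum>i\<in>UNIV. past_prod \<omega> n $ undefined $ i * h \<omega> 0 $ i $ j)" for n
    by (simp add: matrix_matrix_mult_def)
  moreover have "(\<lambda>n. \<Sum>i\<in>UNIV. past_prod \<omega> n $ undefined $ i * h \<omega> 0 $ i $ j) \<longlonglongrightarrow> (\<Sum>i\<in>UNIV. pi_vec p q r \<omega> $ i * h \<omega> 0 $ i $ j)"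
    using st(1) by (intro tendsto_sum tendsto_mult tendsto_const) (auto simp: stationary_start_def)
  ultimately have "(\<lambda>n. past_prod (env_shift 1 \<omega>) (Suc n) $ undefined $ j) \<longlonglongrightarrow> (\<Sum>i\<in>UNIV. pi_vec p q r \<omega> $ i * h \<omega> 0 $ i $ j)"
    by simp
  moreover have "(\<lambda>n. past_prod (env_shift 1 \<omega>) (Suc n) $ undefined $ j) \<longlonglongrightarrow> pi_vec p q r (env_shift 1 \<omega>) $ j"
    using st(2) by (intro LIMSEQ_Suc) (auto simp: stationary_start_def)
  ultimately show ?thesis by (rule LIMSEQ_unique[symmetric])
qed

lemma past_prod_measurable [measurable]: "(\<lambda>\<omega>. past_prod \<omega> n $ i $ j) \<in> borel_measurable P"
  unfolding past_prod_def
proof (induction n arbitrary: i j)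
  case 0
  show ?case by simp
next
  case (Suc n)
  note [measurable] = Suc
  show ?case by (simp add: matrix_matrix_mult_def)
qed

text \<open>A measurable version of \<open>pi_vec\<close>: a limit of measurable functions instead
  of a definite description.\<close>

definition start_weight :: "'s env \<Rightarrow> 'd \<Rightarrow> real" where
  "start_weight \<omega> j = lim (\<lambda>n. past_prod \<omega> n $ undefined $ j)"

text \<open>The point mass at \<open>undefined\<close> is a default on the null set where the
  weights do not form a probability vector, so that the kernel exists for every environment.\<close>

definition start_pmf :: "'s env \<Rightarrow> 'd pmf" where
  "start_pmf \<omega> = embed_pmf (\<lambda>j. if (\<forall>j. 0 \<le> start_weight \<omega> j) \<and> (\<Sum>j\<in>UNIV. start_weight \<omega> j) = 1
     then start_weight \<omega> j else of_bool (j = undefined))"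

lemma pmf_start_pmf:
  "pmf (start_pmf \<omega>) j = (if (\<forall>j. 0 \<le> start_weight \<omega> j) \<and> (\<Sum>j\<in>UNIV. start_weight \<omega> j) = 1
     then start_weight \<omega> j else of_bool (j = undefined))"
  unfolding start_pmf_def
proof (rule pmf_embed_pmf)
  let ?f = "\<lambda>j. if (\<forall>j. 0 \<le> start_weight \<omega> j) \<and> (\<Sum>j\<in>UNIV. start_weight \<omega> j) = 1
     then start_weight \<omega> j else of_bool (j = undefined)"
  show nn: "0 \<le> ?f j" for j by auto
  have "(\<integral>\<^sup>+j. ennreal (?f j) \<partial>count_space UNIV) = ennreal (\<Sum>j\<in>UNIV. ?f j)"
    by (subst nn_integral_count_space_finite) (auto intro!: sum_ennreal nn)
  also have "(\<Sum>j\<in>UNIV. ?f j) = 1"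
  proof (cases "(\<forall>j. 0 \<le> start_weight \<omega> j) \<and> (\<Sum>j\<in>UNIV. start_weight \<omega> j) = 1")
    case True
    then show ?thesis by (simp only: if_True simp_thms)
  next
    case False
    then show ?thesis by (simp only: if_False) (simp add: of_bool_def)
  qed
  finally show "(\<integral>\<^sup>+j. ennreal (?f j) \<partial>count_space UNIV) = 1" by simp
qed

lemma pmf_start_pmf_measurable [measurable]: "(\<lambda>\<omega>. pmf (start_pmf \<omega>) j) \<in> borel_measurable P"
proof -
  have [measurable]: "(\<lambda>\<omega>. start_weight \<omega> j) \<in> borel_measurable P" for j
    unfolding start_weight_def by (rule borel_measurable_lim_metric) measurable
  show ?thesis unfolding pmf_start_pmf by measurable
qed

lemma pmf_start_pmf_eq:
  assumes "stationary_start \<omega>"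
  shows "pmf (start_pmf \<omega>) j = pi_vec p q r \<omega> $ j"
proof -
  have "start_weight \<omega> j = pi_vec p q r \<omega> $ j" for j
    using assms unfolding start_weight_def stationary_start_def by (intro limI) blast
  then show ?thesis using assms by (simp add: pmf_start_pmf stationary_start_def)
qed

end

section \<open>The law of large numbers\<close>

lemma first_time_translate: "first_time (translate 1 X) n = first_time X (Suc n)"
  by (simp add: first_time_def algebra_simps)

lemma path_after_funpow: "(path_after 1 ^^ k) s = path_after k s"
  by (induction k) (auto simp: path_after_def)

definition increments :: "(nat \<Rightarrow> int \<times> 'd) \<Rightarrow> nat \<Rightarrow> nat" where
  "increments X k = first_time X (Suc k) - first_time X k"

lemma increments_measurable [measurable]: "increments \<in> measurable path_space path_space"
proof (rule measurable_PiM_single')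
  fix k
  have "(\<lambda>X. m - first_time X k) \<in> measurable path_space (count_space UNIV)" for m
    by (rule measurable_compose[OF first_time_measurable]) simp
  then show "(\<lambda>X. increments X k) \<in> measurable path_space (count_space UNIV)"
    unfolding increments_def by (rule measurable_compose_countable) (rule first_time_measurable)
qed (auto simp: space_PiM)

definition ascending :: "(nat \<Rightarrow> int \<times> 'd) \<Rightarrow> bool" where
  "ascending X \<longleftrightarrow> fst (X 0) = 0 \<and> skip_free X \<and> (\<forall>L\<ge>0. hits L X)"

lemma ascending_measurable [measurable]:
  "Measurable.pred path_space (ascending :: (nat \<Rightarrow> int \<times> 'd::countable) \<Rightarrow> bool)"
  unfolding ascending_def by measurable

lemma ascending_first_at: "ascending X \<Longrightarrow> first_at (level (int n)) (first_time X n) X"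
  by (intro first_at_first_time) (simp add: ascending_def)

lemma ascending_first_time_0: "ascending X \<Longrightarrow> first_time X 0 = 0"
  by (intro first_time_eq) (simp add: ascending_def)

lemma ascending_first_time_mono:
  assumes "ascending X"
  shows "first_time X n \<le> first_time X (Suc n)"
proof -
  have "first_at (level (int n + 1)) (first_time X (Suc n)) X"
    using ascending_first_at[OF assms, of "Suc n"] by (simp add: add.commute)
  from first_at_level_mono[OF _ _ this] assms obtain s where "s \<le> first_time X (Suc n)" "first_at (level (int n)) s X"
    by (auto simp: ascending_def)
  then show ?thesis using first_time_eq by metis
qed

lemma sum_increments:
  assumes "ascending X"
  shows "(\<Sum>k<n. increments X k) = first_time X n"
proof (induction n)
  case 0
  then show ?case by (simp add: ascending_first_time_0[OF assms])
next
  case (Suc n)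
  then show ?case using ascending_first_time_mono[OF assms, of n] by (simp add: increments_def)
qed

text \<open>Dropping the first crossing time amounts to restarting the path at its first entrance
  into level 1 and renaming that level 0.\<close>

lemma increments_Suc:
  assumes "ascending X"
  shows "path_after 1 (increments X) = increments (translate 1 (path_after (first_time X 1) X))"
proof -
  have split: "first_time X n = first_time X 1 + first_time (path_after (first_time X 1) X) n" if n: "1 \<le> n" for n
  proof (rule first_time_path_after)
    show "hits (int n) X" using assms by (simp add: ascending_def)
    fix s assume s: "s < first_time X 1"
    have "\<forall>u\<le>s. fst (X u) \<noteq> 1"
      using ascending_first_at[OF assms, of 1] s by (auto simp: first_at_def)
    from skip_free_less[OF _ _ this] assms have "fst (X s) < 1" by (simp add: ascending_def)
    with n show "fst (X s) \<noteq> int n" by simp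
  qed
  have "first_time X (Suc n) = first_time X 1 + first_time (path_after (first_time X 1) X) (Suc n)" for n
    by (rule split) simp
  then have "increments X (Suc k) = increments (translate 1 (path_after (first_time X 1) X)) k" for k
    unfolding increments_def first_time_translate by (metis add_diff_cancel_left)
  then show ?thesis by (simp add: fun_eq_iff)
qed

lemma ascending_passage_time:
  assumes "ascending X"
  shows "passage_time 1 X = ennreal (real (increments X 0))"
proof -
  define T where "T = first_time X 1"
  have T: "first_at (level 1) T X" unfolding T_def using ascending_first_at[OF assms, of 1] by simp
  have "(\<forall>s\<le>t. fst (X s) \<noteq> 1) \<longleftrightarrow> t < T" for t
    using T unfolding first_at_def in_level by (metis le_less_trans not_le)
  then have "passage_time 1 X = (\<Sum>t. if t \<in> {..<T} then 1 else 0)"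
    unfolding passage_time_def by simp
  also have "\<dots> = (\<Sum>t\<in>{..<T}. 1)"
    by (rule sums_unique[symmetric]) (rule sums_If_finite_set, simp)
  also have "\<dots> = ennreal (real T)" by (simp add: ennreal_of_nat_eq_real_of_nat)
  finally show ?thesis by (simp add: increments_def ascending_first_time_0[OF assms] T_def)
qed

lemma ascending_increments_0: "ascending X \<Longrightarrow> 1 \<le> increments X 0"
  using ascending_first_at[of X 1] ascending_first_time_0[of X]
  by (cases "first_time X 1 = 0") (auto simp: increments_def ascending_def)

text \<open>After the last visit to 0 unit steps cannot change the sign, and some positive level is
  reached after that visit.\<close>

lemma ascending_eventually_nonneg:
  assumes X: "ascending X" and fin: "finite {t. fst (X t) = 0}"
  shows "\<forall>\<^sub>F t in sequentially. 0 \<le> fst (X t)"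
proof -
  obtain t0 where t0: "\<And>t. t \<ge> t0 \<Longrightarrow> fst (X t) \<noteq> 0"
  proof -
    obtain b where "\<And>t. fst (X t) = 0 \<Longrightarrow> t \<le> b" using fin by (auto simp: finite_nat_set_iff_bounded_le)
    then show ?thesis using that[of "Suc b"] by (meson not_less_eq_eq)
  qed
  \<comment> \<open>A positive level higher than all positions up to \<open>t0\<close>, hence
    reached only after \<open>t0\<close>.\<close>
  define L where "L = max 1 (Max ((\<lambda>s. fst (X s)) ` {..t0}) + 1)"
  have "hits L X" using X by (simp add: ascending_def L_def)
  then obtain t1 where t1: "fst (X t1) = L" by (auto simp: hits_def)
  have "t0 \<le> t1"
  proof (rule ccontr)
    assume "\<not> t0 \<le> t1"
    then have "fst (X t1) \<le> Max ((\<lambda>s. fst (X s)) ` {..t0})" by (intro Max_ge) auto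
    then show False by (simp add: t1 L_def)
  qed
  have "0 < fst (X t)" if "t1 \<le> t" for t
    using that
  proof (induction t rule: dec_induct)
    case base
    then show ?case by (simp add: t1 L_def)
  next
    case (step t)
    have "\<bar>fst (X (Suc t)) - fst (X t)\<bar> \<le> 1" using X by (simp add: ascending_def skip_free_def)
    moreover have "fst (X (Suc t)) \<noteq> 0" using t0[of "Suc t"] \<open>t0 \<le> t1\<close> step.hyps by simp
    ultimately show ?case using step.IH by linarith
  qed
  then show ?thesis unfolding eventually_sequentially by (meson less_imp_le)
qed

context strip_rwre
begin

lemma nn_integral_quenched:
  assumes [measurable]: "f \<in> borel_measurable path_space"
  shows "(\<integral>\<^sup>+X. f X \<partial>quenched p q r \<omega> \<nu>) = (\<Sum>i\<in>UNIV. ennreal (pmf \<nu> i) * (\<integral>\<^sup>+X. f X \<partial>chain (walk \<omega>) (0, i)))"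
proof -
  have "(\<integral>\<^sup>+X. f X \<partial>quenched p q r \<omega> \<nu>)
      = (\<integral>\<^sup>+y. (\<integral>\<^sup>+X. f X \<partial>chain (walk \<omega>) y) \<partial>measure_pmf (map_pmf (\<lambda>i. (0, i)) \<nu>))"
    unfolding quenched_def markov_law_eq_bind
    by (rule nn_integral_bind[where B = path_space]) auto
  also have "\<dots> = (\<integral>\<^sup>+i. (\<integral>\<^sup>+X. f X \<partial>chain (walk \<omega>) (0, i)) \<partial>measure_pmf \<nu>)"
    by (rule nn_integral_map_pmf)
  finally show ?thesis
    by (simp add: nn_integral_measure_pmf nn_integral_count_space_finite)
qed

lemma AE_ascending:
  assumes "good \<omega>"
  shows "AE X in chain (walk \<omega>) (0, i). ascending X"
  using strip_walk.AE_transient_path[OF strip_walk[OF good_in_space[OF assms]] good_stochastic[OF assms], of "(0, i)"]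
  by eventually_elim (auto simp: ascending_def)

text \<open>Annealed law of the crossing times when the walk starts from \<pi>. Environment and path
  are forgotten, and only the sequence on which \<open>path_after 1\<close> acts is kept.\<close>

definition increment_law :: "(nat \<Rightarrow> nat) measure" where
  "increment_law = P \<bind> (\<lambda>\<omega>. distr (quenched p q r \<omega> (start_pmf \<omega>)) path_space increments)"

lemma increment_kernel:
  "(\<lambda>\<omega>. distr (quenched p q r \<omega> (start_pmf \<omega>)) path_space increments) \<in> measurable P (subprob_algebra path_space)"
proof -
  have "(\<lambda>\<omega>. quenched p q r \<omega> (start_pmf \<omega>)) \<in> measurable P (prob_algebra path_space)"
    unfolding measurable_P
    by (rule quenched_measurable[OF tm]) (use pmf_start_pmf_measurable in \<open>simp add: measurable_P\<close>)
  from measurable_compose[OF this measurable_distr_prob_space[OF increments_measurable]]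
  show ?thesis by (rule measurable_prob_algebraD)
qed

lemma sets_increment_law [simp, measurable_cong]: "sets increment_law = sets path_space"
  unfolding increment_law_def by (rule sets_bind[where N = path_space]) (auto simp: not_empty)

lemma nn_integral_increment_law:
  assumes [measurable]: "f \<in> borel_measurable path_space"
  shows "(\<integral>\<^sup>+s. f s \<partial>increment_law)
    = (\<integral>\<^sup>+\<omega>. (\<Sum>i\<in>UNIV. ennreal (pmf (start_pmf \<omega>) i) * (\<integral>\<^sup>+X. f (increments X) \<partial>chain (walk \<omega>) (0, i))) \<partial>P)"
proof -
  have meas: "increments \<in> measurable (quenched p q r \<omega> (start_pmf \<omega>)) path_space" for \<omega>
    by (simp add: quenched_def measurable_cong_sets[OF sets_markov_law refl])
  have "(\<integral>\<^sup>+s. f s \<partial>increment_law)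
    = (\<integral>\<^sup>+\<omega>. (\<integral>\<^sup>+s. f s \<partial>distr (quenched p q r \<omega> (start_pmf \<omega>)) path_space increments) \<partial>P)"
    unfolding increment_law_def by (rule nn_integral_bind[OF assms increment_kernel])
  then show ?thesis
    by (simp add: nn_integral_distr[OF meas] nn_integral_quenched)
qed

lemma sum_pmf_UNIV: "(\<Sum>i\<in>UNIV. ennreal (pmf \<nu> i)) = 1" for \<nu> :: "'d pmf"
  using sum_pmf_eq_1[of UNIV \<nu>] by simp

lemma prob_space_increment_law: "prob_space increment_law"
proof (rule prob_spaceI)
  have "(\<integral>\<^sup>+s. 1 \<partial>increment_law) = 1"
    by (subst nn_integral_increment_law) (auto simp: sum_pmf_UNIV emeasure_space_1)
  then show "emeasure increment_law (space increment_law) = 1" by simp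
qed

lemma AE_increment_law:
  assumes Q: "Measurable.pred path_space Q"
    and AE: "AE \<omega> in P. \<forall>i. AE X in chain (walk \<omega>) (0, i). Q (increments X)"
  shows "AE s in increment_law. Q s"
proof -
  have sets: "{s. \<not> Q s} \<in> sets path_space"
    using Collect_in_path_sets[OF pred_intros_logic(2)[OF Q]] by simp
  have "(\<integral>\<^sup>+s. indicator {s. \<not> Q s} s \<partial>increment_law)
    = (\<integral>\<^sup>+\<omega>. (\<Sum>i\<in>UNIV. ennreal (pmf (start_pmf \<omega>) i) * (\<integral>\<^sup>+X. indicator {s. \<not> Q s} (increments X) \<partial>chain (walk \<omega>) (0, i))) \<partial>P)"
    by (rule nn_integral_increment_law) (rule borel_measurable_indicator[OF sets])
  also have "\<dots> = (\<integral>\<^sup>+\<omega>. 0 \<partial>P)"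
  proof (rule nn_integral_cong_AE, use AE in eventually_elim)
    fix \<omega> assume *: "\<forall>i. AE X in chain (walk \<omega>) (0, i). Q (increments X)"
    have "(\<integral>\<^sup>+X. indicator {s. \<not> Q s} (increments X) \<partial>chain (walk \<omega>) (0, i)) = (\<integral>\<^sup>+X. 0 \<partial>chain (walk \<omega>) (0, i))" for i
      by (rule nn_integral_cong_AE, rule AE_mp[OF *[rule_format, of i]]) (auto intro!: AE_I2)
    then show "(\<Sum>i\<in>UNIV. ennreal (pmf (start_pmf \<omega>) i) * (\<integral>\<^sup>+X. indicator {s. \<not> Q s} (increments X) \<partial>chain (walk \<omega>) (0, i))) = 0"
      by simp
  qed
  finally have "emeasure increment_law {s. \<not> Q s} = 0"
    using sets by simp
  then show ?thesis using sets by (intro AE_I[of _ _ "{s. \<not> Q s}"]) auto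
qed

text \<open>By the strong Markov property at level 1, the later crossing times are those of a walk
  in the shifted environment with start law \<pi> times \<open>h \<omega> 0\<close>. By
  \<open>pi_vec_shift\<close> this is \<pi> of the shifted environment, and invariance of
  \<open>P\<close> removes the shift.\<close>

lemma distr_increment_law: "distr increment_law increment_law (path_after 1) = increment_law"
proof (rule measure_eqI)
  fix B assume "B \<in> sets (distr increment_law increment_law (path_after 1))"
  then have B [measurable]: "B \<in> sets path_space" by simp
  define \<Phi> where "\<Phi> \<omega> j = (\<integral>\<^sup>+X. indicator B (increments X) \<partial>chain (walk \<omega>) (0, j))" for \<omega> j
  define \<Psi> where "\<Psi> \<omega> = (\<Sum>j\<in>UNIV. ennreal (pmf (start_pmf \<omega>) j) * \<Phi> \<omega> j)" for \<omega>
  have [measurable]: "(\<lambda>\<omega>. \<Phi> \<omega> j) \<in> borel_measurable P" for j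
  proof -
    have vim: "increments -` B \<in> sets (path_space :: (nat \<Rightarrow> int \<times> 'd) measure)"
      using measurable_sets[OF increments_measurable B] by simp
    have "\<Phi> \<omega> j = (\<integral>\<^sup>+X. indicator (increments -` B) X \<partial>chain (walk \<omega>) (0, j))" for \<omega>
      by (simp add: \<Phi>_def indicator_vimage)
    then have "\<Phi> \<omega> j = emeasure (chain (walk \<omega>) (0, j)) (increments -` B)" for \<omega>
      using vim by simp
    then show ?thesis using emeasure_chain_measurable[OF vim] by simp
  qed
  have [measurable]: "\<Psi> \<in> borel_measurable P" unfolding \<Psi>_def by measurable
  have "emeasure (distr increment_law increment_law (path_after 1)) B = (\<integral>\<^sup>+s. indicator B (path_after 1 s) \<partial>increment_law)"
    by (subst nn_integral_indicator[symmetric], simp, subst nn_integral_distr) auto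
  also have "\<dots> = (\<integral>\<^sup>+\<omega>. (\<Sum>i\<in>UNIV. ennreal (pmf (start_pmf \<omega>) i) * (\<integral>\<^sup>+X. indicator B (path_after 1 (increments X)) \<partial>chain (walk \<omega>) (0, i))) \<partial>P)"
    by (rule nn_integral_increment_law) measurable
  also have "\<dots> = (\<integral>\<^sup>+\<omega>. \<Psi> (env_shift 1 \<omega>) \<partial>P)"
  proof (rule nn_integral_cong_AE, use AE_good AE_stationary_start fwd.AE_T[OF AE_stationary_start] in eventually_elim)
    fix \<omega> assume good: "good \<omega>" and st: "stationary_start \<omega>" "stationary_start (env_shift 1 \<omega>)"
    have sp: "\<omega> \<in> space P" by (rule good_in_space[OF good])
    interpret W: strip_walk "\<lambda>n. p (\<omega> n)" "\<lambda>n. q (\<omega> n)" "\<lambda>n. r (\<omega> n)" "walk \<omega>"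
      by (rule strip_walk[OF sp])
    have nn: "0 \<le> h \<omega> 0 $ i $ j" for i j using W.nonneg_h by (simp add: nonneg_matrix_def)
    have from_1: "(\<integral>\<^sup>+Y. indicator B (increments (translate 1 Y)) \<partial>chain (walk \<omega>) (1, j)) = \<Phi> (env_shift 1 \<omega>) j" for j
    proof -
      have tr: "translate 1 \<in> measurable (chain (walk \<omega>) (0 + 1, j)) path_space" by measurable
      show ?thesis
        unfolding \<Phi>_def distr_chain_translate[OF sp, of 0 1 j, symmetric]
        by (subst nn_integral_distr[OF tr]) auto
    qed
    have \<Phi>: "(\<integral>\<^sup>+X. indicator B (path_after 1 (increments X)) \<partial>chain (walk \<omega>) (0, i))
       = (\<Sum>j\<in>UNIV. ennreal (h \<omega> 0 $ i $ j) * \<Phi> (env_shift 1 \<omega>) j)" for i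
    proof -
      have "(\<integral>\<^sup>+X. indicator B (path_after 1 (increments X)) \<partial>chain (walk \<omega>) (0, i))
        = (\<integral>\<^sup>+X. at_level 1 (\<lambda>Y. indicator B (increments (translate 1 Y))) X \<partial>chain (walk \<omega>) (0, i))"
      proof (rule nn_integral_cong_AE, use AE_ascending[OF good] in eventually_elim)
        fix X :: "nat \<Rightarrow> int \<times> 'd" assume X: "ascending X"
        have "first_at (level 1) (first_time X 1) X" using ascending_first_at[OF X, of 1] by simp
        from at_level_first[OF this] show "indicator B (path_after 1 (increments X))
            = at_level 1 (\<lambda>Y. indicator B (increments (translate 1 Y))) X"
          by (simp only: increments_Suc[OF X])
      qed
      also have "\<dots> = (\<Sum>j\<in>UNIV. ennreal (W.hit 1 (0, i) j) * (\<integral>\<^sup>+Y. indicator B (increments (translate 1 Y)) \<partial>chain (walk \<omega>) (1, j)))"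
        by (rule W.strong_markov) measurable
      finally show ?thesis by (simp add: W.h_def from_1)
    qed
    have "(\<Sum>i\<in>UNIV. ennreal (pmf (start_pmf \<omega>) i) * (\<Sum>j\<in>UNIV. ennreal (h \<omega> 0 $ i $ j) * \<Phi> (env_shift 1 \<omega>) j))
      = (\<Sum>i\<in>UNIV. \<Sum>j\<in>UNIV. ennreal (pi_vec p q r \<omega> $ i * h \<omega> 0 $ i $ j) * \<Phi> (env_shift 1 \<omega>) j)"
      using st(1) nn by (simp add: pmf_start_pmf_eq sum_distrib_left ennreal_mult mult.assoc stationary_start_def)
    also have "\<dots> = (\<Sum>j\<in>UNIV. \<Sum>i\<in>UNIV. ennreal (pi_vec p q r \<omega> $ i * h \<omega> 0 $ i $ j) * \<Phi> (env_shift 1 \<omega>) j)"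
      by (rule sum.swap)
    also have "\<dots> = (\<Sum>j\<in>UNIV. ennreal (pi_vec p q r (env_shift 1 \<omega>) $ j) * \<Phi> (env_shift 1 \<omega>) j)"
      using st(1) nn by (simp add: pi_vec_shift[OF sp st] stationary_start_def flip: sum_distrib_right)
    finally show "(\<Sum>i\<in>UNIV. ennreal (pmf (start_pmf \<omega>) i) * (\<integral>\<^sup>+X. indicator B (path_after 1 (increments X)) \<partial>chain (walk \<omega>) (0, i)))
      = \<Psi> (env_shift 1 \<omega>)"
      unfolding \<Phi> \<Psi>_def pmf_start_pmf_eq[OF st(2)] .
  qed
  also have "\<dots> = (\<integral>\<^sup>+\<omega>. \<Psi> \<omega> \<partial>P)"
    using fwd.nn_integral_funpow_T[of \<Psi> 1] by simp
  also have "\<dots> = (\<integral>\<^sup>+s. indicator B s \<partial>increment_law)"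
    unfolding \<Psi>_def \<Phi>_def by (rule nn_integral_increment_law[symmetric]) measurable
  finally show "emeasure (distr increment_law increment_law (path_after 1)) B = emeasure increment_law B" by simp
qed simp

abbreviation "m \<equiv> mean_crossing_time P p q r \<zeta>"

lemma nn_integral_increment: "(\<integral>\<^sup>+s. ennreal (real (s 0)) \<partial>increment_law) = m"
proof -
  have "(\<integral>\<^sup>+s. ennreal (real (s 0)) \<partial>increment_law)
    = (\<integral>\<^sup>+\<omega>. (\<Sum>i\<in>UNIV. ennreal (pmf (start_pmf \<omega>) i) * (\<integral>\<^sup>+X. ennreal (real (increments X 0)) \<partial>chain (walk \<omega>) (0, i))) \<partial>P)"
    by (rule nn_integral_increment_law) measurable
  also have "\<dots> = m"
    unfolding mean_crossing_time_def
  proof (rule nn_integral_cong_AE, use AE_good AE_stationary_start in eventually_elim)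
    fix \<omega> assume good: "good \<omega>" and st: "stationary_start \<omega>"
    have "(\<integral>\<^sup>+X. ennreal (real (increments X 0)) \<partial>chain (walk \<omega>) (0, i)) = (\<integral>\<^sup>+X. passage_time 1 X \<partial>chain (walk \<omega>) (0, i))" for i
      by (rule nn_integral_cong_AE, rule AE_mp[OF AE_ascending[OF good]]) (auto intro!: AE_I2 simp: ascending_passage_time)
    then show "(\<Sum>i\<in>UNIV. ennreal (pmf (start_pmf \<omega>) i) * (\<integral>\<^sup>+X. ennreal (real (increments X 0)) \<partial>chain (walk \<omega>) (0, i)))
      = (\<Sum>i\<in>UNIV. ennreal (pi_vec p q r \<omega> $ i) * crossing_series q r \<zeta> \<omega> i)"
      by (simp add: crossing_series_eq[OF good] pmf_start_pmf_eq[OF st])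
  qed
  finally show ?thesis .
qed

sublocale increments: measure_preserving increment_law "path_after 1"
  by (intro measure_preserving.intro prob_space_increment_law measure_preserving_axioms.intro distr_increment_law)
    (simp add: measurable_cong_sets[OF sets_increment_law sets_increment_law])

text \<open>A crossing takes at least one step. This keeps \<open>1 / m\<close> finite.\<close>

lemma m_ge_1: "1 \<le> m"
proof -
  have "AE s in increment_law. 1 \<le> s 0"
  proof (rule AE_increment_law)
    show "AE \<omega> in P. \<forall>i. AE X in chain (walk \<omega>) (0, i). 1 \<le> increments X 0"
      using AE_good
      by (eventually_elim, intro allI) (rule eventually_mono[OF AE_ascending ascending_increments_0])
  qed measurable
  then have "(\<integral>\<^sup>+s. 1 \<partial>increment_law) \<le> (\<integral>\<^sup>+s. ennreal (real (s 0)) \<partial>increment_law)"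
    by (intro nn_integral_mono_AE) (auto elim!: eventually_mono)
  then show ?thesis
    using increments.emeasure_space_1 by (simp add: nn_integral_increment)
qed

text \<open>Bounds that hold for every start in almost every environment pass to
  \<open>increment_law\<close>, where \<open>first_time\<close> is a Birkhoff sum and the one-sided
  averaging bounds apply.\<close>

lemma mean_bounds:
  assumes c: "0 < c"
  shows "(AE \<omega> in P. \<forall>i. AE X in chain (walk \<omega>) (0, i). \<exists>n\<ge>1. c * real n \<le> real (first_time X n)) \<Longrightarrow> ennreal c \<le> m"
    and "(AE \<omega> in P. \<forall>i. AE X in chain (walk \<omega>) (0, i). \<exists>n\<ge>1. real (first_time X n) \<le> c * real n) \<Longrightarrow> m \<le> ennreal c"
proof -
  have birkhoff: "(\<Sum>k<n. ennreal (real ((path_after 1 ^^ k) s 0))) = ennreal (real (\<Sum>k<n. s k))" for n and s :: "nat \<Rightarrow> nat"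
    by (simp only: path_after_funpow) simp
  {
    assume AE: "AE \<omega> in P. \<forall>i. AE X in chain (walk \<omega>) (0, i). \<exists>n\<ge>1. c * real n \<le> real (first_time X n)"
    have "AE s in increment_law. \<exists>n\<ge>1. c * real n \<le> real (\<Sum>k<n. s k)"
    proof (rule AE_increment_law)
      show "AE \<omega> in P. \<forall>i. AE X in chain (walk \<omega>) (0, i). \<exists>n\<ge>1. c * real n \<le> real (\<Sum>k<n. increments X k)"
        using AE AE_good
      proof (eventually_elim, intro allI)
        fix \<omega> i assume *: "\<forall>i. AE X in chain (walk \<omega>) (0, i). \<exists>n\<ge>1. c * real n \<le> real (first_time X n)" and "good \<omega>"
        from *[rule_format, of i] AE_ascending[OF \<open>good \<omega>\<close>, of i]
        show "AE X in chain (walk \<omega>) (0, i). \<exists>n\<ge>1. c * real n \<le> real (\<Sum>k<n. increments X k)"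
          by eventually_elim (simp only: sum_increments)
      qed
    qed measurable
    then have "AE s in increment_law. \<exists>n\<ge>1. ennreal (c * real n) \<le> (\<Sum>k<n. ennreal (real ((path_after 1 ^^ k) s 0)))"
      unfolding birkhoff by eventually_elim (meson ennreal_leI)
    from increments.le_nn_integral_if_averages_ge[OF _ _ this] c
    show "ennreal c \<le> m" by (simp add: nn_integral_increment)
  next
    assume AE: "AE \<omega> in P. \<forall>i. AE X in chain (walk \<omega>) (0, i). \<exists>n\<ge>1. real (first_time X n) \<le> c * real n"
    have "AE s in increment_law. \<exists>n\<ge>1. real (\<Sum>k<n. s k) \<le> c * real n"
    proof (rule AE_increment_law)
      show "AE \<omega> in P. \<forall>i. AE X in chain (walk \<omega>) (0, i). \<exists>n\<ge>1. real (\<Sum>k<n. increments X k) \<le> c * real n"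
        using AE AE_good
      proof (eventually_elim, intro allI)
        fix \<omega> i assume *: "\<forall>i. AE X in chain (walk \<omega>) (0, i). \<exists>n\<ge>1. real (first_time X n) \<le> c * real n" and "good \<omega>"
        from *[rule_format, of i] AE_ascending[OF \<open>good \<omega>\<close>, of i]
        show "AE X in chain (walk \<omega>) (0, i). \<exists>n\<ge>1. real (\<Sum>k<n. increments X k) \<le> c * real n"
          by eventually_elim (simp only: sum_increments)
      qed
    qed measurable
    then have "AE s in increment_law. \<exists>n\<ge>1. (\<Sum>k<n. ennreal (real ((path_after 1 ^^ k) s 0))) \<le> ennreal (c * real n)"
      unfolding birkhoff by eventually_elim (meson ennreal_leI)
    from increments.nn_integral_le_if_averages_le[OF _ _ this] c
    show "m \<le> ennreal c" by (simp add: nn_integral_increment)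
  }
qed

text \<open>Two zero-one laws are combined: for a fixed environment the event holds almost surely
  for all starts or fails almost surely for all starts, and which alternative holds is invariant
  under the shift, hence the same for almost every environment.\<close>

lemma first_time_rate_zero_one:
  "(AE \<omega> in P. \<forall>x. AE X in chain (walk \<omega>) x. exceeds c (\<lambda>n. s * real (first_time X n)))
   \<or> (AE \<omega> in P. \<forall>x. AE X in chain (walk \<omega>) x. \<not> exceeds c (\<lambda>n. s * real (first_time X n)))"
proof -
  define E where "E X \<longleftrightarrow> exceeds c (\<lambda>n. s * real (first_time X n))" for X :: "nat \<Rightarrow> int \<times> 'd"
  have E [measurable]: "Measurable.pred path_space E" unfolding E_def by measurable
  have sets: "{X. \<not> E X} \<in> sets path_space"
    using Collect_in_path_sets[OF pred_intros_logic(2)[OF E]] by simp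
  \<comment> \<open>Because of the dichotomy a single start decides, which makes the alternative a
    measurable event of the environment.\<close>
  define Z where "Z \<omega> \<longleftrightarrow> emeasure (chain (walk \<omega>) (0, undefined)) {X. \<not> E X} = 0" for \<omega>
  have Z [measurable]: "Measurable.pred P Z"
    unfolding Z_def using emeasure_chain_measurable[OF sets, of undefined] by measurable
  have AE_E: "(AE X in chain (walk \<omega>) x. E X) \<longleftrightarrow> emeasure (chain (walk \<omega>) x) {X. \<not> E X} = 0" for \<omega> x
    using sets by (subst AE_iff_measurable[of "{X. \<not> E X}"]) auto
  obtain e where e: "0 < e"
    "AE \<omega> in P. \<forall>N. \<exists>m\<ge>N. \<forall>i j. e \<le> h \<omega> (int m) $ i $ j"
    by (rule AE_uniformly_positive)
  have dich: "AE \<omega> in P. good \<omega> \<and> ((\<forall>x. AE X in chain (walk \<omega>) x. E X) \<or> (\<forall>x. AE X in chain (walk \<omega>) x. \<not> E X))"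
    using e(2) AE_good
  proof eventually_elim
    case (elim \<omega>)
    then show ?case
      using strip_walk.first_time_zero_one[OF strip_walk[OF good_in_space] good_stochastic e(1)]
      unfolding E_def by blast
  qed
  have excl: "\<not> ((AE X in chain (walk \<omega>) x. E X) \<and> (AE X in chain (walk \<omega>) x. \<not> E X))" for \<omega> x
  proof
    interpret ch: prob_space "chain (walk \<omega>) x" by (rule prob_space_chain)
    assume "(AE X in chain (walk \<omega>) x. E X) \<and> (AE X in chain (walk \<omega>) x. \<not> E X)"
    then have "AE X in chain (walk \<omega>) x. E X" "AE X in chain (walk \<omega>) x. \<not> E X" by auto
    then have "AE X in chain (walk \<omega>) x. False" by eventually_elim auto
    then show False by simp
  qed
  have "AE \<omega> in P. Z (env_shift 1 \<omega>) \<longleftrightarrow> Z \<omega>"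
    using dich
  proof eventually_elim
    case (elim \<omega>)
    have sp: "\<omega> \<in> space P" using elim by (simp add: good_in_space)
    \<comment> \<open>Translation shifts the index of \<open>first_time\<close> by one, which does
      not affect \<open>exceeds\<close>. So the shifted environment asks the same question from
      level 1, and the answer does not depend on the start.\<close>
    have "translate 1 -` {X. \<not> E X} = {X. \<not> E X}"
      using exceeds_cong_shift[of c "\<lambda>n. s * real (first_time X n)" 0 for X]
      by (auto simp: E_def first_time_translate)
    then have "Z (env_shift 1 \<omega>) \<longleftrightarrow> (AE X in chain (walk \<omega>) (1, undefined). E X)"
      unfolding Z_def AE_E using emeasure_chain_translate[OF sp sets, of 1 0 undefined] by simp
    moreover have "Z \<omega> \<longleftrightarrow> (AE X in chain (walk \<omega>) (0, undefined). E X)"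
      unfolding Z_def AE_E ..
    ultimately show ?case using elim excl by blast
  qed
  from fwd.AE_zero_one[OF Z this] show ?thesis
    unfolding E_def[symmetric]
  proof
    assume "AE \<omega> in P. Z \<omega>"
    with dich have "AE \<omega> in P. \<forall>x. AE X in chain (walk \<omega>) x. E X"
      by eventually_elim (use AE_E Z_def excl in blast)
    then show "(AE \<omega> in P. \<forall>x. AE X in chain (walk \<omega>) x. E X) \<or> (AE \<omega> in P. \<forall>x. AE X in chain (walk \<omega>) x. \<not> E X)" ..
  next
    assume "AE \<omega> in P. \<not> Z \<omega>"
    with dich have "AE \<omega> in P. \<forall>x. AE X in chain (walk \<omega>) x. \<not> E X"
      by eventually_elim (use AE_E Z_def in blast)
    then show "(AE \<omega> in P. \<forall>x. AE X in chain (walk \<omega>) x. E X) \<or> (AE \<omega> in P. \<forall>x. AE X in chain (walk \<omega>) x. \<not> E X)" ..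
  qed
qed

text \<open>In the other alternative of the zero-one law \<open>mean_bounds\<close> would give
  \<open>c \<le> m\<close>.\<close>

lemma AE_first_time_upper:
  assumes "0 < c" "m < ennreal c"
  shows "AE \<omega> in P. \<forall>x. AE X in chain (walk \<omega>) x. \<not> exceeds c (\<lambda>n. real (first_time X n))"
proof -
  have "\<not> (AE \<omega> in P. \<forall>x. AE X in chain (walk \<omega>) x. exceeds c (\<lambda>n. real (first_time X n)))"
  proof
    assume *: "AE \<omega> in P. \<forall>x. AE X in chain (walk \<omega>) x. exceeds c (\<lambda>n. real (first_time X n))"
    have ex: "\<exists>n\<ge>1. c * real n \<le> f n" if "exceeds c f" for f
      using exceeds_frequently[OF that, of 1] by (meson less_imp_le)
    have "ennreal c \<le> m"
      by (rule mean_bounds(1)[OF assms(1)]) (use * in eventually_elim, intro allI, drule spec, erule eventually_mono, erule ex)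
    with assms(2) show False by simp
  qed
  then show ?thesis using first_time_rate_zero_one[of c 1] by simp
qed

text \<open>With negated times, \<open>exceeds (- c)\<close> says that the liminf of
  \<open>first_time X n / n\<close> is below \<open>c\<close>; having this almost surely would give
  \<open>m \<le> c\<close>.\<close>

lemma AE_first_time_lower:
  assumes "0 < c" "ennreal c < m"
  shows "AE \<omega> in P. \<forall>x. AE X in chain (walk \<omega>) x. \<not> exceeds (- c) (\<lambda>n. - real (first_time X n))"
proof -
  have "\<not> (AE \<omega> in P. \<forall>x. AE X in chain (walk \<omega>) x. exceeds (- c) (\<lambda>n. - real (first_time X n)))"
  proof
    assume *: "AE \<omega> in P. \<forall>x. AE X in chain (walk \<omega>) x. exceeds (- c) (\<lambda>n. - real (first_time X n))"
    have ex: "\<exists>n\<ge>1. f n \<le> c * real n" if "exceeds (- c) (\<lambda>n. - f n)" for f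
      using exceeds_frequently[OF that, of 1] by (auto intro: less_imp_le)
    have "m \<le> ennreal c"
      by (rule mean_bounds(2)[OF assms(1)]) (use * in eventually_elim, intro allI, drule spec, erule eventually_mono, erule ex)
    with assms(2) show False by simp
  qed
  then show ?thesis using first_time_rate_zero_one[of "- c" "- 1"] by simp
qed

text \<open>Rational rates keep the conditions countable, and the absence of late visits to 0
  replaces finiteness of the set of visits, so that the event is measurable.\<close>

definition typical :: "(nat \<Rightarrow> int \<times> 'd) \<Rightarrow> bool" where
  "typical X \<longleftrightarrow> ascending X \<and> (\<exists>N. \<forall>t\<ge>N. fst (X t) \<noteq> 0) \<and>
    (\<forall>c::rat. (0 < c \<and> m < ennreal (of_rat c) \<longrightarrow> \<not> exceeds (of_rat c) (\<lambda>n. real (first_time X n))) \<and>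
      (0 < c \<and> ennreal (of_rat c) < m \<longrightarrow> \<not> exceeds (- of_rat c) (\<lambda>n. - real (first_time X n))))"

lemma typical_measurable [measurable]: "Measurable.pred path_space typical"
  unfolding typical_def by measurable

lemma AE_typical: "AE \<omega> in P. \<forall>i. AE X in chain (walk \<omega>) (0, i). typical X"
proof -
  have "AE \<omega> in P. 0 < c \<and> m < ennreal (of_rat c) \<longrightarrow>
      (\<forall>x. AE X in chain (walk \<omega>) x. \<not> exceeds (of_rat c) (\<lambda>n. real (first_time X n)))" for c :: rat
    using AE_first_time_upper[of "of_rat c"] by (cases "0 < c \<and> m < ennreal (of_rat c)") auto
  moreover have "AE \<omega> in P. 0 < c \<and> ennreal (of_rat c) < m \<longrightarrow>
      (\<forall>x. AE X in chain (walk \<omega>) x. \<not> exceeds (- of_rat c) (\<lambda>n. - real (first_time X n)))" for c :: rat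
    using AE_first_time_lower[of "of_rat c"] by (cases "0 < c \<and> ennreal (of_rat c) < m") auto
  ultimately have "AE \<omega> in P. \<forall>c::rat. (0 < c \<and> m < ennreal (of_rat c) \<longrightarrow>
      (\<forall>x. AE X in chain (walk \<omega>) x. \<not> exceeds (of_rat c) (\<lambda>n. real (first_time X n)))) \<and>
      (0 < c \<and> ennreal (of_rat c) < m \<longrightarrow>
      (\<forall>x. AE X in chain (walk \<omega>) x. \<not> exceeds (- of_rat c) (\<lambda>n. - real (first_time X n))))"
    by (simp add: AE_all_countable)
  with AE_good AE_finite_visits show ?thesis
  proof (eventually_elim, intro allI)
    fix \<omega> and i :: 'd
    assume good: "good \<omega>" and fin: "\<forall>i. AE X in chain (walk \<omega>) (0, i). finite {t. fst (X t) = 0}"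
      and rates: "\<forall>c::rat. (0 < c \<and> m < ennreal (of_rat c) \<longrightarrow>
        (\<forall>x. AE X in chain (walk \<omega>) x. \<not> exceeds (of_rat c) (\<lambda>n. real (first_time X n)))) \<and>
        (0 < c \<and> ennreal (of_rat c) < m \<longrightarrow>
        (\<forall>x. AE X in chain (walk \<omega>) x. \<not> exceeds (- of_rat c) (\<lambda>n. - real (first_time X n))))"
    have "AE X in chain (walk \<omega>) (0, i). \<forall>c::rat.
      (0 < c \<and> m < ennreal (of_rat c) \<longrightarrow> \<not> exceeds (of_rat c) (\<lambda>n. real (first_time X n))) \<and>
      (0 < c \<and> ennreal (of_rat c) < m \<longrightarrow> \<not> exceeds (- of_rat c) (\<lambda>n. - real (first_time X n)))"
      unfolding AE_all_countable using rates by (intro allI AE_conjI AE_impI) auto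
    with AE_ascending[OF good, of i] fin[rule_format, of i]
    show "AE X in chain (walk \<omega>) (0, i). typical X"
    proof eventually_elim
      case (elim X)
      obtain b where "\<And>t. fst (X t) = 0 \<Longrightarrow> t \<le> b"
        using elim(2) by (auto simp: finite_nat_set_iff_bounded_le)
      then have "\<forall>t\<ge>Suc b. fst (X t) \<noteq> 0" by (meson not_less_eq_eq)
      with elim show ?case unfolding typical_def by blast
    qed
  qed
qed

lemma typical_speed:
  assumes "typical X"
  shows "(\<lambda>n. real_of_int (fst (X n)) / real n) \<longlonglongrightarrow> enn2real (1 / m)"
    and "(\<lambda>n. ereal (real n) / ereal_of_enat (hitting_time X (int n))) \<longlonglongrightarrow> ereal (enn2real (1 / m))"
proof -
  have asc: "ascending X" using assms by (simp add: typical_def)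
  have sf: "skip_free X" "fst (X 0) = 0" "\<And>L. 0 \<le> L \<Longrightarrow> hits L X" using asc by (auto simp: ascending_def)
  have up: "\<forall>\<^sub>F n in sequentially. real (first_time X n) \<le> c * real n" if c: "0 < c" "m < ennreal c" for c
  proof -
    obtain a where a: "0 \<le> a" "m = ennreal a" using c by (cases m) auto
    then have "a < c" using c by (simp add: ennreal_less_iff)
    then obtain b where b: "a < of_rat b" "of_rat b < c" using of_rat_dense by blast
    then have "0 < b" using a by (metis le_less_trans zero_less_of_rat_iff)
    then have "\<not> exceeds (of_rat b) (\<lambda>n. real (first_time X n))"
      using assms a b by (auto simp: typical_def ennreal_less_iff)
    from not_exceeds_eventually[OF this b(2)] show ?thesis .
  qed
  have low: "\<forall>\<^sub>F n in sequentially. c * real n \<le> real (first_time X n)" if c: "0 < c" "ennreal c < m" for c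
  proof -
    obtain a where a: "c < a" "ennreal a \<le> m"
    proof (cases m)
      case (real r)
      then show ?thesis using that[of r] c by (auto simp: ennreal_less_iff)
    next
      case top
      then show ?thesis using that[of "c + 1"] by simp
    qed
    then obtain b where b: "c < of_rat b" "of_rat b < a" using of_rat_dense by blast
    then have "0 < b" using c by (metis less_trans zero_less_of_rat_iff)
    have "ennreal (of_rat b) < ennreal a" using b c by (intro ennreal_lessI) auto
    then have "\<not> exceeds (- of_rat b) (\<lambda>n. - real (first_time X n))"
      using assms a \<open>0 < b\<close> by (auto simp: typical_def)
    from not_exceeds_eventually[OF this, of "- c"] b show ?thesis by simp
  qed
  obtain N where N: "\<forall>t\<ge>N. fst (X t) \<noteq> 0" using assms by (auto simp: typical_def)
  have "{t. fst (X t) = 0} \<subseteq> {..<N}"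
  proof
    fix t assume "t \<in> {t. fst (X t) = 0}"
    then show "t \<in> {..<N}" using N[rule_format, of t] by (cases "N \<le> t") auto
  qed
  then have "finite {t. fst (X t) = 0}" by (rule finite_subset) simp
  note nonneg = ascending_eventually_nonneg[OF asc this]
  show "(\<lambda>n. real_of_int (fst (X n)) / real n) \<longlonglongrightarrow> enn2real (1 / m)"
    by (rule speed_of_position[OF sf m_ge_1 up low nonneg])
  show "(\<lambda>n. ereal (real n) / ereal_of_enat (hitting_time X (int n))) \<longlonglongrightarrow> ereal (enn2real (1 / m))"
    by (rule speed_of_hitting_time[OF sf m_ge_1 up low nonneg])
qed

lemma AE_annealed_typical:
  assumes \<mu>: "\<mu> \<in> initial_laws S"
  shows "AE z in annealed P p q r \<mu>. typical (snd z)"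
proof -
  let ?B = "{X. \<not> typical X}"
  have B: "?B \<in> sets path_space"
    using Collect_in_path_sets[OF pred_intros_logic(2)[OF typical_measurable]] by simp
  have "emeasure (annealed P p q r \<mu>) (space P \<times> ?B) = (\<integral>\<^sup>+\<omega>\<in>space P. emeasure (quenched p q r \<omega> (\<mu> \<omega>)) ?B \<partial>P)"
    by (rule emeasure_annealed_Times[OF prob_space_axioms sets_P tm \<mu> _ B]) simp
  also have "\<dots> = (\<integral>\<^sup>+\<omega>. 0 \<partial>P)"
  proof (rule nn_integral_cong_AE, use AE_typical in eventually_elim)
    fix \<omega> assume *: "\<forall>i. AE X in chain (walk \<omega>) (0, i). typical X"
    have "emeasure (chain (walk \<omega>) (0, i)) ?B = 0" for i
      using *[rule_format, of i] B by (subst (asm) AE_iff_measurable[of ?B]) auto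
    then have "(\<integral>\<^sup>+X. indicator ?B X \<partial>quenched p q r \<omega> (\<mu> \<omega>)) = 0"
      using B by (subst nn_integral_quenched) auto
    moreover have "?B \<in> sets (quenched p q r \<omega> (\<mu> \<omega>))" using B by (simp add: quenched_def)
    ultimately show "emeasure (quenched p q r \<omega> (\<mu> \<omega>)) ?B * indicator (space P) \<omega> = 0" by simp
  qed
  finally have null: "emeasure (annealed P p q r \<mu>) (space P \<times> ?B) = 0" by simp
  have sets: "sets (annealed P p q r \<mu>) = sets (P \<Otimes>\<^sub>M path_space)"
    unfolding annealed_def by (rule sets_bind) (auto simp: not_empty)
  have "space (annealed P p q r \<mu>) = space P \<times> UNIV"
    using sets_eq_imp_space_eq[OF sets] by (simp add: space_pair_measure)
  then show ?thesis
    using null B sets by (intro AE_I[of _ _ "space P \<times> ?B"]) auto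
qed

end

theorem theorem2p1:
  fixes S :: "'s measure" and P :: "'s env measure"
    and p q r :: "'s \<Rightarrow> real ^ 'd::finite ^ 'd"
    and \<zeta> :: "int \<Rightarrow> 's env \<Rightarrow> real ^ 'd ^ 'd"
  assumes "prob_space P" and "sets P = sets (env_space S)"
    and "transition_matrices S p q r"
    and "condition_C S P p q r"
    and "stationary_solution P p q r \<zeta>"
    and "condition_D P q r \<zeta>"
  shows "\<exists>v\<ge>0. ennreal v = 1 / mean_crossing_time P p q r \<zeta> \<and>
    (\<forall>\<mu>\<in>initial_laws S. AE (\<omega>, X) in annealed P p q r \<mu>.
       (\<lambda>n. real_of_int (fst (X n)) / real n) \<longlonglongrightarrow> v \<and>
       (\<lambda>n. ereal (real n) / ereal_of_enat (hitting_time X (int n))) \<longlonglongrightarrow> ereal v)"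
proof -
  interpret strip_rwre P S p q r \<zeta>
    using assms
    by (intro strip_rwre.intro random_environment.intro random_environment_axioms.intro strip_rwre_axioms.intro)
  \<comment> \<open>In \<open>ennreal\<close> the quotient \<open>1 / 0\<close> is \<infinity>,
    which \<open>enn2real\<close> would send to 0.\<close>
  have "m \<noteq> 0" using m_ge_1 by auto
  then have fin: "1 / m < \<top>" by (simp add: ennreal_divide_eq_top_iff flip: less_top)
  show ?thesis
  proof (intro exI[of _ "enn2real (1 / m)"] conjI ballI)
    show "ennreal (enn2real (1 / m)) = 1 / m" using fin by simp
    fix \<mu> :: "'s env \<Rightarrow> 'd pmf" assume "\<mu> \<in> initial_laws S"
    from AE_annealed_typical[OF this]
    show "AE (\<omega>, X) in annealed P p q r \<mu>.
       (\<lambda>n. real_of_int (fst (X n)) / real n) \<longlonglongrightarrow> enn2real (1 / m) \<and>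
       (\<lambda>n. ereal (real n) / ereal_of_enat (hitting_time X (int n))) \<longlonglongrightarrow> ereal (enn2real (1 / m))"
      by eventually_elim (auto simp: typical_speed)
  qed simp
qed

end
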